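(* Let $n\in\mathbb{N}$, $\vartheta\in(0,1)$, $\alpha,\beta\in(0,1)$, and $\mathbf{a}\in\mathbb{R}^n_+$ with $\|\mathbf{a}\|=1$. The solution $w=w(\mathbf{x},t)$ to the fractional equation $$\frac{\partial^\beta w}{\partial t^\beta}=-(-\triangle)^\vartheta w-(\mathbf{a}\cdot\nabla)^\alpha w,\qquad(\mathbf{x},t)\in\mathbb{R}^n\times(0,+\infty),$$ subject to the initial condition $w(\mathbf{x},0)=\delta(\mathbf{x})$, is given by $$w(\mathbf{x},t)=\int_0^\infty dz\int_{\mathbb{R}^n_+}d\mathbf{s}\;\mathcal{T}_{2\vartheta}(\mathbf{x}-\mathbf{s},z)\,h_\alpha(\mathbf{a}\cdot\mathbf{s},z)\,l_\beta(z,t),$$ where $\mathcal{T}_{2\vartheta}(\mathbf{x},t)$, $\mathbf{x}\in\mathbb{R}^n$, $t>0$, is the law of the isotropic stable L\'evy process $\mathbf{S}_{2\vartheta}(t)$; $h_\alpha(x,t)$, $x\in[0,+\infty)$, $t>0$, is the law of the stable subordinator $\mathfrak{H}^\alpha_t$; and $l_\beta(x,t)$, $x\in(0,+\infty)$, $t>0$, is the law of the inverse process $\mathfrak{L}^\beta_t$.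
   Context: $\mathbb{R}^n_+$ is the non-negative orthant, $\mathbf{a}\cdot\mathbf{x}=\sum_ka_kx_k$, $\mathbf{a}\cdot\nabla=\sum_ka_k\partial_{x_k}$, and $\widehat{u}(\boldsymbol{\xi})=\int_{\mathbb{R}^n}e^{i\boldsymbol{\xi}\cdot\mathbf{x}}u(\mathbf{x})\,d\mathbf{x}$. The fractional directional derivative of order $\alpha\in(0,1)$ is $(\mathbf{a}\cdot\nabla)^\alpha=\frac{(\mathbf{a}\cdot\nabla)}{\Gamma(1-\alpha)}\int_0^\infty ds\,s^{-\alpha}e^{-s(\mathbf{a}\cdot\nabla)}$, where $e^{-s(\mathbf{a}\cdot\nabla)}f(\mathbf{x})=f(\mathbf{x}-s\mathbf{a})$. The fractional Laplacian $(-\triangle)^\vartheta$ is the operator with $\widehat{(-\triangle)^\vartheta u}(\boldsymbol{\xi})=\|\boldsymbol{\xi}\|^{2\vartheta}\widehat{u}(\boldsymbol{\xi})$. For $\beta\in(0,1)$, $\frac{\partial^\beta f}{\partial t^\beta}(t)=\frac{1}{\Gamma(1-\beta)}\int_0^t\frac{f'(s)}{(t-s)^\beta}ds$ is the Dzerbayshan-Caputo derivative. $\mathbf{S}_{2\vartheta}(t)$ is the $\mathbb{R}^n$-valued isotropic stable process with $\mathbb{E}e^{i\boldsymbol{\xi}\cdot\mathbf{S}_{2\vartheta}(t)}=e^{-t\|\boldsymbol{\xi}\|^{2\vartheta}}$. $\mathfrak{H}^\alpha_t$ is the $\alpha$-stable subordinator, $\mathbb{E}e^{-\xi\mathfrak{H}^\alpha_t}=e^{-t\xi^\alpha}$.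 $\mathfrak{L}^\beta_t=\inf\{s\ge0:\mathfrak{H}^\beta_s\notin(0,t)\}$ is the inverse of the $\beta$-stable subordinator. Convention of the paper: since $\mathbf{s}=r\mathbf{a}$ is taken to be equivalent to $\mathbf{a}\cdot\mathbf{s}=r$, the distributions $\delta(\mathbf{s}-r\mathbf{a})$ and $\delta(\mathbf{a}\cdot\mathbf{s}-r)$ are identified, so that $h_\alpha(\mathbf{a}\cdot\mathbf{s},z)$, as a distribution in $\mathbf{s}\in\mathbb{R}^n_+$, stands for $\int_0^\infty h_\alpha(r,z)\,\delta(\mathbf{s}-r\mathbf{a})\,dr$ and has Fourier transform $e^{-z(-i\mathbf{a}\cdot\boldsymbol{\xi})^\alpha}$ (principal branch).
   Formalization: The inverse process is taken as the infimum over s>0 rather than s≥0 of times when the stable subordinator is outside (0,t): since the subordinator starts at 0, which is not in (0,t), allowing s=0 would make the inverse process identically 0. *)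

theory Defs
  imports "HOL-Probability.Probability"
begin

section \<open>Operators on test functions\<close>

primrec iterated_partial :: "'a::euclidean_space list \<Rightarrow> ('a \<Rightarrow> complex) \<Rightarrow> 'a \<Rightarrow> complex" where
  "iterated_partial [] f = f"
| "iterated_partial (b # bs) f = (\<lambda>x. frechet_derivative (iterated_partial bs f) (at x) b)"

definition schwartz :: "('a::euclidean_space \<Rightarrow> complex) \<Rightarrow> bool" where
  "schwartz f \<longleftrightarrow>
     (\<forall>bs. set bs \<subseteq> Basis \<longrightarrow>
        (\<forall>x. iterated_partial bs f differentiable (at x)) \<and>
        (\<forall>k::nat. bounded (range (\<lambda>x. (norm x ^ k) *\<^sub>R iterated_partial bs f x))))"

definition fourier :: "('a::euclidean_space \<Rightarrow> complex) \<Rightarrow> 'a \<Rightarrow> complex" where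
  "fourier u \<xi> = (CLINT x|lborel. exp (\<i> * complex_of_real (\<xi> \<bullet> x)) * u x)"

text \<open>The operator with Fourier multiplier \<open>norm \<xi> powr (2 * \<theta>)\<close>, written out by means of the
  inverse of the (unnormalised, positive sign) transform above.\<close>

definition frac_laplacian ::
    "real \<Rightarrow> ('a::euclidean_space \<Rightarrow> complex) \<Rightarrow> 'a \<Rightarrow> complex" where
  "frac_laplacian \<theta> u x =
     (1 / complex_of_real ((2 * pi) ^ DIM('a))) *
     (CLINT \<xi>|lborel. exp (- \<i> * complex_of_real (\<xi> \<bullet> x)) *
        (complex_of_real (norm \<xi> powr (2 * \<theta>)) * fourier u \<xi>))"

text \<open>\<open>(a \<cdot> \<nabla>)\<close> is the Frechet derivative applied to the vector \<open>a\<close>.\<close>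

definition frac_dir_deriv ::
    "real \<Rightarrow> 'a::euclidean_space \<Rightarrow> ('a \<Rightarrow> complex) \<Rightarrow> 'a \<Rightarrow> complex" where
  "frac_dir_deriv \<alpha> a f x =
     (1 / Gamma (1 - \<alpha>)) *\<^sub>R
     frechet_derivative
       (\<lambda>y. LINT s:{0<..}|lborel. (s powr (- \<alpha>)) *\<^sub>R f (y - s *\<^sub>R a)) (at x) a"

section \<open>The same operators on integrable functions, in the sense of distributions\<close>

definition pairing :: "('a::euclidean_space \<Rightarrow> real) \<Rightarrow> ('a \<Rightarrow> complex) \<Rightarrow> complex" where
  "pairing u \<phi> = (CLINT x|lborel. complex_of_real (u x) * \<phi> x)"

text \<open>The multiplier of the fractional Laplacian is even, so the operator is its own transpose.\<close>

definition distr_frac_laplacian ::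
    "real \<Rightarrow> ('a::euclidean_space \<Rightarrow> real) \<Rightarrow> ('a \<Rightarrow> complex) \<Rightarrow> complex" where
  "distr_frac_laplacian \<theta> u \<phi> = pairing u (frac_laplacian \<theta> \<phi>)"

text \<open>Translation by \<open>s a\<close> has transpose translation by \<open>- s a\<close>, and \<open>(a \<cdot> \<nabla>)\<close> has transpose
  \<open>(- a) \<cdot> \<nabla>\<close>; hence the transpose of the fractional derivative along \<open>a\<close> is the one along \<open>- a\<close>.\<close>

definition distr_frac_dir_deriv ::
    "real \<Rightarrow> 'a::euclidean_space \<Rightarrow> ('a \<Rightarrow> real) \<Rightarrow> ('a \<Rightarrow> complex) \<Rightarrow> complex" where
  "distr_frac_dir_deriv \<alpha> a u \<phi> = pairing u (frac_dir_deriv \<alpha> (- a) \<phi>)"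

section \<open>Dzerbayshan-Caputo derivative\<close>

text \<open>The predicate includes the existence of the derivative and of the integral.\<close>

definition has_caputo_derivative ::
    "real \<Rightarrow> (real \<Rightarrow> complex) \<Rightarrow> complex \<Rightarrow> real \<Rightarrow> bool" where
  "has_caputo_derivative \<beta> f D t \<longleftrightarrow>
     (\<forall>s\<in>{0<..<t}. f differentiable (at s)) \<and>
     set_integrable lborel {0<..<t} (\<lambda>s. vector_derivative f (at s) /\<^sub>R ((t - s) powr \<beta>)) \<and>
     D = (1 / Gamma (1 - \<beta>)) *\<^sub>R
           (LINT s:{0<..<t}|lborel. vector_derivative f (at s) /\<^sub>R ((t - s) powr \<beta>))"

section \<open>The Cauchy problem with initial datum the Dirac mass at the origin\<close>

text \<open>A solution is a family of integrable functions, with norms bounded on bounded time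
  intervals, that satisfies the equation as an identity of tempered distributions in \<open>x\<close> and
  tends to the Dirac mass as \<open>t\<close> decreases to \<open>0\<close>.\<close>

definition solves_frac_problem ::
    "real \<Rightarrow> real \<Rightarrow> real \<Rightarrow> 'a::euclidean_space \<Rightarrow> ('a \<Rightarrow> real \<Rightarrow> real) \<Rightarrow> bool" where
  "solves_frac_problem \<theta> \<alpha> \<beta> a w \<longleftrightarrow>
     (\<forall>t>0. integrable lborel (\<lambda>x. w x t)) \<and>
     (\<forall>b>0. \<exists>C. \<forall>t\<in>{0<..b}. (LINT x|lborel. \<bar>w x t\<bar>) \<le> C) \<and>
     (\<forall>\<phi>. schwartz \<phi> \<longrightarrow>
        (\<forall>t>0. has_caputo_derivative \<beta> (\<lambda>s. pairing (\<lambda>x. w x s) \<phi>)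
           (- distr_frac_laplacian \<theta> (\<lambda>x. w x t) \<phi> - distr_frac_dir_deriv \<alpha> a (\<lambda>x. w x t) \<phi>) t) \<and>
        ((\<lambda>t. pairing (\<lambda>x. w x t) \<phi>) \<longlongrightarrow> \<phi> 0) (at_right 0))"

section \<open>Stable processes\<close>

text \<open>Processes are indexed by \<open>real\<close>; only times \<open>t \<ge> 0\<close> are constrained.\<close>

definition levy_process :: "'w measure \<Rightarrow> (real \<Rightarrow> 'w \<Rightarrow> 'a::euclidean_space) \<Rightarrow> bool" where
  "levy_process M X \<longleftrightarrow>
     prob_space M \<and>
     (\<forall>t\<ge>0. X t \<in> borel_measurable M) \<and>
     (AE \<omega> in M. X 0 \<omega> = 0) \<and>
     (\<forall>(\<tau> :: nat \<Rightarrow> real) m. 0 \<le> \<tau> 0 \<and> mono \<tau> \<longrightarrow>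
        prob_space.indep_vars M (\<lambda>_. borel) (\<lambda>i \<omega>. X (\<tau> (Suc i)) \<omega> - X (\<tau> i) \<omega>) {..<m}) \<and>
     (\<forall>s\<ge>0. \<forall>r\<ge>0. distr M borel (\<lambda>\<omega>. X (s + r) \<omega> - X s \<omega>) = distr M borel (X r)) \<and>
     (AE \<omega> in M.
        (\<forall>t\<ge>0. ((\<lambda>s. X s \<omega>) \<longlongrightarrow> X t \<omega>) (at_right t)) \<and>
        (\<forall>t>0. \<exists>y. ((\<lambda>s. X s \<omega>) \<longlongrightarrow> y) (at_left t)))"

definition isotropic_stable_process ::
    "real \<Rightarrow> 'w measure \<Rightarrow> (real \<Rightarrow> 'w \<Rightarrow> 'a::euclidean_space) \<Rightarrow> bool" where
  "isotropic_stable_process \<theta> M S \<longleftrightarrow>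
     levy_process M S \<and>
     (\<forall>t\<ge>0. \<forall>\<xi>. (CLINT \<omega>|M. exp (\<i> * complex_of_real (\<xi> \<bullet> S t \<omega>))) =
        complex_of_real (exp (- t * norm \<xi> powr (2 * \<theta>))))"

definition stable_subordinator :: "real \<Rightarrow> 'w measure \<Rightarrow> (real \<Rightarrow> 'w \<Rightarrow> real) \<Rightarrow> bool" where
  "stable_subordinator \<alpha> M H \<longleftrightarrow>
     levy_process M H \<and>
     (AE \<omega> in M. mono_on {0..} (\<lambda>t. H t \<omega>)) \<and>
     (\<forall>t\<ge>0. \<forall>\<xi>\<ge>0. (LINT \<omega>|M. exp (- \<xi> * H t \<omega>)) = exp (- t * \<xi> powr \<alpha>))"

text \<open>The infimum runs over \<open>s > 0\<close>: since \<open>H 0 = 0\<close> does not lie in the open interval \<open>(0, t)\<close>,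
  admitting \<open>s = 0\<close> would make the infimum vanish identically.\<close>

definition inverse_process :: "(real \<Rightarrow> 'w \<Rightarrow> real) \<Rightarrow> real \<Rightarrow> 'w \<Rightarrow> real" where
  "inverse_process H t \<omega> = Inf {s. 0 < s \<and> H s \<omega> \<notin> {0<..<t}}"

text \<open>\<open>f x t\<close> is a density of \<open>X t\<close> for every \<open>t > 0\<close>. A density is determined only up to null sets
  for each \<open>t\<close>; joint measurability makes integrals of \<open>f\<close> with respect to \<open>t\<close> meaningful.\<close>

definition has_density ::
    "'w measure \<Rightarrow> (real \<Rightarrow> 'w \<Rightarrow> 'a::euclidean_space) \<Rightarrow> ('a \<Rightarrow> real \<Rightarrow> real) \<Rightarrow> bool" where
  "has_density M X f \<longleftrightarrow>
     (\<forall>t>0. \<forall>x. 0 \<le> f x t) \<and>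
     (\<forall>t>0. distributed M lborel (X t) (\<lambda>x. ennreal (f x t))) \<and>
     (\<lambda>(x, t). f x t) \<in> borel_measurable (borel \<Otimes>\<^sub>M restrict_space borel {0<..})"

section \<open>The candidate solution\<close>

definition nonneg_orthant :: "(real ^ 'n) set" where
  "nonneg_orthant = {s. \<forall>k. 0 \<le> s $ k}"

text \<open>The measure \<open>\<integral>\<^sub>0\<^sup>\<infinity> h(r) \<delta>(s - r a) dr\<close>, which is what \<open>h(a \<bullet> s) ds\<close> stands for.\<close>

definition ray_measure :: "'a::euclidean_space \<Rightarrow> (real \<Rightarrow> real) \<Rightarrow> 'a measure" where
  "ray_measure a h =
     distr (density lborel (\<lambda>r. indicator {0..} r * ennreal (h r))) borel (\<lambda>r. r *\<^sub>R a)"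

definition stable_mixture ::
    "real ^ 'n \<Rightarrow> (real ^ 'n \<Rightarrow> real \<Rightarrow> real) \<Rightarrow> (real \<Rightarrow> real \<Rightarrow> real) \<Rightarrow>
     (real \<Rightarrow> real \<Rightarrow> real) \<Rightarrow> real ^ 'n \<Rightarrow> real \<Rightarrow> real" where
  "stable_mixture a T h l x t =
     (LINT z:{0<..}|lborel.
        (LINT s:nonneg_orthant|ray_measure a (\<lambda>r. h r z). T (x - s) z) * l z t)"

end

theory Submission imports Defs "HOL-Complex_Analysis.Complex_Analysis" begin

text \<open>The problem becomes scalar under the Fourier transform. Let \<open>L\<close> be the inverse of the subordinator
\<open>K\<close>. For independent \<open>S\<close>, \<open>H\<close>, \<open>L\<close> the mixture is the law of
\<open>S(L\<^sub>t) + H(L\<^sub>t) a\<close>, so its transform at \<open>\<xi>\<close> is \<open>\<integral> exp (- z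
\<Psi>(- \<xi>)) l(z, t) dz\<close> with the symbol \<open>\<Psi>(\<xi>) = norm \<xi> powr (2 \<theta>) + (i a \<bullet>
\<xi>) powr \<alpha>\<close>, which has nonnegative real part. Self-similarity of \<open>K\<close> gives that
\<open>L\<^sub>t\<close> has the law of \<open>t powr \<beta> * Y\<close> with \<open>Y = K\<^sub>1 powr (-
\<beta>)\<close> (\<open>inverse_process_law\<close>), and \<open>E Y^k = k! / Gamma (\<beta> k + 1)\<close>
(\<open>subordinator_inverse_power_moments\<close>). The transform is therefore the Mittag-Leffler series in \<open>-
\<Psi>(- \<xi>) t powr \<beta>\<close> (\<open>fourier_stable_mixture\<close>).

Existence. Each term of that series is a power of \<open>t\<close>, whose Caputo derivative is a Beta integral; summing,
the Caputo derivative of the series \<open>ml z t\<close> is \<open>- z\<close> times the series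
(\<open>abel_integral_ml'\<close>). The transposed operators act on the transform of a Schwartz function
\<open>\<phi>\<close> as multiplication by \<open>\<Psi>\<close> (\<open>distr_operators_schwartz\<close>; for the
directional derivative, which is defined by a singular integral along a ray, this is
\<open>frac_dir_deriv_schwartz\<close>). Hence the pairing of the mixture with \<open>\<phi>\<close> is a superposition
of functions \<open>ml (\<Psi> \<xi>) t\<close> with weight proportional to the transform of \<open>\<phi>\<close>, and
the equation follows by integrating over \<open>\<xi>\<close> (\<open>caputo_superposition\<close>). Letting
\<open>t\<close> tend to \<open>0\<close> leaves the Fourier inversion formula for \<open>\<phi> 0\<close>.

Uniqueness. The functions \<open>exp (i \<xi>0 \<bullet> x - \<epsilon>\<^sup>2 (norm x)\<^sup>2 / 2)\<close> are
Schwartz, and their transforms concentrate at \<open>- \<xi>0\<close> as \<open>\<epsilon>\<close> tends to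
\<open>0\<close>. Limits need not commute with the Caputo derivative, so the equation is first integrated to a Volterra
equation (\<open>caputo_volterra\<close>), where dominated convergence applies. The result
(\<open>solution_fourier_volterra\<close>) is that for every solution \<open>w\<close> the function \<open>f(t)\<close>,
the transform of \<open>w(\<cdot>, t)\<close> at \<open>\<xi>0\<close>, satisfies \<open>f(t) = 1 - \<Psi>(- \<xi>0) /
Gamma \<beta> * \<integral>\<^sub>0\<^sup>t (t - u) powr (\<beta> - 1) f(u) du\<close>. Since \<open>f\<close> is
bounded on bounded intervals, this determines \<open>f\<close> (\<open>volterra_unique\<close>), and the transform
determines the function (\<open>fourier_unique\<close>).

The sign of the argument of \<open>\<Psi>\<close> changes between the two sides because the transform has the kernel
\<open>exp (i \<xi> \<bullet> x)\<close> and Parseval's formula for it pairs frequency \<open>\<xi>\<close> of \<open>\<phi>\<close> with frequency \<open>- \<xi>\<close> of \<open>w\<close>.\<close>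

abbreviation cpx :: "real \<Rightarrow> complex" where "cpx \<equiv> complex_of_real"

section \<open>Limits and derivatives under the integral sign\<close>

text \<open>Limits at a point of a first countable space can be tested on sequences, which reduces the claim to the
  dominated convergence theorem. The set \<open>A\<close> serves one-sided limits: a parameter \<open>e\<close> tending to \<open>0\<close> from
  above is handled as \<open>at 0 within {0<..1}\<close>, where a majorant may use \<open>e \<le> 1\<close>.\<close>

lemma dominated_convergence_within:
  fixes s :: "'p::first_countable_topology \<Rightarrow> 'w \<Rightarrow> 'b::{banach, second_countable_topology}"
  assumes "f \<in> borel_measurable M"
    and "\<And>p. p \<in> A \<Longrightarrow> p \<noteq> p0 \<Longrightarrow> s p \<in> borel_measurable M"
    and "integrable M g"
    and lim: "AE x in M. ((\<lambda>p. s p x) \<longlongrightarrow> f x) (at p0 within A)"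
    and bd: "\<And>p. p \<in> A \<Longrightarrow> p \<noteq> p0 \<Longrightarrow> AE x in M. norm (s p x) \<le> g x"
  shows "((\<lambda>p. \<integral>x. s p x \<partial>M) \<longlongrightarrow> (\<integral>x. f x \<partial>M)) (at p0 within A)"
  unfolding tendsto_at_iff_sequentially comp_def
proof (intro allI impI)
  fix X assume X: "\<forall>i. X i \<in> A - {p0}" "X \<longlonglongrightarrow> p0"
  show "(\<lambda>i. \<integral>x. s (X i) x \<partial>M) \<longlonglongrightarrow> (\<integral>x. f x \<partial>M)"
  proof (rule integral_dominated_convergence)
    show "AE x in M. norm (s (X i) x) \<le> g x" for i
      using bd[of "X i"] X by blast
    show "AE x in M. (\<lambda>i. s (X i) x) \<longlonglongrightarrow> f x"
      using lim by eventually_elim (use X in \<open>auto simp: tendsto_at_iff_sequentially comp_def\<close>)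
  qed (use assms(1-3) X in auto)
qed

text \<open>The mean value inequality bounds the difference quotients by the majorant of the derivatives, and dominated
  convergence applies to the remainder divided by \<open>norm h\<close>. The Frechet form is what the directional derivative
  of an integral requires; with a real or complex parameter it also yields derivatives of Laplace transforms and
  of functions of time.\<close>

lemma has_derivative_integral:
  fixes f :: "'p::real_normed_vector \<Rightarrow> 'w \<Rightarrow> 'b::{banach, second_countable_topology}"
  assumes S: "open S" "x0 \<in> S"
    and int: "\<And>p. p \<in> S \<Longrightarrow> integrable M (f p)"
    and der: "\<And>p x. p \<in> S \<Longrightarrow> x \<in> space M \<Longrightarrow> ((\<lambda>p. f p x) has_derivative f' p x) (at p)"
    and bd: "\<And>p x. p \<in> S \<Longrightarrow> x \<in> space M \<Longrightarrow> onorm (f' p x) \<le> g x"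
    and meas: "\<And>v. (\<lambda>x. f' x0 x v) \<in> borel_measurable M"
    and g: "integrable M g"
  shows "((\<lambda>p. \<integral>x. f p x \<partial>M) has_derivative (\<lambda>v. \<integral>x. f' x0 x v \<partial>M)) (at x0)"
proof -
  obtain e where e: "e > 0" "ball x0 e \<subseteq> S" using S openE by blast
  have f'bd: "norm (f' p x v) \<le> g x * norm v" if "p \<in> S" "x \<in> space M" for p x v
  proof -
    have "bounded_linear (f' p x)" using der[OF that] by (rule has_derivative_bounded_linear)
    then have "norm (f' p x v) \<le> onorm (f' p x) * norm v" by (rule onorm)
    also have "\<dots> \<le> g x * norm v" by (intro mult_right_mono bd that) auto
    finally show ?thesis .
  qed
  have int': "integrable M (\<lambda>x. f' x0 x v)" for v
    by (rule Bochner_Integration.integrable_bound[of M "\<lambda>x. g x * norm v"])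
       (use meas f'bd S(2) g in \<open>auto intro!: AE_I2 intro: order_trans[OF _ abs_ge_self]\<close>)
  have lin: "bounded_linear (f' x0 x)" if "x \<in> space M" for x
    using der[OF S(2) that] by (rule has_derivative_bounded_linear)
  have "bounded_linear (\<lambda>v. \<integral>x. f' x0 x v \<partial>M)"
  proof (rule bounded_linear_intro[where K = "\<integral>x. g x \<partial>M"])
    fix u v
    have "(\<integral>x. f' x0 x (u + v) \<partial>M) = (\<integral>x. f' x0 x u + f' x0 x v \<partial>M)"
      by (intro Bochner_Integration.integral_cong) (auto simp: linear_add bounded_linear.linear lin)
    then show "(\<integral>x. f' x0 x (u + v) \<partial>M) = (\<integral>x. f' x0 x u \<partial>M) + (\<integral>x. f' x0 x v \<partial>M)"
      using int' by simp
  next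
    fix r v
    have "(\<integral>x. f' x0 x (r *\<^sub>R v) \<partial>M) = (\<integral>x. r *\<^sub>R f' x0 x v \<partial>M)"
      by (intro Bochner_Integration.integral_cong) (auto simp: linear_scale bounded_linear.linear lin)
    then show "(\<integral>x. f' x0 x (r *\<^sub>R v) \<partial>M) = r *\<^sub>R (\<integral>x. f' x0 x v \<partial>M)"
      by simp
  next
    fix v
    have "norm (\<integral>x. f' x0 x v \<partial>M) \<le> (\<integral>x. norm (f' x0 x v) \<partial>M)" by (rule integral_norm_bound)
    also have "\<dots> \<le> (\<integral>x. g x * norm v \<partial>M)"
      using int' g f'bd S(2) by (intro integral_mono) auto
    finally show "norm (\<integral>x. f' x0 x v \<partial>M) \<le> norm v * (\<integral>x. g x \<partial>M)" using g by (simp add: mult.commute)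
  qed
  moreover have "((\<lambda>h. norm ((\<integral>x. f (x0 + h) x \<partial>M) - (\<integral>x. f x0 x \<partial>M) - (\<integral>x. f' x0 x h \<partial>M)) / norm h) \<longlongrightarrow> 0) (at 0)"
  proof -
    let ?R = "\<lambda>h x. (f (x0 + h) x - f x0 x - f' x0 x h) /\<^sub>R norm h"
    have inS: "x0 + h \<in> S" if "h \<in> ball 0 e" for h
      using that e(2) by (auto simp: dist_norm subset_iff)
    \<comment> \<open>Half of the majorant \<open>2 * g\<close> accounts for the difference quotient and half for the derivative itself.\<close>
    have "((\<lambda>h. \<integral>x. ?R h x \<partial>M) \<longlongrightarrow> (\<integral>x. 0 \<partial>M)) (at 0 within ball 0 e)"
    proof (rule dominated_convergence_within)
      show "integrable M (\<lambda>x. 2 * g x)" using g by simp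
      show "AE x in M. ((\<lambda>h. ?R h x) \<longlongrightarrow> 0) (at 0 within ball 0 e)"
      proof (rule AE_I2)
        fix x assume "x \<in> space M"
        from der[OF S(2) this] have "((\<lambda>h. norm (f (x0 + h) x - f x0 x - f' x0 x h) / norm h) \<longlongrightarrow> 0) (at 0)"
          by (simp add: has_derivative_at)
        then have "((\<lambda>h. norm (?R h x)) \<longlongrightarrow> 0) (at 0)" by (simp add: divide_inverse mult.commute)
        then have "((\<lambda>h. ?R h x) \<longlongrightarrow> 0) (at 0)" by (rule tendsto_norm_zero_cancel)
        then show "((\<lambda>h. ?R h x) \<longlongrightarrow> 0) (at 0 within ball 0 e)"
          by (rule tendsto_within_subset) auto
      qed
      fix h :: 'p assume h: "h \<in> ball 0 e" "h \<noteq> 0"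
      show "?R h \<in> borel_measurable M"
        using int[OF inS[OF h(1)]] int[OF S(2)] meas by (intro borel_measurable_scaleR borel_measurable_diff) auto
      show "AE x in M. norm (?R h x) \<le> 2 * g x"
      proof (rule AE_I2)
        fix x assume x: "x \<in> space M"
        have "norm (f (x0 + h) x - f x0 x) \<le> g x * norm ((x0 + h) - x0)"
        proof (rule differentiable_bound[where S = "ball x0 e" and f = "\<lambda>p. f p x" and f' = "\<lambda>p. f' p x"])
          show "((\<lambda>p. f p x) has_derivative f' p x) (at p within ball x0 e)" if "p \<in> ball x0 e" for p
            using der[of p x] that e x has_derivative_at_withinI by blast
        qed (use e h x bd in \<open>auto simp: dist_norm\<close>)
        moreover have "norm (f' x0 x h) \<le> g x * norm h" by (rule f'bd[OF S(2) x])
        ultimately have "norm (f (x0 + h) x - f x0 x - f' x0 x h) \<le> 2 * g x * norm h"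
          using norm_triangle_ineq4[of "f (x0 + h) x - f x0 x" "f' x0 x h"] by simp
        then show "norm (?R h x) \<le> 2 * g x" using h(2) by (simp add: divide_simps mult.commute)
      qed
    qed auto
    then have "((\<lambda>h. norm (\<integral>x. ?R h x \<partial>M)) \<longlongrightarrow> 0) (at 0 within ball 0 e)"
      unfolding Bochner_Integration.integral_zero by (rule tendsto_norm_zero)
    then have "((\<lambda>h. norm (\<integral>x. ?R h x \<partial>M)) \<longlongrightarrow> 0) (at 0)"
      using e(1) by (simp add: at_within_open[of 0 "ball 0 e"])
    moreover have "\<forall>\<^sub>F h in at 0. norm (\<integral>x. ?R h x \<partial>M) =
       norm ((\<integral>x. f (x0 + h) x \<partial>M) - (\<integral>x. f x0 x \<partial>M) - (\<integral>x. f' x0 x h \<partial>M)) / norm h"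
      unfolding eventually_at
    proof (intro exI[of _ e] conjI ballI impI e(1))
      fix h :: 'p assume "h \<noteq> 0 \<and> dist h 0 < e"
      then have "x0 + h \<in> S" by (intro inS) auto
      from int[OF this] int[OF S(2)] int'[of h]
      show "norm (\<integral>x. ?R h x \<partial>M) =
       norm ((\<integral>x. f (x0 + h) x \<partial>M) - (\<integral>x. f x0 x \<partial>M) - (\<integral>x. f' x0 x h \<partial>M)) / norm h"
        by (simp add: divide_inverse mult.commute)
    qed
    ultimately show ?thesis by (rule Lim_transform_eventually)
  qed
  ultimately show ?thesis by (simp add: has_derivative_at)
qed

section \<open>The Fourier transform of integrable functions\<close>

text \<open>Lebesgue measure is the image of the product of the one-dimensional measures under
  \<open>f \<mapsto> \<Sum>b\<in>Basis. f b *\<^sub>R b\<close>, so Fubini's theorem for products applies.\<close>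

lemma integral_prod_Basis:
  fixes f :: "'a::euclidean_space \<Rightarrow> real \<Rightarrow> complex"
  assumes f: "\<And>b. b \<in> Basis \<Longrightarrow> integrable lborel (f b)"
  shows "integrable lborel (\<lambda>x::'a. \<Prod>b\<in>Basis. f b (x \<bullet> b))"
    and "(\<integral>x. (\<Prod>b\<in>Basis. f b (x \<bullet> b)) \<partial>(lborel :: 'a measure)) = (\<Prod>b\<in>Basis. LBINT x. f b x)"
proof -
  interpret product_sigma_finite "\<lambda>_::'a. lborel :: real measure" ..
  have L: "(lborel :: 'a measure) = distr (Pi\<^sub>M Basis (\<lambda>b. lborel)) borel (\<lambda>f. \<Sum>b\<in>Basis. f b *\<^sub>R b)"
    unfolding lborel_eq_real by (rule lborel_def)
  have meas: "(\<lambda>x::'a. \<Prod>b\<in>Basis. f b (x \<bullet> b)) \<in> borel_measurable borel"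
  proof (rule borel_measurable_prod)
    fix b :: 'a assume "b \<in> Basis"
    then have [measurable]: "f b \<in> borel_measurable borel" using f[of b] by auto
    show "(\<lambda>x. f b (x \<bullet> b)) \<in> borel_measurable borel" by measurable
  qed
  have map: "(\<lambda>f. \<Sum>b\<in>Basis. f b *\<^sub>R b) \<in> Pi\<^sub>M Basis (\<lambda>b::'a. lborel) \<rightarrow>\<^sub>M (borel :: 'a measure)"
    by measurable
  have eq: "(\<Prod>b\<in>Basis. f b ((\<Sum>b\<in>Basis. x b *\<^sub>R b) \<bullet> b)) = (\<Prod>b\<in>Basis. f b (x b))" for x :: "'a \<Rightarrow> real"
    by (intro prod.cong) (auto simp: inner_sum_left_Basis)
  show "integrable lborel (\<lambda>x::'a. \<Prod>b\<in>Basis. f b (x \<bullet> b))"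
    unfolding L using map meas
    by (subst integrable_distr_eq) (auto simp: eq intro!: product_integrable_prod f)
  show "(\<integral>x. (\<Prod>b\<in>Basis. f b (x \<bullet> b)) \<partial>(lborel :: 'a measure)) = (\<Prod>b\<in>Basis. LBINT x. f b x)"
    unfolding L using map meas
    by (subst integral_distr) (auto simp: eq product_integral_prod f)
qed

text \<open>The standard Gaussian density, given as a product so that its integrals reduce to one dimension.\<close>

definition gauss :: "'a::euclidean_space \<Rightarrow> real" where
  "gauss y = (\<Prod>b\<in>Basis. std_normal_density (y \<bullet> b))"

lemma gauss_eq: "gauss (y::'a::euclidean_space) = exp (- (norm y)\<^sup>2 / 2) / sqrt (2 * pi) ^ DIM('a)"
proof -
  have "(norm y)\<^sup>2 = (\<Sum>b\<in>Basis. (y \<bullet> b)\<^sup>2)"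
    by (subst power2_norm_eq_inner, subst euclidean_inner) (simp add: power2_eq_square)
  then show ?thesis
    by (simp add: gauss_def std_normal_density_def prod_dividef exp_sum sum_negf sum_divide_distrib flip: exp_sum)
qed

lemma gauss_nonneg [simp]: "gauss y \<ge> 0"
  by (simp add: gauss_eq)

lemma borel_measurable_gauss [measurable]: "gauss \<in> borel_measurable borel"
  unfolding gauss_eq by measurable

text \<open>The integral factorises over the coordinates, and each factor is the characteristic function of the standard
  normal distribution.\<close>

lemma
  fixes \<xi> :: "'a::euclidean_space"
  shows integrable_gauss_iexp: "integrable lborel (\<lambda>y. iexp (\<xi> \<bullet> y) * cpx (gauss y))"
    and fourier_gauss: "fourier (\<lambda>y. cpx (gauss y)) \<xi> = cpx (exp (- (norm \<xi>)\<^sup>2 / 2))"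
proof -
  have 1: "iexp (\<xi> \<bullet> y) * cpx (gauss y) =
     (\<Prod>b\<in>Basis. (\<lambda>b r. std_normal_density r *\<^sub>R iexp ((\<xi> \<bullet> b) * r)) b (y \<bullet> b))" for y :: 'a
    by (subst euclidean_inner)
       (simp add: gauss_def scaleR_conv_of_real prod.distrib sum_distrib_left exp_sum mult.commute)
  have 2: "integrable lborel (\<lambda>r. std_normal_density r *\<^sub>R iexp (t * r))" for t
    by (rule Bochner_Integration.integrable_bound[of lborel std_normal_density]) auto
  have 3: "(LBINT r. std_normal_density r *\<^sub>R iexp (t * r)) = cpx (exp (- t\<^sup>2 / 2))" for t
    using fun_cong[OF char_std_normal_distribution, of t]
    by (simp add: char_def integral_density)
  show "integrable lborel (\<lambda>y. iexp (\<xi> \<bullet> y) * cpx (gauss y))"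
    unfolding 1 by (intro integral_prod_Basis 2)
  have "(norm \<xi>)\<^sup>2 = (\<Sum>b\<in>Basis. (\<xi> \<bullet> b)\<^sup>2)"
    by (subst power2_norm_eq_inner, subst euclidean_inner) (simp add: power2_eq_square)
  then have "(\<Prod>b\<in>Basis. cpx (exp (- (\<xi> \<bullet> b)\<^sup>2 / 2))) = cpx (exp (- (norm \<xi>)\<^sup>2 / 2))"
    by (simp add: sum_negf sum_divide_distrib exp_sum[symmetric] flip: of_real_prod)
  then show "fourier (\<lambda>y. cpx (gauss y)) \<xi> = cpx (exp (- (norm \<xi>)\<^sup>2 / 2))"
    unfolding fourier_def 1 by (subst integral_prod_Basis[OF 2]) (simp only: 3)
qed

lemma integrable_gauss [simp]: "integrable lborel (gauss :: 'a::euclidean_space \<Rightarrow> real)"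
  using integrable_gauss_iexp[of "0::'a"] by (simp add: complex_of_real_integrable_eq)

lemma integral_gauss [simp]: "(\<integral>y. gauss y \<partial>(lborel :: 'a::euclidean_space measure)) = 1"
  using fourier_gauss[of "0::'a"] by (simp add: fourier_def)

lemma integrable_complex_mult_iff:
  fixes f :: "'w \<Rightarrow> complex"
  assumes "c \<noteq> 0"
  shows "integrable M (\<lambda>x. c * f x) \<longleftrightarrow> integrable M f"
  using assms integrable_mult_right[of "inverse c" M "\<lambda>x. c * f x"] by (auto simp flip: mult.assoc)

lemma lborel_integral_affine:
  fixes f :: "'a::euclidean_space \<Rightarrow> complex" and t :: 'a
  assumes "c \<noteq> 0" and [measurable]: "f \<in> borel_measurable borel"
  shows "(LBINT x. f x) = cpx (\<bar>c\<bar> ^ DIM('a)) * (LBINT x. f (t + c *\<^sub>R x))"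
  by (subst lborel_affine[OF assms(1), of t])
     (simp add: integral_density integral_distr scaleR_conv_of_real)

lemma lborel_integrable_affine:
  fixes f :: "'a::euclidean_space \<Rightarrow> complex" and t :: 'a
  assumes "c \<noteq> 0" and [measurable]: "f \<in> borel_measurable borel"
  shows "integrable lborel f \<longleftrightarrow> integrable lborel (\<lambda>x. f (t + c *\<^sub>R x))"
proof -
  have "integrable lborel f \<longleftrightarrow> integrable lborel (\<lambda>x. \<bar>c\<bar> ^ DIM('a) *\<^sub>R f (t + c *\<^sub>R x))"
    by (subst lborel_affine[OF assms(1), of t]) (simp add: integrable_density integrable_distr_eq)
  then show ?thesis using assms(1) unfolding scaleR_conv_of_real by (subst (asm) integrable_complex_mult_iff) auto
qed

text \<open>Fubini's theorem needs joint integrability. The kernels that couple the two variables below have, possibly after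
  rescaling, modulus at most \<open>1\<close>, as \<open>exp (i \<xi> \<bullet> x)\<close> does.\<close>

lemma (in pair_sigma_finite) integrable_mult_kernel:
  fixes u :: "'a \<Rightarrow> complex" and g :: "'b \<Rightarrow> complex"
  assumes u: "integrable M1 u" and g: "integrable M2 g"
    and k[measurable]: "k \<in> borel_measurable (M1 \<Otimes>\<^sub>M M2)" and k1: "\<And>x y. norm (k (x, y)) \<le> 1"
  shows "integrable (M1 \<Otimes>\<^sub>M M2) (\<lambda>(x, y). u x * g y * k (x, y))"
proof -
  have [measurable]: "u \<in> borel_measurable M1" "g \<in> borel_measurable M2" using u g by auto
  have "integrable (M1 \<Otimes>\<^sub>M M2) (\<lambda>(x, y). u x * g y)"
    by (rule Fubini_integrable) (use u g in \<open>auto simp: norm_mult\<close>)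
  then show ?thesis
    by (rule Bochner_Integration.integrable_bound)
       (auto simp: norm_mult intro!: AE_I2 mult_left_le k1)
qed

lemma norm_fourier_le: "norm (fourier u \<xi>) \<le> (LBINT x. norm (u x))"
  unfolding fourier_def by (rule order_trans[OF integral_norm_bound]) (simp add: norm_mult)

lemma integrable_iexp_mult:
  fixes u :: "'a::euclidean_space \<Rightarrow> complex"
  assumes "integrable lborel u"
  shows "integrable lborel (\<lambda>x. iexp (\<xi> \<bullet> x) * u x)"
  by (rule Bochner_Integration.integrable_bound[OF assms]) (use assms in \<open>auto simp: norm_mult\<close>)

lemma isCont_fourier:
  fixes u :: "'a::euclidean_space \<Rightarrow> complex"
  assumes u: "integrable lborel u"
  shows "isCont (fourier u) \<xi>"
  unfolding isCont_def fourier_def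
proof (rule dominated_convergence_within[where g = "\<lambda>x. norm (u x)"])
  have [measurable]: "u \<in> borel_measurable borel" using u by auto
  show "(\<lambda>x. iexp (\<xi> \<bullet> x) * u x) \<in> borel_measurable lborel" for \<xi> by measurable
  show "AE x in lborel. ((\<lambda>p. iexp (p \<bullet> x) * u x) \<longlongrightarrow> iexp (\<xi> \<bullet> x) * u x) (at \<xi>)"
    by (intro AE_I2 tendsto_intros)
qed (use u in \<open>auto simp: norm_mult\<close>)

lemma borel_measurable_fourier:
  fixes u :: "'a::euclidean_space \<Rightarrow> complex"
  assumes u: "integrable lborel u"
  shows "fourier u \<in> borel_measurable borel"
  by (intro borel_measurable_continuous_onI continuous_at_imp_continuous_on ballI isCont_fourier u)

text \<open>Both sides are the double integral of \<open>u x * g \<xi> * exp (i \<xi> \<bullet> x)\<close>.\<close>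

lemma integral_fourier_mult:
  fixes u g :: "'a::euclidean_space \<Rightarrow> complex"
  assumes u: "integrable lborel u" and g: "integrable lborel g"
  shows "(LBINT \<xi>. fourier u \<xi> * g \<xi>) = (LBINT x. u x * fourier g x)"
proof -
  have [measurable]: "u \<in> borel_measurable borel" "g \<in> borel_measurable borel" using u g by auto
  have "integrable (lborel \<Otimes>\<^sub>M lborel) (\<lambda>(x, \<xi>). u x * g \<xi> * (\<lambda>(x, \<xi>). iexp (\<xi> \<bullet> x)) (x, \<xi>))"
    by (rule lborel_pair.integrable_mult_kernel[OF u g]) auto
  then have "(LBINT \<xi>. (LBINT x. u x * g \<xi> * iexp (\<xi> \<bullet> x))) =
      (LBINT x. (LBINT \<xi>. u x * g \<xi> * iexp (\<xi> \<bullet> x)))"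
    by (intro lborel_pair.Fubini_integral) simp
  moreover have "(LBINT x. u x * g \<xi> * iexp (\<xi> \<bullet> x)) = fourier u \<xi> * g \<xi>" for \<xi>
    unfolding fourier_def by (subst integral_mult_left_zero[symmetric]) (simp add: mult_ac)
  moreover have "(LBINT \<xi>. u x * g \<xi> * iexp (\<xi> \<bullet> x)) = u x * fourier g x" for x
    unfolding fourier_def by (subst integral_mult_right_zero[symmetric]) (simp add: mult_ac inner_commute)
  ultimately show ?thesis by simp
qed

text \<open>The functions \<open>y \<mapsto> f (x + e *\<^sub>R y)\<close> converge to the constant \<open>f x\<close> and are dominated by \<open>g\<close>. The majorant \<open>g\<close>
  may grow, which matters when \<open>f\<close> contains the symbol of the equation.\<close>

lemma gauss_approx_identity:
  fixes f :: "'a::euclidean_space \<Rightarrow> complex"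
  assumes [measurable]: "f \<in> borel_measurable borel" and cont: "isCont f x"
    and bd: "\<And>y e. 0 < e \<Longrightarrow> e \<le> 1 \<Longrightarrow> norm (f (x + e *\<^sub>R y)) \<le> g y"
    and int: "integrable lborel (\<lambda>y. g y * gauss y)"
  shows "((\<lambda>e. LBINT y. f (x + e *\<^sub>R y) * cpx (gauss y)) \<longlongrightarrow> f x) (at 0 within {0<..1})"
proof -
  have "((\<lambda>e. LBINT y. f (x + e *\<^sub>R y) * cpx (gauss y)) \<longlongrightarrow>
      (LBINT y. f x * cpx (gauss (y::'a)))) (at 0 within {0<..1})"
  proof (rule dominated_convergence_within[OF _ _ int])
    show "AE y in lborel. ((\<lambda>e. f (x + e *\<^sub>R y) * cpx (gauss y)) \<longlongrightarrow> f x * cpx (gauss y)) (at 0 within {0<..1})"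
    proof (rule AE_I2)
      fix y
      have "((\<lambda>e. x + e *\<^sub>R y) \<longlongrightarrow> x + 0 *\<^sub>R y) (at 0 within {0<..1})" by (intro tendsto_intros)
      then have "((\<lambda>e. f (x + e *\<^sub>R y)) \<longlongrightarrow> f x) (at 0 within {0<..1})"
        by (intro isCont_tendsto_compose[OF cont]) simp
      then show "((\<lambda>e. f (x + e *\<^sub>R y) * cpx (gauss y)) \<longlongrightarrow> f x * cpx (gauss y)) (at 0 within {0<..1})"
        by (intro tendsto_intros)
    qed
  qed (auto simp: norm_mult intro!: AE_I2 mult_right_mono bd)
  then show ?thesis by (simp add: integral_complex_of_real)
qed

text \<open>Modulation shifts the transform, dilation by \<open>e\<close> rescales it, and a Gaussian is its own transform up to the
  constant. The result is an approximate Dirac mass at \<open>- \<xi>0\<close>; this family regularises the inversion formula and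
  later isolates single frequencies of a solution.\<close>

lemma fourier_modulated_gauss:
  fixes \<xi> \<xi>0 :: "'a::euclidean_space"
  assumes e: "e > 0"
  shows "fourier (\<lambda>x. iexp (\<xi>0 \<bullet> x) * cpx (exp (- (norm (e *\<^sub>R x))\<^sup>2 / 2))) \<xi> =
     cpx ((2 * pi) ^ DIM('a) / e ^ DIM('a) * gauss ((\<xi> + \<xi>0) /\<^sub>R e))"
    and "integrable lborel (\<lambda>x. iexp (\<xi>0 \<bullet> x) * cpx (exp (- (norm (e *\<^sub>R x))\<^sup>2 / 2)))"
proof -
  let ?C = "sqrt (2 * pi) ^ DIM('a)"
  have C: "?C * ?C = (2 * pi) ^ DIM('a)" "?C \<noteq> 0" by (simp_all only: power_mult_distrib[symmetric] real_sqrt_mult_self) simp_all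
  have *: "exp (- (norm (e *\<^sub>R x))\<^sup>2 / 2) = ?C * gauss (e *\<^sub>R x)" for x :: 'a
    by (simp add: gauss_eq)
  have int: "integrable lborel (\<lambda>x. iexp (\<eta> \<bullet> x) * cpx (gauss (e *\<^sub>R x)))" for \<eta> :: 'a
  proof -
    have "integrable lborel (\<lambda>x. cpx (gauss (0 + e *\<^sub>R x :: 'a)))"
      using e by (subst lborel_integrable_affine[symmetric]) (auto simp: complex_of_real_integrable_eq)
    then show ?thesis by (intro integrable_iexp_mult) simp
  qed
  from int[of \<xi>0] show "integrable lborel (\<lambda>x. iexp (\<xi>0 \<bullet> x) * cpx (exp (- (norm (e *\<^sub>R x))\<^sup>2 / 2)))"
    unfolding * using integrable_mult_right[of "of_real ?C", OF int[of \<xi>0]] by (simp add: mult.left_commute del: integrable_mult_right)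
  have "fourier (\<lambda>x. iexp (\<xi>0 \<bullet> x) * cpx (exp (- (norm (e *\<^sub>R x))\<^sup>2 / 2))) \<xi> =
    (LBINT x. of_real ?C * (iexp ((\<xi> + \<xi>0) \<bullet> x) * cpx (gauss (e *\<^sub>R x))))"
    unfolding fourier_def * by (simp add: inner_add_left ring_distribs exp_add mult_ac)
  also have "\<dots> = of_real ?C * (LBINT x. iexp ((\<xi> + \<xi>0) \<bullet> x) * cpx (gauss (e *\<^sub>R x)))"
    by simp
  also have "(LBINT x. iexp ((\<xi> + \<xi>0) \<bullet> x) * cpx (gauss (e *\<^sub>R x)))
     = cpx (1 / e ^ DIM('a)) * fourier (\<lambda>y. cpx (gauss y)) ((\<xi> + \<xi>0) /\<^sub>R e)"
    using e by (subst lborel_integral_affine[of "1/e" _ 0])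
      (auto simp: fourier_def power_one_over inner_divide_left divide_inverse power_inverse)
  also have "fourier (\<lambda>y. cpx (gauss y)) ((\<xi> + \<xi>0) /\<^sub>R e) = of_real (?C * gauss ((\<xi> + \<xi>0) /\<^sub>R e))"
    unfolding fourier_gauss by (simp add: gauss_eq)
  finally show "fourier (\<lambda>x. iexp (\<xi>0 \<bullet> x) * cpx (exp (- (norm (e *\<^sub>R x))\<^sup>2 / 2))) \<xi> =
     cpx ((2 * pi) ^ DIM('a) / e ^ DIM('a) * gauss ((\<xi> + \<xi>0) /\<^sub>R e))"
    unfolding C(1)[symmetric] by (simp add: mult_ac)
qed

lemma integral_mult_scaled_gauss:
  fixes f :: "'a::euclidean_space \<Rightarrow> complex"
  assumes e: "e > 0" and [measurable]: "f \<in> borel_measurable borel"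
  shows "(LBINT u. f u * cpx (1 / e ^ DIM('a) * gauss ((u - x) /\<^sub>R e))) =
     (LBINT y. f (x + e *\<^sub>R y) * cpx (gauss y))"
proof -
  let ?F = "\<lambda>u. f u * cpx (1 / e ^ DIM('a) * gauss ((u - x) /\<^sub>R e))"
  have "(LBINT u. ?F u) = cpx (\<bar>e\<bar> ^ DIM('a)) * (LBINT y. ?F (x + e *\<^sub>R y))"
    by (rule lborel_integral_affine) (use e in auto)
  also have "\<dots> = (LBINT y. cpx (\<bar>e\<bar> ^ DIM('a)) * ?F (x + e *\<^sub>R y))"
    by (rule integral_mult_right_zero[symmetric])
  also have "\<dots> = (LBINT y. f (x + e *\<^sub>R y) * cpx (gauss y))"
    by (intro Bochner_Integration.integral_cong) (use e in auto)
  finally show ?thesis .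
qed

text \<open>The product of the transform with a modulated Gaussian is evaluated in two ways: moving the transform to the
  Gaussian gives a Gaussian average of \<open>\<phi>\<close> around \<open>x\<close>, which tends to \<open>\<phi> x\<close>, and by dominated convergence it
  tends to the inversion integral.\<close>

theorem fourier_inversion:
  fixes \<phi> :: "'a::euclidean_space \<Rightarrow> complex"
  assumes \<phi>: "integrable lborel \<phi>" and F: "integrable lborel (fourier \<phi>)"
    and cont: "isCont \<phi> x" and bd: "\<And>y. norm (\<phi> y) \<le> B"
  shows "\<phi> x = cpx (1 / (2 * pi) ^ DIM('a)) *
    (LBINT \<xi>. exp (- \<i> * cpx (\<xi> \<bullet> x)) * fourier \<phi> \<xi>)"
proof -
  let ?m = "\<lambda>e \<xi>. iexp ((-x) \<bullet> \<xi>) * cpx (exp (- (norm (e *\<^sub>R \<xi>))\<^sup>2 / 2))"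
  have [measurable]: "\<phi> \<in> borel_measurable borel" "fourier \<phi> \<in> borel_measurable borel" using \<phi> F by auto
  have eq: "(LBINT \<xi>. fourier \<phi> \<xi> * ?m e \<xi>) =
      cpx ((2 * pi) ^ DIM('a)) * (LBINT y. \<phi> (x + e *\<^sub>R y) * cpx (gauss y))" if e: "e > 0" for e
  proof -
    have "(LBINT \<xi>. fourier \<phi> \<xi> * ?m e \<xi>) = (LBINT u. \<phi> u * fourier (?m e) u)"
      by (rule integral_fourier_mult[OF \<phi> fourier_modulated_gauss(2)[OF e]])
    also have "\<dots> = (LBINT u. of_real ((2 * pi) ^ DIM('a)) * (\<phi> u * cpx (1 / e ^ DIM('a) * gauss ((u - x) /\<^sub>R e))))"
      unfolding fourier_modulated_gauss(1)[OF e] by (simp add: mult_ac)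
    also have "\<dots> = of_real ((2 * pi) ^ DIM('a)) * (LBINT u. \<phi> u * cpx (1 / e ^ DIM('a) * gauss ((u - x) /\<^sub>R e)))"
      by (rule integral_mult_right_zero)
    finally show ?thesis unfolding integral_mult_scaled_gauss[OF e \<open>\<phi> \<in> _\<close>] .
  qed
  have "((\<lambda>e. LBINT y. \<phi> (x + e *\<^sub>R y) * cpx (gauss y)) \<longlongrightarrow> \<phi> x) (at 0 within {0<..1})"
    by (rule gauss_approx_identity[where g = "\<lambda>_. B"]) (use cont bd in auto)
  then have "((\<lambda>e. cpx ((2 * pi) ^ DIM('a)) * (LBINT y. \<phi> (x + e *\<^sub>R y) * cpx (gauss y)))
      \<longlongrightarrow> cpx ((2 * pi) ^ DIM('a)) * \<phi> x) (at 0 within {0<..1})"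
    by (intro tendsto_intros)
  then have 1: "((\<lambda>e. LBINT \<xi>. fourier \<phi> \<xi> * ?m e \<xi>)
      \<longlongrightarrow> cpx ((2 * pi) ^ DIM('a)) * \<phi> x) (at 0 within {0<..1})"
    by (rule Lim_transform_within[where d = 1]) (use eq in auto)
  have 2: "((\<lambda>e. LBINT \<xi>. fourier \<phi> \<xi> * ?m e \<xi>)
      \<longlongrightarrow> (LBINT \<xi>. exp (- \<i> * cpx (\<xi> \<bullet> x)) * fourier \<phi> \<xi>)) (at 0 within {0<..1})"
  proof (rule dominated_convergence_within[OF _ _ integrable_norm[OF F]])
    show "AE \<xi> in lborel. ((\<lambda>e. fourier \<phi> \<xi> * ?m e \<xi>) \<longlongrightarrow> exp (- \<i> * cpx (\<xi> \<bullet> x)) * fourier \<phi> \<xi>) (at 0 within {0<..1})"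
    proof (rule AE_I2)
      fix \<xi>
      have "((\<lambda>e. fourier \<phi> \<xi> * ?m e \<xi>) \<longlongrightarrow> fourier \<phi> \<xi> * ?m 0 \<xi>) (at 0 within {0<..1})"
        by (intro tendsto_intros) simp
      then show "((\<lambda>e. fourier \<phi> \<xi> * ?m e \<xi>) \<longlongrightarrow> exp (- \<i> * cpx (\<xi> \<bullet> x)) * fourier \<phi> \<xi>) (at 0 within {0<..1})"
        by (simp add: inner_commute mult.commute)
    qed
  qed (auto simp: norm_mult intro!: AE_I2 mult_left_le)
  have "at 0 within {0<..1::real} \<noteq> bot"
    by (simp add: trivial_limit_within)
  from tendsto_unique[OF this 1 2] show ?thesis by (simp add: field_simps)
qed

text \<open>The positive and negative parts of \<open>u\<close> are densities of finite measures that agree on boxes. Boxes generate the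
  Borel sets and are stable under intersection, so the measures agree and hence so do the densities.\<close>

lemma AE_zero_if_box_integrals_zero:
  fixes u :: "'a::euclidean_space \<Rightarrow> real"
  assumes u: "integrable lborel u"
    and box: "\<And>a b. (LBINT x. indicator (box a b) x * u x) = 0"
  shows "AE x in lborel. u x = 0"
proof -
  define p where "p x = max (u x) 0" for x
  define n where "n x = max (- u x) 0" for x
  have pn: "p x \<ge> 0" "n x \<ge> 0" "p x - n x = u x" for x by (auto simp: p_def n_def)
  have ip: "integrable lborel p" and "integrable lborel n" using u by (auto simp: p_def[abs_def] n_def[abs_def])
  then have [measurable]: "p \<in> borel_measurable borel" "n \<in> borel_measurable borel" by auto
  have ind: "integrable lborel (\<lambda>x. indicator A x * v x)"
    if "integrable lborel v" "A \<in> sets borel" for v :: "'a \<Rightarrow> real" and A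
    using integrable_real_mult_indicator[of A lborel v] that by (simp add: mult.commute)
  have fin: "emeasure (density lborel (\<lambda>x. ennreal (v x))) A = ennreal (LBINT x. indicator A x * v x)"
    if "integrable lborel v" "\<And>x. v x \<ge> 0" "A \<in> sets borel" for v :: "'a \<Rightarrow> real" and A
  proof -
    have [measurable]: "v \<in> borel_measurable borel" using that by auto
    have "emeasure (density lborel (\<lambda>x. ennreal (v x))) A = (\<integral>\<^sup>+x. ennreal (indicator A x * v x) \<partial>lborel)"
      using that by (auto simp: emeasure_density intro!: nn_integral_cong split: split_indicator)
    also have "\<dots> = ennreal (LBINT x. indicator A x * v x)"
      using that by (intro nn_integral_eq_integral ind) auto
    finally show ?thesis .
  qed
  have "density lborel (\<lambda>x. ennreal (p x)) = density lborel (\<lambda>x. ennreal (n x))"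
  proof (rule measure_eqI_generator_eq[where E = "range (\<lambda>(a, b). box a b)" and \<Omega> = UNIV and A = "\<lambda>n. box (- (real n *\<^sub>R One)) (real n *\<^sub>R One)"])
    show "Int_stable (range (\<lambda>(a, b). box a b :: 'a set))"
      by (auto simp: Int_stable_def box_Int_box)
    show "sets (density lborel (\<lambda>x. ennreal (p x))) = sigma_sets UNIV (range (\<lambda>(a, b). box a b))"
      "sets (density lborel (\<lambda>x. ennreal (n x))) = sigma_sets UNIV (range (\<lambda>(a, b). box a b))"
      by (simp_all add: borel_eq_box)
    show "(\<Union>n. box (- (real n *\<^sub>R One)) (real n *\<^sub>R One) :: 'a set) = UNIV" by (rule UN_box_eq_UNIV)
    show "emeasure (density lborel (\<lambda>x. ennreal (p x))) X = emeasure (density lborel (\<lambda>x. ennreal (n x))) X"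
      if "X \<in> range (\<lambda>(a, b). box a b)" for X
    proof -
      from that obtain a b where X: "X = box a b" by auto
      have i: "integrable lborel (\<lambda>x. indicator X x * p x)" "integrable lborel (\<lambda>x. indicator X x * n x)"
        using ind[OF ip, of X] ind[OF \<open>integrable lborel n\<close>, of X] X by auto
      have "(LBINT x. indicator X x * p x) - (LBINT x. indicator X x * n x)
        = (LBINT x. indicator X x * p x - indicator X x * n x)"
        by (rule Bochner_Integration.integral_diff[OF i, symmetric])
      also have "\<dots> = (LBINT x. indicator X x * u x)"
        unfolding pn(3)[symmetric] by (simp add: right_diff_distrib)
      finally have "(LBINT x. indicator X x * p x) = (LBINT x. indicator X x * n x)"
        unfolding X box by simp
      then show ?thesis
        using fin[OF \<open>integrable lborel p\<close> pn(1)] fin[OF \<open>integrable lborel n\<close> pn(2)] unfolding X by simp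
    qed
    show "emeasure (density lborel (\<lambda>x. ennreal (p x))) (box (- (real n *\<^sub>R One)) (real n *\<^sub>R One)) \<noteq> \<infinity>" for n
      by (subst fin[OF ip pn(1)]) auto
  qed auto
  then have "AE x in lborel. ennreal (p x) = ennreal (n x)"
    by (intro sigma_finite_measure.density_unique[OF sigma_finite_lborel]) auto
  then show ?thesis
  proof eventually_elim
    fix x assume "ennreal (p x) = ennreal (n x)"
    with pn[of x] show "u x = 0" by simp
  qed
qed

text \<open>Gaussian averages of the indicator function of a box are superpositions of exponentials, hence orthogonal to \<open>u\<close>.
  They are bounded by \<open>1\<close> and converge to the indicator function off the frontier of the box, which is a null set.\<close>

theorem fourier_unique:
  fixes u :: "'a::euclidean_space \<Rightarrow> real"
  assumes u: "integrable lborel u" and F: "\<And>\<xi>. fourier (\<lambda>x. cpx (u x)) \<xi> = 0"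
  shows "AE x in lborel. u x = 0"
proof (rule AE_zero_if_box_integrals_zero[OF u])
  fix a b :: 'a
  have [measurable]: "u \<in> borel_measurable borel" using u by auto
  have uc: "integrable lborel (\<lambda>x. cpx (u x))" using u by (simp add: complex_of_real_integrable_eq)
  let ?B = "\<lambda>x. indicator (box a b) x :: complex"
  let ?J = "\<lambda>e x. LBINT y. ?B (x + e *\<^sub>R y) * cpx (gauss (y::'a))"
  have G: "integrable lborel (\<lambda>v. ?B v)"
  proof -
    have "integrable lborel (\<lambda>v. cpx (indicator (box a b) v))"
      unfolding complex_of_real_integrable_eq by (rule integrable_real_indicator) (auto simp: emeasure_lborel_box_eq)
    then show ?thesis by (simp add: of_real_indicator)
  qed
  have J0: "(LBINT x. cpx (u x) * ?J e x) = 0" if e: "e > 0" for e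
  proof -
    define s where "s = sqrt (2 * pi) ^ DIM('a)"
    have s: "s > 0" by (simp add: s_def)
    let ?k = "\<lambda>x v. cpx (1 / e ^ DIM('a) * gauss ((v - x) /\<^sub>R e))"
    have bd: "s * gauss y \<le> 1" for y :: 'a
      using s by (simp add: gauss_eq flip: s_def)
    \<comment> \<open>The constant \<open>s\<close> normalises the Gaussian to maximum \<open>1\<close>, as the bounded kernel of a double integral.\<close>
    have "integrable (lborel \<Otimes>\<^sub>M lborel) (\<lambda>(x, v). cpx (u x) * ?B v *
        (\<lambda>(x, v). cpx (s * gauss ((v - x) /\<^sub>R e))) (x, v))"
      by (rule lborel_pair.integrable_mult_kernel[OF uc G]) (use bd s in \<open>auto simp: norm_mult\<close>)
    then have "integrable (lborel \<Otimes>\<^sub>M lborel) (\<lambda>p. cpx (1 / (e ^ DIM('a) * s)) * (case p of (x, v) \<Rightarrow> cpx (u x) * ?B v *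
        (\<lambda>(x, v). cpx (s * gauss ((v - x) /\<^sub>R e))) (x, v)))"
      by (rule integrable_mult_right)
    also have "(\<lambda>p. cpx (1 / (e ^ DIM('a) * s)) * (case p of (x, v) \<Rightarrow> cpx (u x) * ?B v *
        (\<lambda>(x, v). cpx (s * gauss ((v - x) /\<^sub>R e))) (x, v))) = (\<lambda>(x, v). cpx (u x) * ?B v * ?k x v)"
      using e s by (auto simp: fun_eq_iff)
    finally have int: "integrable (lborel \<Otimes>\<^sub>M lborel) (\<lambda>(x, v). cpx (u x) * ?B v * ?k x v)" .
    have inner: "(LBINT x. cpx (u x) * ?B v * ?k x v) = 0" for v
    proof -
      let ?m = "\<lambda>\<xi>. iexp ((-v) \<bullet> \<xi>) * cpx (exp (- (norm (e *\<^sub>R \<xi>))\<^sup>2 / 2))"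
      have g: "gauss ((x + - v) /\<^sub>R e) = gauss ((v - x) /\<^sub>R e)" for x
        by (simp add: gauss_eq norm_minus_commute)
      have "(LBINT x. cpx (u x) * ?B v * ?k x v) =
         (LBINT x. (?B v / (2 * pi) ^ DIM('a)) * (cpx (u x) * fourier ?m x))"
        unfolding fourier_modulated_gauss(1)[OF e] g by (simp add: mult_ac)
      also have "\<dots> = (?B v / (2 * pi) ^ DIM('a)) * (LBINT x. cpx (u x) * fourier ?m x)"
        by (rule integral_mult_right_zero)
      also have "(LBINT x. cpx (u x) * fourier ?m x) = 0"
        by (subst integral_fourier_mult[OF uc fourier_modulated_gauss(2)[OF e], symmetric]) (simp add: F)
      finally show ?thesis by simp
    qed
    have "(LBINT x. cpx (u x) * ?J e x) = (LBINT x. cpx (u x) * (LBINT v. ?B v * ?k x v))"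
      by (subst integral_mult_scaled_gauss[OF e]) auto
    also have "\<dots> = (LBINT x. (LBINT v. cpx (u x) * ?B v * ?k x v))"
      unfolding mult.assoc integral_mult_right_zero ..
    also have "\<dots> = (LBINT v. (LBINT x. cpx (u x) * ?B v * ?k x v))"
      by (rule lborel_pair.Fubini_integral[OF int, symmetric])
    also have "\<dots> = 0" unfolding inner by simp
    finally show ?thesis .
  qed
  have "frontier (box a b) \<in> null_sets lborel"
  proof -
    have "negligible (frontier (box a b))" by (intro negligible_convex_frontier convex_box)
    then have "frontier (box a b) \<in> null_sets lebesgue" by (simp add: negligible_iff_null_sets)
    then show ?thesis by (subst (asm) null_sets_completion_iff) auto
  qed
  then have ae: "AE x in lborel. x \<notin> frontier (box a b)" by (rule AE_not_in)
  have bJ: "norm (?J e x) \<le> 1" for e x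
  proof -
    have "norm (?J e x) \<le> (LBINT y. norm (?B (x + e *\<^sub>R y) * cpx (gauss y)))" by (rule integral_norm_bound)
    also have "\<dots> \<le> (LBINT y. gauss (y::'a))"
      by (intro integral_mono Bochner_Integration.integrable_bound[OF integrable_gauss])
         (auto simp: norm_mult split: split_indicator)
    finally show ?thesis by simp
  qed
  have "((\<lambda>e. LBINT x. cpx (u x) * ?J e x) \<longlongrightarrow> (LBINT x. cpx (u x) * ?B x)) (at 0 within {0<..1})"
  proof (rule dominated_convergence_within[OF _ _ integrable_norm[OF uc]])
    show "AE x in lborel. ((\<lambda>e. cpx (u x) * ?J e x) \<longlongrightarrow> cpx (u x) * ?B x) (at 0 within {0<..1})"
      using ae
    proof eventually_elim
      fix x assume "x \<notin> frontier (box a b)"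
      then have "isCont (\<lambda>x. cpx (indicator (box a b) x)) x"
        by (intro continuous_intros) (simp add: isCont_indicator)
      then have "isCont ?B x" by (simp add: of_real_indicator)
      then have "((\<lambda>e. ?J e x) \<longlongrightarrow> ?B x) (at 0 within {0<..1})"
        by (intro gauss_approx_identity[where g = "\<lambda>_. 1"]) (auto split: split_indicator)
      then show "((\<lambda>e. cpx (u x) * ?J e x) \<longlongrightarrow> cpx (u x) * ?B x) (at 0 within {0<..1})"
        by (intro tendsto_intros)
    qed
  qed (auto simp: norm_mult intro!: AE_I2 mult_left_le bJ)
  then have 1: "((\<lambda>e. 0) \<longlongrightarrow> (LBINT x. cpx (u x) * ?B x)) (at 0 within {0<..1::real})"
    by (rule Lim_transform_within[where d = 1]) (use J0 in auto)
  have nb: "at 0 within {0<..1::real} \<noteq> bot"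
    by (simp add: trivial_limit_within)
  have "(LBINT x. cpx (u x) * ?B x) = 0"
    using tendsto_unique[OF nb 1 tendsto_const] .
  moreover have "(LBINT x. cpx (u x) * ?B x) = cpx (LBINT x. indicator (box a b) x * u x)"
    by (subst integral_complex_of_real[symmetric]) (auto intro!: Bochner_Integration.integral_cong split: split_indicator)
  ultimately show "(LBINT x. indicator (box a b) x * u x) = 0" by simp
qed

section \<open>Schwartz functions\<close>

definition partial :: "'a::euclidean_space \<Rightarrow> ('a \<Rightarrow> complex) \<Rightarrow> 'a \<Rightarrow> complex" where
  "partial b f x = frechet_derivative f (at x) b"

lemma iterated_partial_Cons: "iterated_partial (b # bs) f = partial b (iterated_partial bs f)"
  by (simp add: partial_def fun_eq_iff)

lemma iterated_partial_append: "iterated_partial (bs @ cs) f = iterated_partial bs (iterated_partial cs f)"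
  by (induction bs) auto

lemma partial_eqI: "(f has_derivative f') (at x) \<Longrightarrow> partial b f x = f' b"
  by (simp add: partial_def frechet_derivative_at[symmetric])

lemma schwartz_has_derivative:
  "schwartz f \<Longrightarrow> (f has_derivative (\<lambda>v. frechet_derivative f (at x) v)) (at x)"
  unfolding schwartz_def frechet_derivative_works[symmetric]
  by (metis empty_subsetI iterated_partial.simps(1) list.set(1))

text \<open>A partial derivative is itself an iterated partial derivative, so its seminorms are among those of \<open>f\<close>.\<close>

lemma schwartz_partial: "schwartz f \<Longrightarrow> b \<in> Basis \<Longrightarrow> schwartz (partial b f)"
  unfolding schwartz_def
proof (intro allI impI)
  fix bs :: "'a list"
  assume f: "\<forall>bs. set bs \<subseteq> Basis \<longrightarrow>
        (\<forall>x. iterated_partial bs f differentiable (at x)) \<and>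
        (\<forall>k::nat. bounded (range (\<lambda>x. (norm x ^ k) *\<^sub>R iterated_partial bs f x)))"
    and b: "b \<in> Basis" and bs: "set bs \<subseteq> Basis"
  have "iterated_partial bs (partial b f) = iterated_partial (bs @ [b]) f"
    by (simp add: iterated_partial_append partial_def[abs_def])
  then show "(\<forall>x. iterated_partial bs (partial b f) differentiable (at x)) \<and>
        (\<forall>k::nat. bounded (range (\<lambda>x. (norm x ^ k) *\<^sub>R iterated_partial bs (partial b f) x)))"
    using f[rule_format, of "bs @ [b]"] b bs by auto
qed

lemma frechet_derivative_schwartz:
  assumes "schwartz f"
  shows "frechet_derivative f (at x) v = (\<Sum>b\<in>Basis. cpx (v \<bullet> b) * partial b f x)"
proof -
  have lin: "linear (frechet_derivative f (at x))"
    using schwartz_has_derivative[OF assms] has_derivative_linear by blast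
  have "frechet_derivative f (at x) v = frechet_derivative f (at x) (\<Sum>b\<in>Basis. (v \<bullet> b) *\<^sub>R b)"
    by (simp add: euclidean_representation)
  also have "\<dots> = (\<Sum>b\<in>Basis. (v \<bullet> b) *\<^sub>R frechet_derivative f (at x) b)"
    by (simp add: linear_sum[OF lin] linear_scale[OF lin])
  finally show ?thesis by (simp add: partial_def scaleR_conv_of_real)
qed

lemma partial_add:
  assumes "f differentiable (at x)" "g differentiable (at x)"
  shows "partial b (\<lambda>x. f x + g x) x = partial b f x + partial b g x"
  using assms unfolding partial_def
  by (subst frechet_derivative_at[OF has_derivative_add, symmetric]) (auto simp: frechet_derivative_works)

lemma partial_cmult:
  assumes "f differentiable (at x)"
  shows "partial b (\<lambda>x. c * f x) x = c * partial b f x"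
  using assms unfolding partial_def
  by (subst frechet_derivative_at[OF has_derivative_mult_right, symmetric]) (auto simp: frechet_derivative_works)

lemma iterated_partial_lincomb:
  assumes f: "schwartz f" and g: "schwartz g" and "set bs \<subseteq> Basis"
  shows "iterated_partial bs (\<lambda>x. f x + c * g x) = (\<lambda>x. iterated_partial bs f x + c * iterated_partial bs g x)"
  using assms(3)
proof (induction bs)
  case (Cons b bs)
  have d: "iterated_partial bs f differentiable (at x)" "iterated_partial bs g differentiable (at x)" for x
    using f g Cons.prems by (auto simp: schwartz_def)
  have IH: "iterated_partial bs (\<lambda>x. f x + c * g x) = (\<lambda>x. iterated_partial bs f x + c * iterated_partial bs g x)"
    using Cons by simp
  show ?case
    unfolding iterated_partial_Cons IH by (rule ext) (simp add: partial_add partial_cmult differentiable_mult d)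
qed simp

text \<open>Needed for \<open>\<phi> - \<partial>\<^sub>b\<partial>\<^sub>b \<phi>\<close>, whose transform is \<open>1 + (\<xi> \<bullet> b)\<^sup>2\<close> times that of \<open>\<phi>\<close>.\<close>

lemma schwartz_lincomb:
  assumes f: "schwartz f" and g: "schwartz g"
  shows "schwartz (\<lambda>x. f x + c * g x)"
  unfolding schwartz_def
proof (intro allI impI conjI)
  fix bs :: "'a list" and x :: 'a and k :: nat
  assume bs: "set bs \<subseteq> Basis"
  then have d: "iterated_partial bs f differentiable (at x)" "iterated_partial bs g differentiable (at x)" for x
    using f g by (auto simp: schwartz_def)
  show "iterated_partial bs (\<lambda>x. f x + c * g x) differentiable (at x)"
    unfolding iterated_partial_lincomb[OF f g bs] by (intro derivative_intros d differentiable_const)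
  have "bounded (range (\<lambda>x. norm x ^ k *\<^sub>R iterated_partial bs f x))" "bounded (range (\<lambda>x. norm x ^ k *\<^sub>R iterated_partial bs g x))"
    using f g bs by (auto simp: schwartz_def)
  then obtain A B where AB: "\<And>x. norm (norm x ^ k *\<^sub>R iterated_partial bs f x) \<le> A" "\<And>x. norm (norm x ^ k *\<^sub>R iterated_partial bs g x) \<le> B"
    unfolding bounded_iff by blast
  have "norm (norm x ^ k *\<^sub>R (iterated_partial bs f x + c * iterated_partial bs g x)) \<le> A + norm c * B" for x
  proof -
    have "norm (norm x ^ k *\<^sub>R (iterated_partial bs f x + c * iterated_partial bs g x))
       \<le> norm (norm x ^ k *\<^sub>R iterated_partial bs f x) + norm (c * (norm x ^ k *\<^sub>R iterated_partial bs g x))"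
      by (simp only: scaleR_add_right mult_scaleR_right norm_triangle_ineq)
    also have "\<dots> \<le> A + norm c * B"
      unfolding norm_mult[of c] by (intro add_mono AB mult_left_mono) auto
    finally show ?thesis .
  qed
  then show "bounded (range (\<lambda>x. norm x ^ k *\<^sub>R iterated_partial bs (\<lambda>x. f x + c * g x) x))"
    unfolding iterated_partial_lincomb[OF f g bs] bounded_iff by blast
qed

lemma schwartz_decay:
  assumes f: "schwartz f"
  obtains C where "C \<ge> 0" "\<And>x. norm (f x) * (1 + (norm x)\<^sup>2) ^ k \<le> C"
proof -
  have "\<forall>j. bounded (range (\<lambda>x. norm x ^ j *\<^sub>R f x))"
    using f unfolding schwartz_def by (metis empty_subsetI iterated_partial.simps(1) list.set(1))
  then have "bounded (range (\<lambda>x. norm x ^ 0 *\<^sub>R f x))" "bounded (range (\<lambda>x. norm x ^ (2 * k) *\<^sub>R f x))" by blast+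
  then obtain A B where AB: "\<And>x. norm (norm x ^ 0 *\<^sub>R f x) \<le> A" "\<And>x. norm (norm x ^ (2 * k) *\<^sub>R f x) \<le> B"
    unfolding bounded_iff by blast
  have "norm (f x) * (1 + (norm x)\<^sup>2) ^ k \<le> 2 ^ k * (A + B)" for x
  proof -
    have "(1 + (norm x)\<^sup>2) ^ k \<le> (2 * max 1 ((norm x)\<^sup>2)) ^ k"
      by (intro power_mono) (auto simp: max_def)
    also have "\<dots> = 2 ^ k * max 1 ((norm x)\<^sup>2) ^ k" by (simp add: power_mult_distrib)
    also have "max 1 ((norm x)\<^sup>2) ^ k \<le> 1 + norm x ^ (2 * k)"
      by (auto simp: max_def power_mult)
    finally have "(1 + (norm x)\<^sup>2) ^ k \<le> 2 ^ k * (1 + norm x ^ (2 * k))" by simp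
    then have "norm (f x) * (1 + (norm x)\<^sup>2) ^ k \<le> norm (f x) * (2 ^ k * (1 + norm x ^ (2 * k)))"
      by (rule mult_left_mono) simp
    also have "\<dots> = 2 ^ k * (norm (norm x ^ 0 *\<^sub>R f x) + norm (norm x ^ (2 * k) *\<^sub>R f x))"
      by (simp add: algebra_simps)
    also have "\<dots> \<le> 2 ^ k * (A + B)" by (intro mult_left_mono add_mono AB) auto
    finally show ?thesis .
  qed
  moreover have "2 ^ k * (A + B) \<ge> 0"
    by (rule order_trans[OF _ calculation[of 0]]) auto
  ultimately show ?thesis using that by blast
qed

text \<open>A weight with integrable reciprocal in every dimension: the reciprocal is a product of Cauchy densities up to a
  constant. Being a product of factors \<open>1 + (\<xi> \<bullet> b)\<^sup>2\<close>, it is also the multiplier of a differential operator.\<close>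

definition cauchy_weight :: "'a::euclidean_space \<Rightarrow> real" where
  "cauchy_weight x = (\<Prod>b\<in>Basis. 1 + (x \<bullet> b)\<^sup>2)"

lemma cauchy_weight_pos: "cauchy_weight x > 0"
  unfolding cauchy_weight_def by (intro prod_pos) (auto intro: add_pos_nonneg)

lemma integrable_inverse_cauchy_weight: "integrable lborel (\<lambda>x::'a::euclidean_space. inverse (cauchy_weight x))"
proof -
  have "integrable lborel (\<lambda>r::real. inverse (1 + r\<^sup>2))"
    using integrable_inverse_1_plus_square by (simp add: set_integrable_def einterval_def)
  then have "integrable lborel (\<lambda>r::real. cpx (inverse (1 + r\<^sup>2)))"
    unfolding complex_of_real_integrable_eq .
  then have "integrable lborel (\<lambda>x::'a. \<Prod>b\<in>Basis. (\<lambda>_ r. cpx (inverse (1 + r\<^sup>2))) b (x \<bullet> b))"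
    by (intro integral_prod_Basis)
  also have "(\<lambda>x::'a. \<Prod>b\<in>Basis. (\<lambda>_ r. cpx (inverse (1 + r\<^sup>2))) b (x \<bullet> b)) = (\<lambda>x. cpx (inverse (cauchy_weight x)))"
    by (simp add: cauchy_weight_def prod_inversef[symmetric] fun_eq_iff o_def)
  finally show ?thesis unfolding complex_of_real_integrable_eq .
qed

lemma cauchy_weight_le: "cauchy_weight (x::'a::euclidean_space) \<le> (1 + (norm x)\<^sup>2) ^ DIM('a)"
proof -
  have "cauchy_weight x \<le> (\<Prod>b\<in>(Basis::'a set). 1 + (norm x)\<^sup>2)"
    unfolding cauchy_weight_def
  proof (intro prod_mono conjI)
    fix b :: 'a assume "b \<in> Basis"
    then have "\<bar>x \<bullet> b\<bar> \<le> norm x" by (rule Basis_le_norm)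
    then show "1 + (x \<bullet> b)\<^sup>2 \<le> 1 + (norm x)\<^sup>2" using abs_le_square_iff[of "x \<bullet> b" "norm x"] by simp
  qed auto
  then show ?thesis by simp
qed

text \<open>Expanding the product gives \<open>1\<close>, the squares of the coordinates and further nonnegative terms.\<close>

lemma cauchy_weight_ge: "1 + (norm x)\<^sup>2 \<le> cauchy_weight (x::'a::euclidean_space)"
proof -
  have "1 + (\<Sum>b\<in>B. f b) \<le> (\<Prod>b\<in>B. 1 + f b)" if "finite B" "\<And>b. f b \<ge> (0::real)" for B :: "'a set" and f
    using that(1)
  proof (induction B)
    case (insert b B)
    have "1 \<le> (\<Prod>b\<in>B. 1 + f b)" using that(2) by (intro prod_ge_1) auto
    then have "f b * 1 \<le> f b * (\<Prod>b\<in>B. 1 + f b)" using that(2) by (intro mult_left_mono) auto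
    then show ?case using insert by (simp add: algebra_simps)
  qed simp
  from this[of Basis "\<lambda>b. (x \<bullet> b)\<^sup>2"] have "1 + (\<Sum>b\<in>Basis. (x \<bullet> b)\<^sup>2) \<le> cauchy_weight x"
    by (simp add: cauchy_weight_def)
  moreover have "(norm x)\<^sup>2 = (\<Sum>b\<in>Basis. (x \<bullet> b)\<^sup>2)"
    by (subst power2_norm_eq_inner, subst euclidean_inner) (simp add: power2_eq_square)
  ultimately show ?thesis by simp
qed

lemma isCont_schwartz: "schwartz f \<Longrightarrow> isCont f x"
  using schwartz_has_derivative has_derivative_continuous by blast

lemma borel_measurable_schwartz: "schwartz f \<Longrightarrow> f \<in> borel_measurable borel"
  by (intro borel_measurable_continuous_onI continuous_at_imp_continuous_on ballI isCont_schwartz)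

lemma integrable_schwartz:
  fixes f :: "'a::euclidean_space \<Rightarrow> complex"
  assumes f: "schwartz f"
  shows "integrable lborel f"
proof -
  obtain C where C: "C \<ge> 0" "\<And>x. norm (f x) * (1 + (norm x)\<^sup>2) ^ DIM('a) \<le> C"
    using schwartz_decay[OF f] by blast
  show ?thesis
  proof (rule Bochner_Integration.integrable_bound)
    show "integrable lborel (\<lambda>x::'a. C * inverse (cauchy_weight x))"
      using integrable_inverse_cauchy_weight[where 'a='a] by simp
    show "AE x in lborel. norm (f x) \<le> norm (C * inverse (cauchy_weight x))"
    proof (rule AE_I2)
      fix x
      have "norm (f x) * cauchy_weight x \<le> norm (f x) * (1 + (norm x)\<^sup>2) ^ DIM('a)"
        by (intro mult_left_mono cauchy_weight_le) auto
      also have "\<dots> \<le> C" by (rule C)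
      finally show "norm (f x) \<le> norm (C * inverse (cauchy_weight x))"
        using C(1) cauchy_weight_pos[of x] by (simp add: divide_simps abs_mult)
    qed
  qed (use borel_measurable_schwartz[OF f] in simp)
qed

lemma schwartz_bounded:
  assumes "schwartz f" obtains B where "\<And>x. norm (f x) \<le> B"
  using schwartz_decay[OF assms, where k = 0] by auto

text \<open>Integrating \<open>g'\<close> over unit segments in direction \<open>b\<close> gives \<open>g (x + b) - g x\<close>, whose integral over \<open>x\<close> vanishes
  by translation invariance; by Fubini's theorem and translation invariance the same double integral is
  \<open>\<integral> g'\<close>. This replaces integration by parts and its boundary terms.\<close>

lemma integral_directional_derivative_zero:
  fixes g g' :: "'a::euclidean_space \<Rightarrow> complex"
  assumes g: "integrable lborel g" and g': "integrable lborel g'"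
    and der: "\<And>x. (g has_derivative D x) (at x)" and D: "\<And>x. D x b = g' x"
    and cont: "\<And>x. isCont g' x"
  shows "(LBINT x. g' x) = 0"
proof -
  have [measurable]: "g \<in> borel_measurable borel" "g' \<in> borel_measurable borel" using g g' by auto
  have FTC: "(LBINT s. indicator {0..1} s *\<^sub>R g' (x + s *\<^sub>R b)) = g (x + b) - g x" for x
  proof -
    have "has_bochner_integral lborel (\<lambda>s. indicator {0..1} s *\<^sub>R g' (x + s *\<^sub>R b)) ((\<lambda>s. g (x + s *\<^sub>R b)) 1 - (\<lambda>s. g (x + s *\<^sub>R b)) 0)"
    proof (rule has_bochner_integral_FTC_Icc)
      fix s :: real
      have "((\<lambda>s. g (x + s *\<^sub>R b)) has_derivative (\<lambda>h. D (x + s *\<^sub>R b) (h *\<^sub>R b))) (at s within {0..1})"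
        by (rule has_derivative_compose[OF _ der]) (auto intro!: derivative_eq_intros)
      moreover have "D (x + s *\<^sub>R b) (h *\<^sub>R b) = h *\<^sub>R g' (x + s *\<^sub>R b)" for h
        using D linear_scale[OF has_derivative_linear[OF der]] by metis
      ultimately show "((\<lambda>s. g (x + s *\<^sub>R b)) has_vector_derivative g' (x + s *\<^sub>R b)) (at s within {0..1})"
        by (simp add: has_vector_derivative_def)
    next
      show "continuous_on {0..1} (\<lambda>s. g' (x + s *\<^sub>R b))"
        by (intro continuous_at_imp_continuous_on ballI isCont_o2[OF _ cont] continuous_intros)
    qed simp
    then show ?thesis by (simp add: has_bochner_integral_iff)
  qed
  have trans: "(LBINT x. f (x + t)) = (LBINT x. f x)" "integrable lborel (\<lambda>x. f (x + t))"
    if "integrable lborel f" for f :: "'a \<Rightarrow> complex" and t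
    using lborel_integral_affine[of 1 f t] lborel_integrable_affine[of 1 f t] that
    by (auto simp: add.commute)
  have norm_trans: "(LBINT x. norm (g' (x + t))) = (LBINT x. norm (g' x))" for t
    using trans(1)[of "\<lambda>x. cpx (norm (g' x))" t] g' by (simp add: complex_of_real_integrable_eq)
  have "integrable (lborel \<Otimes>\<^sub>M lborel) (\<lambda>(s::real, x). indicator {0..1} s *\<^sub>R g' (x + s *\<^sub>R b))"
  proof (rule lborel_pair.Fubini_integrable)
    show "integrable lborel (\<lambda>s::real. LBINT x. norm (case (s, x) of (s, x) \<Rightarrow> indicator {0..1} s *\<^sub>R g' (x + s *\<^sub>R b)))"
      by (simp add: norm_trans)
    show "AE s in lborel. integrable lborel (\<lambda>x. case (s, x) of (s::real, x) \<Rightarrow> indicator {0..1} s *\<^sub>R g' (x + s *\<^sub>R b))"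
      using trans(2)[OF g'] by simp
  qed simp
  then have "(LBINT x. (LBINT s. indicator {0..1::real} s *\<^sub>R g' (x + s *\<^sub>R b)))
     = (LBINT s. (LBINT x. indicator {0..1::real} s *\<^sub>R g' (x + s *\<^sub>R b)))"
    by (rule lborel_pair.Fubini_integral)
  also have "\<dots> = (LBINT x. g' x)"
    using trans(1)[OF g'] by simp
  also have "(LBINT x. (LBINT s. indicator {0..1::real} s *\<^sub>R g' (x + s *\<^sub>R b))) = 0"
    unfolding FTC using trans[OF g] g by simp
  finally show ?thesis by simp
qed

lemma has_derivative_cexp:
  fixes g :: "'a::real_normed_vector \<Rightarrow> complex"
  assumes "(g has_derivative g') (at x)"
  shows "((\<lambda>x. exp (g x)) has_derivative (\<lambda>v. exp (g x) * g' v)) (at x)"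
  by (rule has_derivative_compose[OF assms DERIV_exp[unfolded has_field_derivative_def]])

text \<open>The integral of the \<open>b\<close>-derivative of \<open>exp (i \<xi> \<bullet> x) * \<phi> x\<close> is zero, and the product rule splits it.\<close>

lemma fourier_partial:
  fixes \<phi> :: "'a::euclidean_space \<Rightarrow> complex"
  assumes \<phi>: "schwartz \<phi>" and b: "b \<in> Basis"
  shows "fourier (partial b \<phi>) \<xi> = - \<i> * cpx (\<xi> \<bullet> b) * fourier \<phi> \<xi>"
proof -
  let ?E = "\<lambda>x. iexp (\<xi> \<bullet> x)"
  have s: "schwartz (partial b \<phi>)" by (rule schwartz_partial[OF \<phi> b])
  have i1: "integrable lborel (\<lambda>x. ?E x * \<phi> x)" and i2: "integrable lborel (\<lambda>x. ?E x * partial b \<phi> x)"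
    using integrable_iexp_mult integrable_schwartz \<phi> s by blast+
  have "(LBINT x. \<i> * cpx (\<xi> \<bullet> b) * (?E x * \<phi> x) + ?E x * partial b \<phi> x) = 0"
  proof (rule integral_directional_derivative_zero[where g = "\<lambda>x. ?E x * \<phi> x"
        and D = "\<lambda>x v. ?E x * frechet_derivative \<phi> (at x) v + (\<i> * cpx (\<xi> \<bullet> v) * ?E x) * \<phi> x" and b = b])
    show "((\<lambda>x. ?E x * \<phi> x) has_derivative (\<lambda>v. ?E x * frechet_derivative \<phi> (at x) v + (\<i> * cpx (\<xi> \<bullet> v) * ?E x) * \<phi> x)) (at x)" for x
      by (rule has_derivative_mult[OF _ schwartz_has_derivative[OF \<phi>]])
         (rule has_derivative_eq_rhs[OF has_derivative_cexp], auto intro!: derivative_eq_intros simp: mult_ac)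
    show "isCont (\<lambda>x. \<i> * cpx (\<xi> \<bullet> b) * (?E x * \<phi> x) + ?E x * partial b \<phi> x) x" for x
      by (intro continuous_intros isCont_schwartz \<phi> s)
  qed (use i1 i2 in \<open>auto simp: partial_def\<close>)
  then have "\<i> * cpx (\<xi> \<bullet> b) * fourier \<phi> \<xi> + fourier (partial b \<phi>) \<xi> = 0"
    using i1 i2 by (simp add: fourier_def)
  then show ?thesis by (simp add: add_eq_0_iff)
qed

lemma fourier_lincomb:
  assumes "integrable lborel f" "integrable lborel g"
  shows "fourier (\<lambda>x. f x + c * g x) \<xi> = fourier f \<xi> + c * fourier g \<xi>"
proof -
  have "(LBINT x. iexp (\<xi> \<bullet> x) * f x + c * (iexp (\<xi> \<bullet> x) * g x)) = fourier f \<xi> + c * fourier g \<xi>"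
    unfolding fourier_def using integrable_iexp_mult[OF assms(1), of \<xi>] integrable_iexp_mult[OF assms(2), of \<xi>] by simp
  then show ?thesis unfolding fourier_def by (simp add: algebra_simps)
qed

text \<open>One application of \<open>1 - \<partial>\<^sub>b\<partial>\<^sub>b\<close> for each basis vector \<open>b\<close> produces the weight factor by factor.\<close>

lemma ex_schwartz_fourier_weight:
  fixes \<phi> :: "'a::euclidean_space \<Rightarrow> complex"
  assumes \<phi>: "schwartz \<phi>"
  shows "\<exists>\<psi>. schwartz \<psi> \<and> (\<forall>\<xi>. fourier \<psi> \<xi> = cpx (cauchy_weight \<xi>) * fourier \<phi> \<xi>)"
proof -
  have "\<exists>\<psi>. schwartz \<psi> \<and> (\<forall>\<xi>. fourier \<psi> \<xi> = cpx (\<Prod>b\<in>B. 1 + (\<xi> \<bullet> b)\<^sup>2) * fourier \<phi> \<xi>)"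
    if "finite B" "B \<subseteq> Basis" for B :: "'a set"
    using that
  proof (induction B)
    case empty
    show ?case using \<phi> by auto
  next
    case (insert b B)
    then obtain \<psi> where \<psi>: "schwartz \<psi>" "\<And>\<xi>. fourier \<psi> \<xi> = cpx (\<Prod>b\<in>B. 1 + (\<xi> \<bullet> b)\<^sup>2) * fourier \<phi> \<xi>"
      by auto
    have b: "b \<in> Basis" using insert by auto
    have s: "schwartz (partial b (partial b \<psi>))" by (intro schwartz_partial \<psi> b)
    have "fourier (\<lambda>x. \<psi> x + (-1) * partial b (partial b \<psi>) x) \<xi> = cpx (\<Prod>b\<in>insert b B. 1 + (\<xi> \<bullet> b)\<^sup>2) * fourier \<phi> \<xi>" for \<xi>
      by (subst fourier_lincomb) (use insert in \<open>auto simp: integrable_schwartz \<psi> s fourier_partial schwartz_partial b power2_eq_square algebra_simps\<close>)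
    then show ?case using schwartz_lincomb[OF \<psi>(1) s, of "-1"] by blast
  qed
  from this[of Basis] show ?thesis by (simp add: cauchy_weight_def)
qed

text \<open>The transform of a Schwartz function is bounded. Applying this to a Schwartz function whose transform is the
  square of \<open>cauchy_weight\<close> times that of \<open>\<phi>\<close> leaves one factor to compensate the weight in the claim
  and one to make the rest integrable.\<close>

lemma integrable_weight_fourier_schwartz:
  fixes \<phi> :: "'a::euclidean_space \<Rightarrow> complex"
  assumes \<phi>: "schwartz \<phi>"
  shows "integrable lborel (\<lambda>\<xi>. cpx (1 + (norm \<xi>)\<^sup>2) * fourier \<phi> \<xi>)"
proof -
  obtain \<psi>1 where 1: "schwartz \<psi>1" "\<And>\<xi>. fourier \<psi>1 \<xi> = cpx (cauchy_weight \<xi>) * fourier \<phi> \<xi>"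
    using ex_schwartz_fourier_weight[OF \<phi>] by blast
  obtain \<psi> where 2: "schwartz \<psi>" "\<And>\<xi>. fourier \<psi> \<xi> = cpx (cauchy_weight \<xi>) * fourier \<psi>1 \<xi>"
    using ex_schwartz_fourier_weight[OF 1(1)] by blast
  define C where "C = (LBINT x. norm (\<psi> x))"
  have C: "C \<ge> 0" by (simp add: C_def)
  have [measurable]: "fourier \<phi> \<in> borel_measurable borel" by (intro borel_measurable_fourier integrable_schwartz \<phi>)
  show ?thesis
  proof (rule Bochner_Integration.integrable_bound)
    show "integrable lborel (\<lambda>x::'a. C * inverse (cauchy_weight x))"
      using integrable_inverse_cauchy_weight[where 'a='a] by simp
    show "AE x in lborel. norm (cpx (1 + (norm x)\<^sup>2) * fourier \<phi> x) \<le> norm (C * inverse (cauchy_weight x))"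
    proof (rule AE_I2)
      fix x :: 'a
      let ?w = "cauchy_weight x"
      have w: "?w > 0" by (rule cauchy_weight_pos)
      have "norm (fourier \<psi> x) \<le> C" unfolding C_def by (rule norm_fourier_le)
      then have *: "?w * (?w * norm (fourier \<phi> x)) \<le> C"
        using w by (simp add: 1 2 norm_mult)
      have "norm (cpx (1 + (norm x)\<^sup>2) * fourier \<phi> x) = (1 + (norm x)\<^sup>2) * norm (fourier \<phi> x)"
        unfolding norm_mult norm_of_real by simp
      also have "\<dots> \<le> ?w * norm (fourier \<phi> x)"
        by (intro mult_right_mono cauchy_weight_ge) auto
      also have "\<dots> \<le> C * inverse ?w" using * w by (simp add: field_simps)
      finally show "norm (cpx (1 + (norm x)\<^sup>2) * fourier \<phi> x) \<le> norm (C * inverse (cauchy_weight x))"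
        using C w by simp
    qed
  qed simp
qed

text \<open>Quadratic growth covers all multipliers below: those of order \<open>2 * \<theta>\<close>, \<open>\<alpha>\<close> and \<open>1\<close>.\<close>

lemma integrable_fourier_schwartz_mult:
  fixes \<phi> :: "'a::euclidean_space \<Rightarrow> complex"
  assumes \<phi>: "schwartz \<phi>" and [measurable]: "m \<in> borel_measurable borel"
    and m: "\<And>\<xi>. norm (m \<xi>) \<le> C * (1 + (norm \<xi>)\<^sup>2)"
  shows "integrable lborel (\<lambda>\<xi>. m \<xi> * fourier \<phi> \<xi>)"
proof (rule Bochner_Integration.integrable_bound)
  have [measurable]: "fourier \<phi> \<in> borel_measurable borel" by (intro borel_measurable_fourier integrable_schwartz \<phi>)
  show "integrable lborel (\<lambda>\<xi>. cpx C * (cpx (1 + (norm \<xi>)\<^sup>2) * fourier \<phi> \<xi>))"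
    by (intro integrable_mult_right integrable_weight_fourier_schwartz \<phi>)
  show "AE \<xi> in lborel. norm (m \<xi> * fourier \<phi> \<xi>) \<le> norm (cpx C * (cpx (1 + (norm \<xi>)\<^sup>2) * fourier \<phi> \<xi>))"
  proof (rule AE_I2)
    fix \<xi>
    have "norm (m \<xi>) \<le> \<bar>C\<bar> * (1 + (norm \<xi>)\<^sup>2)"
      by (rule order_trans[OF m]) (intro mult_right_mono, auto)
    then have "norm (m \<xi>) * norm (fourier \<phi> \<xi>) \<le> \<bar>C\<bar> * (1 + (norm \<xi>)\<^sup>2) * norm (fourier \<phi> \<xi>)"
      by (rule mult_right_mono) simp
    then show "norm (m \<xi> * fourier \<phi> \<xi>) \<le> norm (cpx C * (cpx (1 + (norm \<xi>)\<^sup>2) * fourier \<phi> \<xi>))"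
      unfolding norm_mult norm_of_real by simp
  qed
  show "(\<lambda>\<xi>. m \<xi> * fourier \<phi> \<xi>) \<in> borel_measurable lborel" by simp
qed

lemma integrable_fourier_schwartz: "schwartz \<phi> \<Longrightarrow> integrable lborel (fourier \<phi>)"
  using integrable_fourier_schwartz_mult[of \<phi> "\<lambda>_. 1" 1] by simp

lemma fourier_inversion_schwartz:
  fixes \<phi> :: "'a::euclidean_space \<Rightarrow> complex"
  assumes \<phi>: "schwartz \<phi>"
  shows "\<phi> x = cpx (1 / (2 * pi) ^ DIM('a)) *
    (LBINT \<xi>. exp (- \<i> * cpx (\<xi> \<bullet> x)) * fourier \<phi> \<xi>)"
proof -
  obtain B where "\<And>x. norm (\<phi> x) \<le> B" using schwartz_bounded[OF \<phi>] by blast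
  then show ?thesis
    by (intro fourier_inversion integrable_schwartz integrable_fourier_schwartz isCont_schwartz \<phi>)
qed

text \<open>Polynomials as functions on the whole space, without reference to a choice of monomials; only closure under
  sums, products and derivatives matters for iterated derivatives of Gaussians.\<close>

inductive poly_fun :: "('a::euclidean_space \<Rightarrow> complex) \<Rightarrow> bool" where
  const: "poly_fun (\<lambda>_. c)"
| coord: "poly_fun (\<lambda>x. cpx (x \<bullet> b))"
| add: "poly_fun p \<Longrightarrow> poly_fun q \<Longrightarrow> poly_fun (\<lambda>x. p x + q x)"
| mult: "poly_fun p \<Longrightarrow> poly_fun q \<Longrightarrow> poly_fun (\<lambda>x. p x * q x)"

lemma poly_fun_derivative:
  "poly_fun p \<Longrightarrow> \<exists>D. (\<forall>x. (p has_derivative D x) (at x)) \<and> (\<forall>b. poly_fun (\<lambda>x. D x b))"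
proof (induction rule: poly_fun.induct)
  case (const c)
  show ?case by (rule exI[of _ "\<lambda>_ _. 0"]) (auto intro: poly_fun.const)
next
  case (coord b)
  show ?case by (rule exI[of _ "\<lambda>_ v. cpx (v \<bullet> b)"])
    (auto intro!: poly_fun.const derivative_eq_intros)
next
  case (add p q)
  then obtain D E where "\<forall>x. (p has_derivative D x) (at x)" "\<forall>b. poly_fun (\<lambda>x. D x b)"
    "\<forall>x. (q has_derivative E x) (at x)" "\<forall>b. poly_fun (\<lambda>x. E x b)" by blast
  then show ?case by (intro exI[of _ "\<lambda>x v. D x v + E x v"]) (auto intro!: poly_fun.add has_derivative_add)
next
  case (mult p q)
  then obtain D E where "\<forall>x. (p has_derivative D x) (at x)" "\<forall>b. poly_fun (\<lambda>x. D x b)"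
    "\<forall>x. (q has_derivative E x) (at x)" "\<forall>b. poly_fun (\<lambda>x. E x b)" by blast
  with mult show ?case by (intro exI[of _ "\<lambda>x v. p x * E x v + D x v * q x"]) (auto intro!: poly_fun.add poly_fun.mult has_derivative_mult)
qed

lemma poly_fun_bound: "poly_fun p \<Longrightarrow> \<exists>C N. C \<ge> 0 \<and> (\<forall>x. norm (p x) \<le> C * (1 + norm x) ^ N)"
proof (induction rule: poly_fun.induct)
  case (const c)
  show ?case by (rule exI[of _ "norm c"], rule exI[of _ 0]) auto
next
  case (coord b)
  show ?case
  proof (intro exI[of _ "norm b"] exI[of _ 1] conjI allI)
    fix x
    have "\<bar>x \<bullet> b\<bar> \<le> norm x * norm b" by (rule Cauchy_Schwarz_ineq2)
    then show "norm (cpx (x \<bullet> b)) \<le> norm b * (1 + norm x) ^ 1"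
      using norm_ge_zero[of b] by (simp only: norm_of_real power_one_right ring_distribs mult_1_right mult.commute)
  qed simp
next
  case (add p q)
  then obtain C N D M where *: "C \<ge> 0" "D \<ge> 0" "\<And>x. norm (p x) \<le> C * (1 + norm x) ^ N" "\<And>x. norm (q x) \<le> D * (1 + norm x) ^ M"
    by blast
  show ?case
  proof (intro exI[of _ "C + D"] exI[of _ "max N M"] conjI allI)
    fix x
    have "norm (p x + q x) \<le> C * (1 + norm x) ^ N + D * (1 + norm x) ^ M"
      by (intro norm_triangle_le add_mono *)
    also have "\<dots> \<le> C * (1 + norm x) ^ max N M + D * (1 + norm x) ^ max N M"
      by (intro add_mono mult_left_mono power_increasing *) auto
    finally show "norm (p x + q x) \<le> (C + D) * (1 + norm x) ^ max N M" by (simp add: algebra_simps)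
  qed (use * in auto)
next
  case (mult p q)
  then obtain C N D M where *: "C \<ge> 0" "D \<ge> 0" "\<And>x. norm (p x) \<le> C * (1 + norm x) ^ N" "\<And>x. norm (q x) \<le> D * (1 + norm x) ^ M"
    by blast
  show ?case
  proof (intro exI[of _ "C * D"] exI[of _ "N + M"] conjI allI)
    fix x
    have "norm (p x * q x) \<le> (C * (1 + norm x) ^ N) * (D * (1 + norm x) ^ M)"
      unfolding norm_mult by (intro mult_mono *) (use * in auto)
    then show "norm (p x * q x) \<le> C * D * (1 + norm x) ^ (N + M)" by (simp add: algebra_simps power_add)
  qed (use * in auto)
qed

text \<open>\<open>y ^ N / fact N\<close> is one term of the exponential series.\<close>

lemma power_le_fact_exp:
  fixes y :: real assumes "y \<ge> 0"
  shows "y ^ N \<le> fact N * exp y"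
proof -
  have "(\<Sum>n\<in>{N}. y ^ n /\<^sub>R fact n) \<le> (\<Sum>n. y ^ n /\<^sub>R fact n)"
    using assms by (intro sum_le_suminf summable_exp_generic) auto
  then show ?thesis by (simp add: exp_def field_simps)
qed

lemma bounded_power_exp_neg_square:
  fixes e :: real assumes e: "e > 0"
  shows "\<exists>B. \<forall>r\<ge>0. (1 + r) ^ N * exp (- (e * r)\<^sup>2 / 2) \<le> B"
proof (intro exI allI impI)
  fix r :: real assume r: "r \<ge> 0"
  define c where "c = e\<^sup>2 / 2"
  have c: "c > 0" using e by (simp add: c_def)
  have ec: "exp (- (e * r)\<^sup>2 / 2) = exp (- (c * r\<^sup>2))" by (simp add: c_def power_mult_distrib)
  have "(1 + r) ^ N \<le> (2 * max 1 (r\<^sup>2)) ^ N"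
  proof (intro power_mono)
    show "1 + r \<le> 2 * max 1 (r\<^sup>2)"
    proof (cases "r \<le> 1")
      case False then have "r * 1 \<le> r * r" by (intro mult_left_mono) auto
      with False have "1 + r \<le> 2 * (r * r)" by linarith
      then show ?thesis by (simp add: max_def power2_eq_square)
    qed (simp add: max_def)
  qed (use r in auto)
  also have "\<dots> = 2 ^ N * max 1 (r\<^sup>2) ^ N" by (rule power_mult_distrib)
  also have "max 1 (r\<^sup>2) ^ N \<le> 1 + (r\<^sup>2) ^ N" by (auto simp: max_def)
  also have "(r\<^sup>2) ^ N = (c * r\<^sup>2) ^ N / c ^ N" using c by (simp add: power_mult_distrib)
  also have "(c * r\<^sup>2) ^ N \<le> fact N * exp (c * r\<^sup>2)" using c by (intro power_le_fact_exp) auto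
  also have "1 \<le> exp (c * r\<^sup>2)" using c by simp
  finally have "(1 + r) ^ N \<le> 2 ^ N * (exp (c * r\<^sup>2) + fact N * exp (c * r\<^sup>2) / c ^ N)"
    using c by (simp add: divide_right_mono)
  also have "\<dots> = 2 ^ N * (1 + fact N / c ^ N) * exp (c * r\<^sup>2)" by (simp add: algebra_simps)
  finally show "(1 + r) ^ N * exp (- (e * r)\<^sup>2 / 2) \<le> 2 ^ N * (1 + fact N / c ^ N)"
    unfolding ec exp_minus by (simp add: field_simps)
qed

text \<open>Every iterated partial derivative is a polynomial times the function itself, and the Gaussian beats every
  polynomial.\<close>

lemma schwartz_modulated_gauss:
  fixes \<xi>0 :: "'a::euclidean_space"
  assumes e: "e > 0"
  shows "schwartz (\<lambda>x. iexp (\<xi>0 \<bullet> x) * cpx (exp (- (norm (e *\<^sub>R x))\<^sup>2 / 2)))"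
proof -
  define E where "E x = iexp (\<xi>0 \<bullet> x) * cpx (exp (- (norm (e *\<^sub>R x))\<^sup>2 / 2))" for x
  have E: "E = (\<lambda>x. exp (\<i> * cpx (\<xi>0 \<bullet> x) - cpx (e\<^sup>2 / 2 * (x \<bullet> x))))"
  proof
    fix x :: 'a
    have *: "- (norm (e *\<^sub>R x))\<^sup>2 / 2 = - (e\<^sup>2 / 2 * (x \<bullet> x))"
      by (simp add: power_mult_distrib power2_norm_eq_inner)
    have "exp A * cpx (exp (- B)) = exp (A - cpx B)" for A B
      by (simp add: exp_diff exp_minus exp_of_real divide_inverse)
    then show "E x = exp (\<i> * cpx (\<xi>0 \<bullet> x) - cpx (e\<^sup>2 / 2 * (x \<bullet> x)))"
      unfolding E_def * .
  qed
  have dE: "(E has_derivative (\<lambda>v. E x * (\<i> * cpx (\<xi>0 \<bullet> v) - cpx (e\<^sup>2 * (x \<bullet> v))))) (at x)" for x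
    unfolding E by (rule has_derivative_eq_rhs[OF has_derivative_cexp])
      (auto intro!: derivative_eq_intros simp: algebra_simps inner_commute)
  have form: "\<exists>p. poly_fun p \<and> iterated_partial bs E = (\<lambda>x. p x * E x)" if "set bs \<subseteq> Basis" for bs
    using that
  proof (induction bs)
    case Nil
    show ?case by (rule exI[of _ "\<lambda>_. 1"]) (auto intro: poly_fun.const)
  next
    case (Cons b bs)
    then obtain p where p: "poly_fun p" "iterated_partial bs E = (\<lambda>x. p x * E x)" by auto
    obtain D where D: "\<And>x. (p has_derivative D x) (at x)" "\<And>b. poly_fun (\<lambda>x. D x b)"
      using poly_fun_derivative[OF p(1)] by blast
    have "((\<lambda>x. p x * E x) has_derivative (\<lambda>v. p x * (E x * (\<i> * cpx (\<xi>0 \<bullet> v) - cpx (e\<^sup>2 * (x \<bullet> v)))) + D x v * E x)) (at x)" for x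
      by (rule has_derivative_mult[OF D(1) dE])
    then have "partial b (\<lambda>x. p x * E x) x = p x * (E x * (\<i> * cpx (\<xi>0 \<bullet> b) - cpx (e\<^sup>2 * (x \<bullet> b)))) + D x b * E x" for x
      by (rule partial_eqI)
    then have "iterated_partial (b # bs) E = (\<lambda>x. (D x b + p x * (\<i> * cpx (\<xi>0 \<bullet> b) + cpx (- (e\<^sup>2)) * cpx (x \<bullet> b))) * E x)"
      unfolding iterated_partial_Cons p(2) by (simp add: fun_eq_iff algebra_simps)
    moreover have "poly_fun (\<lambda>x. D x b + p x * (\<i> * cpx (\<xi>0 \<bullet> b) + cpx (- (e\<^sup>2)) * cpx (x \<bullet> b)))"
      by (intro poly_fun.intros D p)
    ultimately show ?case by blast
  qed
  have "schwartz E" unfolding schwartz_def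
  proof (intro allI impI conjI)
    fix bs :: "'a list" and x :: 'a and k :: nat
    assume "set bs \<subseteq> Basis"
    from form[OF this] obtain p where p: "poly_fun p" "iterated_partial bs E = (\<lambda>x. p x * E x)" by blast
    obtain D where D: "\<And>x. (p has_derivative D x) (at x)" using poly_fun_derivative[OF p(1)] by blast
    show "iterated_partial bs E differentiable (at x)"
      unfolding p(2) differentiable_def using has_derivative_mult[OF D dE] by blast
    obtain C N where C: "C \<ge> 0" "\<And>x. norm (p x) \<le> C * (1 + norm x) ^ N" using poly_fun_bound[OF p(1)] by blast
    obtain B where B: "\<And>r. r \<ge> 0 \<Longrightarrow> (1 + r) ^ (k + N) * exp (- (e * r)\<^sup>2 / 2) \<le> B" using bounded_power_exp_neg_square[OF e] by blast
    have nE: "norm (E x) = exp (- (e * norm x)\<^sup>2 / 2)" for x using e by (simp add: E_def norm_mult)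
    have "norm (norm x ^ k *\<^sub>R (p x * E x)) \<le> C * B" for x
    proof -
      have "norm (norm x ^ k *\<^sub>R (p x * E x)) = norm x ^ k * (norm (p x) * norm (E x))" by (simp add: norm_mult)
      also have "\<dots> \<le> (1 + norm x) ^ k * ((C * (1 + norm x) ^ N) * norm (E x))"
        by (intro mult_mono power_mono C mult_nonneg_nonneg) auto
      also have "\<dots> = C * ((1 + norm x) ^ (k + N) * exp (- (e * norm x)\<^sup>2 / 2))" by (simp add: nE power_add)
      also have "\<dots> \<le> C * B" by (intro mult_left_mono B C) auto
      finally show ?thesis .
    qed
    then show "bounded (range (\<lambda>x. norm x ^ k *\<^sub>R iterated_partial bs E x))"
      unfolding p(2) bounded_iff by blast
  qed
  then show ?thesis by (simp add: E_def[abs_def])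
qed

lemma onorm_mult_const_le: "onorm (\<lambda>v::complex. k * v) \<le> norm k"
  by (rule onorm_le) (simp add: norm_mult)

section \<open>Laplace transforms on the right half-plane\<close>

text \<open>On a ball of radius \<open>Re z / 2\<close> around \<open>z\<close> the derivative of the integrand is dominated by an integrable
  exponential.\<close>

lemma laplace_holomorphic:
  fixes M :: "real measure"
  assumes M: "sets M = sets borel" and nonneg: "AE x in M. x \<ge> 0"
    and int: "\<And>c. c > 0 \<Longrightarrow> integrable M (\<lambda>x. exp (- c * x))"
  shows "(\<lambda>z. \<integral>x. exp (- (z * cpx x)) \<partial>M) holomorphic_on {z. Re z > 0}"
  unfolding holomorphic_on_def
proof
  fix z assume "z \<in> {z. Re z > 0}"
  then have z: "Re z > 0" by simp
  have [measurable_cong]: "sets M = sets borel" by (rule M)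
  define c where "c = Re z / 2"
  have c: "c > 0" using z by (simp add: c_def)
  have Re: "Re p > c" if "p \<in> ball z c" for p
    using that abs_Re_le_cmod[of "z - p"] by (auto simp: dist_norm c_def)
  \<comment> \<open>The indicator function makes the bounds hold everywhere instead of almost everywhere.\<close>
  let ?f = "\<lambda>p x. indicator {0..} x *\<^sub>R exp (- (p * cpx x))"
  let ?f' = "\<lambda>p x. indicator {0..} x *\<^sub>R (- cpx x * exp (- (p * cpx x)))"
  have "((\<lambda>p. \<integral>x. ?f p x \<partial>M) has_derivative (\<lambda>v. \<integral>x. ?f' z x * v \<partial>M)) (at z)"
  proof (rule has_derivative_integral[where S = "ball z c" and g = "\<lambda>x. 2 / c * exp (- (c / 2) * x)" and f' = "\<lambda>p x v. ?f' p x * v"])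
    show "integrable M (\<lambda>x. 2 / c * exp (- (c / 2) * x))"
      by (intro integrable_mult_right int) (use c in simp)
    fix p x assume p: "p \<in> ball z c"
    show "integrable M (?f p)"
    proof (rule Bochner_Integration.integrable_bound[OF int[OF c]])
      show "AE x in M. norm (?f p x) \<le> norm (exp (- c * x))"
        by (rule AE_I2) (use Re[OF p] in \<open>auto split: split_indicator simp: mult_right_mono\<close>)
    qed measurable
    show "((\<lambda>p. ?f p x) has_derivative (\<lambda>v. ?f' p x * v)) (at p)"
      by (rule has_derivative_eq_rhs[OF has_derivative_scaleR_right[OF has_derivative_cexp]])
         (auto intro!: derivative_eq_intros)
    show "onorm (\<lambda>v. ?f' p x * v) \<le> 2 / c * exp (- (c / 2) * x)"
    proof (cases "x \<ge> 0")
      case True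
      have "onorm (\<lambda>v. ?f' p x * v) \<le> norm (?f' p x)" by (rule onorm_mult_const_le)
      also have "\<dots> = x * exp (- (Re p * x))" using True by (simp add: norm_mult)
      also have "\<dots> \<le> x * exp (- (c * x))" using Re[OF p] True by (intro mult_left_mono) (auto simp: mult_right_mono)
      also have "\<dots> = 2 / c * ((c / 2 * x) * exp (- (c * x)))" using c by simp
      \<comment> \<open>Half of the decay is spent on absorbing the factor \<open>x\<close>.\<close>
      also have "\<dots> \<le> 2 / c * (exp (c / 2 * x) * exp (- (c * x)))"
      proof (intro mult_left_mono mult_right_mono)
        show "c / 2 * x \<le> exp (c / 2 * x)" using exp_ge_add_one_self[of "c / 2 * x"] by linarith
      qed (use c in auto)
      also have "\<dots> = 2 / c * exp (- (c / 2) * x)" by (simp flip: exp_add)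
      finally show ?thesis .
    next
      case False
      then show ?thesis using c by (simp add: onorm_zero)
    qed
  qed (use c in auto)
  then have "((\<lambda>p. \<integral>x. ?f p x \<partial>M) has_field_derivative (\<integral>x. ?f' z x \<partial>M)) (at z)"
    by (simp only: has_field_derivative_def integral_mult_left_zero)
  moreover have "(\<integral>x. ?f p x \<partial>M) = (\<integral>x. exp (- (p * cpx x)) \<partial>M)" for p
    by (intro integral_cong_AE) (use nonneg in \<open>auto elim!: eventually_mono\<close>)
  ultimately show "(\<lambda>z. \<integral>x. exp (- (z * cpx x)) \<partial>M) field_differentiable at z within {z. Re z > 0}"
    by (auto simp: field_differentiable_def intro: has_field_derivative_at_within)
qed

lemma right_half_plane_nonpos: "Re z > 0 \<Longrightarrow> z \<notin> \<real>\<^sub>\<le>\<^sub>0"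
  by (auto simp: complex_nonpos_Reals_iff)

text \<open>The positive half-line accumulates at \<open>1\<close>, so the identity theorem applies.\<close>

lemma right_half_plane_continuation:
  assumes f: "f holomorphic_on {z. Re z > 0}" and g: "g holomorphic_on {z. Re z > 0}"
    and eq: "\<And>\<xi>. \<xi> > 0 \<Longrightarrow> f (cpx \<xi>) = g (cpx \<xi>)" and z: "Re z > 0"
  shows "f z = g z"
proof -
  let ?S = "{z. Re z > 0}" and ?U = "cpx ` {0<..}"
  have "f z - g z = 0"
  proof (rule analytic_continuation[where f = "\<lambda>z. f z - g z" and S = ?S and U = ?U and \<xi> = 1])
    show "(\<lambda>z. f z - g z) holomorphic_on ?S" by (intro holomorphic_intros f g)
    show "open ?S" by (rule open_halfspace_Re_gt)
    show "connected ?S" by (intro convex_connected convex_halfspace_Re_gt)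
    show "1 islimpt ?U"
      unfolding islimpt_approachable
    proof (intro allI impI)
      fix e :: real assume e: "e > 0"
      show "\<exists>x'\<in>?U. x' \<noteq> 1 \<and> dist x' 1 < e"
      proof (rule bexI[of _ "cpx (1 + e / 2)"])
        show "cpx (1 + e / 2) \<noteq> 1 \<and> dist (cpx (1 + e / 2)) 1 < e"
          using e by (simp add: dist_norm norm_divide)
        show "cpx (1 + e / 2) \<in> ?U" using e by (intro imageI) auto
      qed
    qed
  qed (use eq z in auto)
  then show ?thesis by simp
qed

text \<open>Analytic continuation extends the formula for the Laplace transform to complex arguments of positive real part,
  and \<open>- i y\<close> is a boundary point reached as the limit of \<open>d - i y\<close>. The function \<open>z powr \<alpha>\<close> is continuous there,
  also at \<open>0\<close> because \<open>\<alpha>\<close> is positive. This is where the principal branch enters.\<close>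

lemma char_from_laplace:
  fixes N :: "real measure"
  assumes N: "prob_space N" "sets N = sets borel" and nonneg: "AE x in N. x \<ge> 0"
    and lap: "\<And>\<xi>. \<xi> > 0 \<Longrightarrow> (\<integral>x. exp (- \<xi> * x) \<partial>N) = exp (- t * \<xi> powr \<alpha>)" and \<alpha>: "\<alpha> > 0"
  shows "(\<integral>x. iexp (y * x) \<partial>N) = exp (- cpx t * (- \<i> * cpx y) powr cpx \<alpha>)"
proof -
  interpret prob_space N by (rule N)
  have [measurable_cong]: "sets N = sets borel" by (rule N)
  have bound: "integrable N (\<lambda>x. exp (- c * x))" if "c > 0" for c
    by (rule Bochner_Integration.integrable_bound[of N "\<lambda>_. 1::real"])
       (use that nonneg in \<open>auto elim!: eventually_mono\<close>)
  define L where "L z = (\<integral>x. exp (- (z * cpx x)) \<partial>N)" for z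
  have L: "L z = exp (- cpx t * z powr cpx \<alpha>)" if "Re z > 0" for z
  proof (rule right_half_plane_continuation[OF _ _ _ that])
    show "L holomorphic_on {z. Re z > 0}"
      unfolding L_def by (rule laplace_holomorphic[OF N(2) nonneg bound])
    show "(\<lambda>z. exp (- cpx t * z powr cpx \<alpha>)) holomorphic_on {z. Re z > 0}"
      by (intro holomorphic_intros right_half_plane_nonpos) auto
    fix \<xi> :: real assume \<xi>: "\<xi> > 0"
    have "L (cpx \<xi>) = (\<integral>x. cpx (exp (- \<xi> * x)) \<partial>N)"
      unfolding L_def by (simp add: exp_of_real[symmetric])
    also have "\<dots> = cpx (exp (- t * \<xi> powr \<alpha>))" using lap[OF \<xi>] by simp
    finally show "L (cpx \<xi>) = exp (- cpx t * cpx \<xi> powr cpx \<alpha>)"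
      using \<xi> by (simp add: powr_of_real exp_of_real[symmetric])
  qed
  let ?z = "\<lambda>d. cpx d - \<i> * cpx y"
  have "((\<lambda>d. L (?z d)) \<longlongrightarrow> L (?z 0)) (at 0 within {0<..1})"
    unfolding L_def
  proof (rule dominated_convergence_within[where g = "\<lambda>_. 1"])
    show "AE x in N. ((\<lambda>d. exp (- (?z d * cpx x))) \<longlongrightarrow> exp (- (?z 0 * cpx x))) (at 0 within {0<..1})"
      by (intro AE_I2 tendsto_intros)
    show "AE x in N. norm (exp (- (?z d * cpx x))) \<le> 1" if "d \<in> {0<..1}" for d
      using nonneg that by (auto elim!: eventually_mono)
  qed auto
  then have 1: "((\<lambda>d. exp (- cpx t * ?z d powr cpx \<alpha>)) \<longlongrightarrow> L (?z 0)) (at 0 within {0<..1})"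
    by (rule Lim_transform_within[where d = 1]) (auto simp: L)
  have "?z 0 \<notin> \<real>\<^sub>\<le>\<^sub>0 \<or> ?z 0 = 0 \<and> 0 < Re (cpx \<alpha>)"
    using \<alpha> by (auto simp: complex_nonpos_Reals_iff complex_eq_iff)
  then have 2: "((\<lambda>d. exp (- cpx t * ?z d powr cpx \<alpha>)) \<longlongrightarrow> exp (- cpx t * ?z 0 powr cpx \<alpha>)) (at 0 within {0<..1})"
    by (intro tendsto_intros tendsto_powr_complex')
  have "at 0 within {0<..1::real} \<noteq> bot"
    by (simp add: trivial_limit_within)
  from tendsto_unique[OF this 1 2] show ?thesis by (simp add: L_def mult.assoc)
qed

text \<open>The substitution \<open>u \<mapsto> \<xi> * u\<close> in the Gamma integral.\<close>

lemma nn_integral_gamma_scaled: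
  fixes p \<xi> :: real
  assumes p: "p > 0" and \<xi>: "\<xi> > 0"
  shows "(\<integral>\<^sup>+u. ennreal (indicator {0<..} u * (u powr (p - 1) * exp (- \<xi> * u))) \<partial>lborel) = ennreal (Gamma p * \<xi> powr (- p))"
proof -
  let ?I = "\<integral>\<^sup>+u. ennreal (indicator {0<..} u * (u powr (p - 1) * exp (- \<xi> * u))) \<partial>lborel"
  have "ennreal (Gamma p) = (\<integral>\<^sup>+ t. ennreal (indicat_real {0..} t * t powr (p - 1) / exp t) \<partial>lborel)"
    by (rule Gamma_conv_nn_integral_real[OF p])
  also have "\<dots> = ennreal \<bar>\<xi>\<bar> * (\<integral>\<^sup>+ u. ennreal (indicat_real {0..} (0 + \<xi> * u) * (0 + \<xi> * u) powr (p - 1) / exp (0 + \<xi> * u)) \<partial>lborel)"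
    by (rule nn_integral_real_affine) (use \<xi> in auto)
  also have "\<dots> = (\<integral>\<^sup>+ u. ennreal \<bar>\<xi>\<bar> * ennreal (indicat_real {0..} (0 + \<xi> * u) * (0 + \<xi> * u) powr (p - 1) / exp (0 + \<xi> * u)) \<partial>lborel)"
    by (rule nn_integral_cmult[symmetric]) measurable
  also have "\<dots> = (\<integral>\<^sup>+ u. ennreal (\<xi> powr p) * ennreal (indicator {0<..} u * (u powr (p - 1) * exp (- \<xi> * u))) \<partial>lborel)"
  proof (intro nn_integral_cong)
    fix u :: real
    show "ennreal \<bar>\<xi>\<bar> * ennreal (indicat_real {0..} (0 + \<xi> * u) * (0 + \<xi> * u) powr (p - 1) / exp (0 + \<xi> * u)) =
      ennreal (\<xi> powr p) * ennreal (indicator {0<..} u * (u powr (p - 1) * exp (- \<xi> * u)))"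
    proof (cases "u > 0")
      case True
      have "\<xi> * (\<xi> * u) powr (p - 1) = \<xi> powr p * u powr (p - 1)"
        using \<xi> True by (simp add: powr_mult powr_diff)
      then have "\<xi> * ((\<xi> * u) powr (p - 1) / exp (\<xi> * u)) = \<xi> powr p * (u powr (p - 1) * exp (- \<xi> * u))"
        by (simp add: exp_minus field_simps)
      then show ?thesis using \<xi> True by (simp flip: ennreal_mult)
    next
      case False
      with \<xi> show ?thesis by (cases "u = 0") (auto simp: zero_le_mult_iff)
    qed
  qed
  also have "\<dots> = ennreal (\<xi> powr p) * ?I" by (rule nn_integral_cmult) measurable
  finally have "ennreal (\<xi> powr (- p)) * ennreal (Gamma p) = ennreal (\<xi> powr (- p)) * (ennreal (\<xi> powr p) * ?I)" by simp
  also have "\<dots> = ?I" using \<xi> by (simp flip: mult.assoc ennreal_mult powr_add)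
  finally show ?thesis using p by (simp add: ennreal_mult mult.commute Gamma_real_pos less_imp_le)
qed

lemma gamma_scaled:
  fixes p \<xi> :: real
  assumes p: "p > 0" and \<xi>: "\<xi> > 0"
  shows "has_bochner_integral lborel (\<lambda>u. indicator {0<..} u * (u powr (p - 1) * exp (- \<xi> * u))) (Gamma p * \<xi> powr (- p))"
  using p \<xi> by (intro has_bochner_integral_nn_integral nn_integral_gamma_scaled)
    (auto simp: Gamma_real_pos less_imp_le)

text \<open>Both sides are holomorphic in \<open>z\<close> and agree on the positive half-line.\<close>

lemma gamma_scaled_complex:
  fixes p :: real and z :: complex
  assumes p: "p > 0" and z: "Re z > 0"
  shows "(LBINT u. cpx (indicator {0<..} u * u powr (p - 1)) * exp (- (z * cpx u)))
     = cpx (Gamma p) * z powr cpx (- p)"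
proof (rule right_half_plane_continuation[OF _ _ _ z])
  define M where "M = density lborel (\<lambda>u. ennreal (indicator {0<..} u * u powr (p - 1)))"
  have 1: "(LBINT u. cpx (indicator {0<..} u * u powr (p - 1)) * exp (- (z * cpx u)))
     = (\<integral>u. exp (- (z * cpx u)) \<partial>M)" for z
    unfolding M_def by (subst integral_density) (auto simp: scaleR_conv_of_real)
  show "(\<lambda>z. LBINT u. cpx (indicator {0<..} u * u powr (p - 1)) * exp (- (z * cpx u))) holomorphic_on {z. Re z > 0}"
    unfolding 1
  proof (rule laplace_holomorphic)
    show "AE x in M. 0 \<le> x" unfolding M_def by (subst AE_density) (auto split: split_indicator)
    show "integrable M (\<lambda>x. exp (- c * x))" if "c > 0" for c
      using gamma_scaled[OF p that] unfolding M_def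
      by (subst integrable_density) (auto simp: has_bochner_integral_iff mult.assoc)
  qed (simp add: M_def)
  show "(\<lambda>z. cpx (Gamma p) * z powr cpx (- p)) holomorphic_on {z. Re z > 0}"
    by (intro holomorphic_intros right_half_plane_nonpos) auto
  fix \<xi> :: real assume \<xi>: "\<xi> > 0"
  have "(LBINT u. cpx (indicator {0<..} u * (u powr (p - 1) * exp (- \<xi> * u)))) = cpx (Gamma p * \<xi> powr (- p))"
    using gamma_scaled[OF p \<xi>] by (subst integral_complex_of_real) (simp add: has_bochner_integral_iff)
  then show "(LBINT u. cpx (indicator {0<..} u * u powr (p - 1)) * exp (- (cpx \<xi> * cpx u)))
     = cpx (Gamma p) * cpx \<xi> powr cpx (- p)"
    using \<xi> by (simp add: powr_of_real exp_of_real[symmetric] mult.assoc del: of_real_minus) (simp add: exp_of_real[symmetric])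
qed

text \<open>An inverse transform is the transform of the reflected function, so the claim is the exchange of transforms
  \<open>integral_fourier_mult\<close> after a reflection. It is used for \<open>\<phi>\<close> itself and for the images of \<open>\<phi>\<close> under the two
  fractional operators.\<close>

lemma pairing_inverse_fourier:
  fixes u :: "'a::euclidean_space \<Rightarrow> real" and g :: "'a \<Rightarrow> complex"
  assumes u: "integrable lborel u" and g: "integrable lborel g"
  shows "pairing u (\<lambda>x. c * (LBINT \<xi>. exp (- \<i> * cpx (\<xi> \<bullet> x)) * g \<xi>)) =
    c * (LBINT \<xi>. g \<xi> * fourier (\<lambda>x. cpx (u x)) (- \<xi>))"
proof -
  have uc: "integrable lborel (\<lambda>x. cpx (u x))" using u by (simp add: complex_of_real_integrable_eq)
  have [measurable]: "g \<in> borel_measurable borel" "u \<in> borel_measurable borel" using g u by auto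
  have [measurable]: "fourier (\<lambda>x. cpx (u x)) \<in> borel_measurable borel"
    by (rule borel_measurable_fourier[OF uc])
  have g': "integrable lborel (\<lambda>\<xi>. g (- \<xi>))"
    using g by (subst (asm) lborel_integrable_affine[of "-1" g 0]) auto
  have "(LBINT \<xi>. exp (- \<i> * cpx (\<xi> \<bullet> x)) * g \<xi>) = fourier (\<lambda>\<xi>. g (- \<xi>)) x" for x
    by (subst lborel_integral_affine[of "-1" _ 0]) (auto simp: fourier_def inner_commute)
  then have "pairing u (\<lambda>x. c * (LBINT \<xi>. exp (- \<i> * cpx (\<xi> \<bullet> x)) * g \<xi>)) =
     (LBINT x. c * (cpx (u x) * fourier (\<lambda>\<xi>. g (- \<xi>)) x))"
    by (simp add: pairing_def mult_ac)
  also have "\<dots> = c * (LBINT x. cpx (u x) * fourier (\<lambda>\<xi>. g (- \<xi>)) x)"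
    by (rule integral_mult_right_zero)
  also have "(LBINT x. cpx (u x) * fourier (\<lambda>\<xi>. g (- \<xi>)) x)
      = (LBINT \<xi>. fourier (\<lambda>x. cpx (u x)) \<xi> * g (- \<xi>))"
    by (rule integral_fourier_mult[OF uc g', symmetric])
  also have "\<dots> = (LBINT \<xi>. g \<xi> * fourier (\<lambda>x. cpx (u x)) (- \<xi>))"
    by (subst lborel_integral_affine[of "-1" _ 0]) (auto simp: mult.commute)
  finally show ?thesis .
qed

section \<open>The symbol and the fractional directional derivative\<close>

text \<open>The multiplier of the sum of the two operators on test functions. For functions the directional derivative
  along \<open>a\<close> has the multiplier \<open>(- i a \<bullet> \<xi>) powr \<alpha>\<close>; the sign is reversed for the transpose.\<close>

definition symbol :: "real \<Rightarrow> real \<Rightarrow> 'a::euclidean_space \<Rightarrow> 'a \<Rightarrow> complex" where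
  "symbol \<theta> \<alpha> a \<xi> = cpx (norm \<xi> powr (2 * \<theta>)) + (\<i> * cpx (a \<bullet> \<xi>)) powr cpx \<alpha>"

lemma powr_le_one_plus_square:
  fixes r p :: real
  assumes "r \<ge> 0" "0 \<le> p" "p \<le> 2"
  shows "r powr p \<le> 1 + r\<^sup>2"
proof (cases "r \<le> 1")
  case True
  then have "r powr p \<le> 1 powr p" using assms by (intro powr_mono2) auto
  also have "\<dots> \<le> 1 + r\<^sup>2" by simp
  finally show ?thesis .
next
  case False
  then have "r powr p \<le> r powr 2" using assms by (intro powr_mono) auto
  also have "r powr 2 = r\<^sup>2" using False by (simp add: powr_numeral)
  finally show ?thesis by simp
qed

lemma inner_le_norm_unit: "norm a = 1 \<Longrightarrow> \<bar>a \<bullet> x\<bar> \<le> norm x"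
  using Cauchy_Schwarz_ineq2[of a x] by simp

lemma norm_powr_inner_le:
  assumes "norm a = 1" "0 \<le> p" "p \<le> 2"
  shows "norm ((\<i> * cpx (a \<bullet> \<xi>)) powr cpx p) \<le> 1 + (norm \<xi>)\<^sup>2"
proof -
  have "norm ((\<i> * cpx (a \<bullet> \<xi>)) powr cpx p) = \<bar>a \<bullet> \<xi>\<bar> powr p"
    by (subst norm_powr_real_powr') (auto simp: norm_mult)
  also have "\<dots> \<le> norm \<xi> powr p" using assms by (intro powr_mono2 inner_le_norm_unit) auto
  also have "\<dots> \<le> 1 + (norm \<xi>)\<^sup>2" using assms by (intro powr_le_one_plus_square) auto
  finally show ?thesis .
qed

lemma norm_symbol_le:
  assumes "norm a = 1" "\<theta> \<in> {0<..<1}" "\<alpha> \<in> {0<..<1}"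
  shows "norm (symbol \<theta> \<alpha> a \<xi>) \<le> 2 * (1 + (norm \<xi>)\<^sup>2)"
proof -
  have "norm (symbol \<theta> \<alpha> a \<xi>) \<le> (1 + (norm \<xi>)\<^sup>2) + (1 + (norm \<xi>)\<^sup>2)"
    unfolding symbol_def
    by (intro norm_triangle_mono norm_powr_inner_le) (use assms powr_le_one_plus_square[of "norm \<xi>" "2 * \<theta>"] in auto)
  then show ?thesis by simp
qed

lemma borel_measurable_powr_inner [measurable]:
  fixes a :: "'a::euclidean_space"
  shows "(\<lambda>\<xi>. (\<i> * cpx (a \<bullet> \<xi>)) powr cpx p) \<in> borel_measurable borel"
  unfolding powr_def by measurable

lemma borel_measurable_symbol [measurable]: "symbol \<theta> \<alpha> a \<in> borel_measurable borel"
  unfolding symbol_def[abs_def] by measurable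

text \<open>On the imaginary axis the principal power is discontinuous nowhere: the axis meets the branch cut only in \<open>0\<close>,
  where the power tends to \<open>0\<close>.\<close>

lemma isCont_symbol:
  assumes "\<theta> > 0" "\<alpha> > 0"
  shows "isCont (symbol \<theta> \<alpha> a) \<xi>"
proof -
  have "\<i> * cpx (a \<bullet> \<xi>) \<notin> \<real>\<^sub>\<le>\<^sub>0 \<or> \<i> * cpx (a \<bullet> \<xi>) = 0 \<and> 0 < Re (cpx \<alpha>)"
    using assms by (auto simp: complex_nonpos_Reals_iff complex_eq_iff)
  then have "((\<lambda>\<xi>. (\<i> * cpx (a \<bullet> \<xi>)) powr cpx \<alpha>) \<longlongrightarrow> (\<i> * cpx (a \<bullet> \<xi>)) powr cpx \<alpha>) (at \<xi>)"
    by (intro tendsto_intros tendsto_powr_complex')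
  moreover have "((\<lambda>\<xi>. norm \<xi> powr (2 * \<theta>)) \<longlongrightarrow> norm \<xi> powr (2 * \<theta>)) (at \<xi>)"
    using assms by (intro tendsto_powr' tendsto_intros) auto
  ultimately show ?thesis unfolding isCont_def symbol_def by (intro tendsto_add tendsto_of_real)
qed

text \<open>The power multiplies the argument, which is at most \<open>pi / 2\<close> in absolute value, by \<open>\<alpha> < 1\<close>. Nonnegativity keeps
  the functions \<open>exp (- z \<Psi>)\<close> bounded by \<open>1\<close>.\<close>

lemma Re_powr_nonneg:
  assumes "Re z \<ge> 0" "\<alpha> \<in> {0<..<1}"
  shows "Re (z powr cpx \<alpha>) \<ge> 0"
proof (cases "z = 0")
  case False
  have "\<bar>Im (Ln z)\<bar> \<le> pi / 2" using Re_Ln_pos_le[OF False] assms(1) by auto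
  then have "\<bar>\<alpha> * Im (Ln z)\<bar> \<le> 1 * (pi / 2)" unfolding abs_mult using assms(2) by (intro mult_mono) auto
  then have "cos (\<alpha> * Im (Ln z)) \<ge> 0" by (intro cos_ge_zero) auto
  then show ?thesis using False by (simp add: powr_def Re_exp)
qed simp

lemma Re_symbol_nonneg: "\<alpha> \<in> {0<..<1} \<Longrightarrow> Re (symbol \<theta> \<alpha> a \<xi>) \<ge> 0"
  unfolding symbol_def using Re_powr_nonneg[of "\<i> * cpx (a \<bullet> \<xi>)" \<alpha>] by simp

text \<open>The bound is uniform for base points near \<open>x\<close>, as differentiation in the base point requires.\<close>

lemma schwartz_decay_along_ray:
  fixes f :: "'a::euclidean_space \<Rightarrow> complex"
  assumes f: "schwartz f" and a: "norm a = 1"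
  obtains B where "B \<ge> 0" "\<And>y s. y \<in> ball x 1 \<Longrightarrow> s \<ge> 0 \<Longrightarrow> norm (f (y + s *\<^sub>R a)) \<le> B * inverse (1 + s\<^sup>2)"
proof -
  obtain C where C: "C \<ge> 0" "\<And>x. norm (f x) * (1 + (norm x)\<^sup>2) ^ 1 \<le> C"
    using schwartz_decay[OF f] by blast
  define R where "R = norm x + 1"
  have "norm (f (y + s *\<^sub>R a)) \<le> (2 * (1 + R\<^sup>2) * C) * inverse (1 + s\<^sup>2)" if y: "y \<in> ball x 1" and s: "s \<ge> 0" for y s
  proof -
    let ?q = "norm (y + s *\<^sub>R a)"
    have "norm y \<le> R" using y norm_triangle_ineq[of x "y - x"] by (auto simp: R_def dist_norm norm_minus_commute)
    moreover have "norm (s *\<^sub>R a) \<le> norm (y + s *\<^sub>R a) + norm y"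
      using norm_triangle_ineq4[of "y + s *\<^sub>R a" y] by simp
    ultimately have "s \<le> ?q + R" using a s by simp
    then have "s\<^sup>2 \<le> (?q + R)\<^sup>2" using s by (intro power_mono) auto
    also have "\<dots> \<le> 2 * ?q\<^sup>2 + 2 * R\<^sup>2" using sum_squares_bound[of ?q R] by (simp add: power2_sum)
    finally have "s\<^sup>2 \<le> 2 * ?q\<^sup>2 + 2 * R\<^sup>2" .
    have "1 + s\<^sup>2 \<le> 2 * (1 + R\<^sup>2) * (1 + ?q\<^sup>2)"
    proof -
      have "2 * (1 + R\<^sup>2) * (1 + ?q\<^sup>2) = 2 + 2 * R\<^sup>2 + 2 * ?q\<^sup>2 + 2 * (R\<^sup>2 * ?q\<^sup>2)" by (simp add: algebra_simps)
      moreover have "0 \<le> R\<^sup>2 * ?q\<^sup>2" by simp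
      ultimately show ?thesis using \<open>s\<^sup>2 \<le> 2 * ?q\<^sup>2 + 2 * R\<^sup>2\<close> by linarith
    qed
    then have "norm (f (y + s *\<^sub>R a)) * (1 + s\<^sup>2) \<le> norm (f (y + s *\<^sub>R a)) * (2 * (1 + R\<^sup>2) * (1 + ?q\<^sup>2))"
      by (rule mult_left_mono) simp
    also have "\<dots> = 2 * (1 + R\<^sup>2) * (norm (f (y + s *\<^sub>R a)) * (1 + ?q\<^sup>2) ^ 1)" by simp
    also have "\<dots> \<le> 2 * (1 + R\<^sup>2) * C" by (intro mult_left_mono C) auto
    finally have *: "norm (f (y + s *\<^sub>R a)) * (1 + s\<^sup>2) \<le> 2 * (1 + R\<^sup>2) * C" .
    have "1 + s\<^sup>2 > 0" by (auto intro: add_pos_nonneg)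
    with * show ?thesis by (simp add: field_simps)
  qed
  then show ?thesis using that[of "2 * (1 + R\<^sup>2) * C"] C by auto
qed

text \<open>Near \<open>0\<close> the singularity is integrable because \<open>\<alpha> < 1\<close>, and the square takes care of infinity.\<close>

lemma integrable_powr_decay:
  assumes "\<alpha> \<in> {0<..<1::real}"
  shows "integrable lborel (\<lambda>s::real. indicator {0<..} s * s powr (- \<alpha>) * inverse (1 + s\<^sup>2))"
proof (rule Bochner_Integration.integrable_bound)
  have "integrable lborel (\<lambda>r::real. inverse (1 + r\<^sup>2))"
    using integrable_inverse_1_plus_square by (simp add: set_integrable_def einterval_def)
  moreover have "integrable lborel (\<lambda>u. indicator {0<..} u * (u powr ((1 - \<alpha>) - 1) * exp (- 1 * u)))"
    using gamma_scaled[of "1 - \<alpha>" 1] assms by (simp add: has_bochner_integral_iff)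
  \<comment> \<open>The factor \<open>exp 1\<close> makes the Gamma integrand dominate the singular factor on \<open>{0<..1}\<close>.\<close>
  ultimately show "integrable lborel (\<lambda>u. exp 1 * (indicator {0<..} u * (u powr ((1 - \<alpha>) - 1) * exp (- 1 * u))) + inverse (1 + u\<^sup>2))"
    by (intro Bochner_Integration.integrable_add integrable_mult_right)
  show "AE s in lborel. norm (indicator {0<..} s * s powr (- \<alpha>) * inverse (1 + s\<^sup>2))
    \<le> norm (exp 1 * (indicator {0<..} s * (s powr ((1 - \<alpha>) - 1) * exp (- 1 * s))) + inverse (1 + s\<^sup>2))"
  proof (rule AE_I2)
    fix s :: real
    have p: "1 + s\<^sup>2 > 0" by (auto intro: add_pos_nonneg)
    show "norm (indicator {0<..} s * s powr (- \<alpha>) * inverse (1 + s\<^sup>2))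
    \<le> norm (exp 1 * (indicator {0<..} s * (s powr ((1 - \<alpha>) - 1) * exp (- 1 * s))) + inverse (1 + s\<^sup>2))"
    proof (cases "s > 0")
      case True
      have "s powr (- \<alpha>) * inverse (1 + s\<^sup>2) \<le> exp 1 * (s powr (- \<alpha>) * exp (- s)) + inverse (1 + s\<^sup>2)"
      proof (cases "s \<le> 1")
        case True
        have "s powr (- \<alpha>) * inverse (1 + s\<^sup>2) \<le> s powr (- \<alpha>) * 1"
          using p by (intro mult_left_mono) (auto simp: inverse_le_1_iff)
        also have "\<dots> \<le> s powr (- \<alpha>) * (exp 1 * exp (- s))"
          using True by (intro mult_left_mono) (auto simp flip: exp_add)
        also have "\<dots> \<le> exp 1 * (s powr (- \<alpha>) * exp (- s)) + inverse (1 + s\<^sup>2)"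
          using p by (simp add: mult_ac)
        finally show ?thesis .
      next
        case False
        then have "s powr (- \<alpha>) \<le> 1" using assms powr_mono[of "- \<alpha>" 0 s] by simp
        then have "s powr (- \<alpha>) * inverse (1 + s\<^sup>2) \<le> 1 * inverse (1 + s\<^sup>2)"
          using p by (intro mult_right_mono) auto
        moreover have "0 \<le> exp 1 * (s powr (- \<alpha>) * exp (- s))" by simp
        ultimately show ?thesis by linarith
      qed
      then show ?thesis using True p by (simp add: abs_mult)
    qed simp
  qed
qed measurable

lemma schwartz_derivative_decay_along_ray:
  fixes f :: "'a::euclidean_space \<Rightarrow> complex"
  assumes f: "schwartz f" and a: "norm a = 1"
  obtains B where "B \<ge> 0" "\<And>y s v. y \<in> ball x 1 \<Longrightarrow> s \<ge> 0 \<Longrightarrow>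
    norm (frechet_derivative f (at (y + s *\<^sub>R a)) v) \<le> B * inverse (1 + s\<^sup>2) * norm v"
proof -
  have "\<forall>b\<in>Basis. \<exists>B\<ge>0. \<forall>y s. y \<in> ball x 1 \<longrightarrow> s \<ge> 0 \<longrightarrow> norm (partial b f (y + s *\<^sub>R a)) \<le> B * inverse (1 + s\<^sup>2)"
    using schwartz_decay_along_ray[OF schwartz_partial[OF f] a] by metis
  then obtain Bb where Bb: "\<And>b. b \<in> Basis \<Longrightarrow> Bb b \<ge> 0"
    "\<And>b y s. b \<in> Basis \<Longrightarrow> y \<in> ball x 1 \<Longrightarrow> s \<ge> 0 \<Longrightarrow> norm (partial b f (y + s *\<^sub>R a)) \<le> Bb b * inverse (1 + s\<^sup>2)"
    by metis
  show ?thesis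
  proof (rule that)
    show "0 \<le> (\<Sum>b\<in>Basis. Bb b)" using Bb by (intro sum_nonneg) auto
    fix y v :: 'a and s :: real assume y: "y \<in> ball x 1" and s: "s \<ge> 0"
    have "norm (frechet_derivative f (at (y + s *\<^sub>R a)) v) \<le> (\<Sum>b\<in>Basis. norm v * (Bb b * inverse (1 + s\<^sup>2)))"
      unfolding frechet_derivative_schwartz[OF f]
    proof (rule sum_norm_le)
      fix b :: 'a assume b: "b \<in> Basis"
      show "norm (cpx (v \<bullet> b) * partial b f (y + s *\<^sub>R a)) \<le> norm v * (Bb b * inverse (1 + s\<^sup>2))"
        unfolding norm_mult norm_of_real by (intro mult_mono Bb b y s Basis_le_norm) auto
    qed
    also have "\<dots> = (\<Sum>b\<in>Basis. Bb b) * inverse (1 + s\<^sup>2) * norm v"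
      by (simp add: sum_distrib_left sum_distrib_right mult_ac)
    finally show "norm (frechet_derivative f (at (y + s *\<^sub>R a)) v) \<le> (\<Sum>b\<in>Basis. Bb b) * inverse (1 + s\<^sup>2) * norm v" .
  qed
qed

lemma borel_measurable_frechet_schwartz:
  fixes f :: "'a::euclidean_space \<Rightarrow> complex"
  assumes f: "schwartz f"
  shows "(\<lambda>p. frechet_derivative f (at p) v) \<in> borel_measurable borel"
  unfolding frechet_derivative_schwartz[OF f]
proof (rule borel_measurable_sum)
  fix b :: 'a assume b: "b \<in> Basis"
  show "(\<lambda>p. cpx (v \<bullet> b) * partial b f p) \<in> borel_measurable borel"
    using borel_measurable_schwartz[OF schwartz_partial[OF f b]] by measurable
qed

text \<open>The weight of the singular integral, extended by \<open>0\<close> to negative arguments.\<close>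

definition power_weight :: "real \<Rightarrow> real \<Rightarrow> complex" where
  "power_weight \<alpha> s = cpx (indicator {0<..} s * s powr (- \<alpha>))"

lemma borel_measurable_power_weight [measurable]: "power_weight \<alpha> \<in> borel_measurable borel"
  unfolding power_weight_def[abs_def] by measurable

lemma norm_power_weight_mult_le:
  assumes "s > 0 \<Longrightarrow> norm w \<le> B * inverse (1 + s\<^sup>2) * c"
  shows "norm (power_weight \<alpha> s * w) \<le> B * (indicator {0<..} s * s powr (- \<alpha>) * inverse (1 + s\<^sup>2)) * c"
proof (cases "s > 0")
  case True
  then have "s powr (- \<alpha>) * norm w \<le> s powr (- \<alpha>) * (B * inverse (1 + s\<^sup>2) * c)"
    by (intro mult_left_mono assms) auto
  then show ?thesis using True by (simp add: power_weight_def norm_mult mult_ac)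
qed (simp add: power_weight_def)

text \<open>The outer derivative is moved under the integral. After that the integrand decays like \<open>1 / (1 + s\<^sup>2)\<close> away from
  an integrable singularity.\<close>

lemma frac_dir_deriv_eq_integral:
  fixes \<phi> :: "'a::euclidean_space \<Rightarrow> complex"
  assumes \<phi>: "schwartz \<phi>" and \<alpha>: "\<alpha> \<in> {0<..<1}" and a: "norm a = 1"
  shows "frac_dir_deriv \<alpha> (- a) \<phi> x = (1 / Gamma (1 - \<alpha>)) *\<^sub>R
    (- (LBINT s. power_weight \<alpha> s * frechet_derivative \<phi> (at (x + s *\<^sub>R a)) a))"
proof -
  have [measurable]: "\<phi> \<in> borel_measurable borel" by (rule borel_measurable_schwartz[OF \<phi>])
  have [measurable]: "(\<lambda>p. frechet_derivative \<phi> (at p) v) \<in> borel_measurable borel" for v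
    by (rule borel_measurable_frechet_schwartz[OF \<phi>])
  obtain B0 where B0: "B0 \<ge> 0" "\<And>y s. y \<in> ball x 1 \<Longrightarrow> s \<ge> 0 \<Longrightarrow> norm (\<phi> (y + s *\<^sub>R a)) \<le> B0 * inverse (1 + s\<^sup>2)"
    using schwartz_decay_along_ray[OF \<phi> a] by blast
  obtain B where B: "B \<ge> 0" "\<And>y s v. y \<in> ball x 1 \<Longrightarrow> s \<ge> 0 \<Longrightarrow>
      norm (frechet_derivative \<phi> (at (y + s *\<^sub>R a)) v) \<le> B * inverse (1 + s\<^sup>2) * norm v"
    using schwartz_derivative_decay_along_ray[OF \<phi> a] by blast
  have weight: "integrable lborel (\<lambda>s. C * (indicator {0<..} s * s powr (- \<alpha>) * inverse (1 + s\<^sup>2)))" for C :: real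
    by (intro integrable_mult_right integrable_powr_decay \<alpha>)
  let ?G = "\<lambda>y. LBINT s. power_weight \<alpha> s * \<phi> (y + s *\<^sub>R a)"
  have "(?G has_derivative (\<lambda>v. LBINT s. power_weight \<alpha> s * frechet_derivative \<phi> (at (x + s *\<^sub>R a)) v)) (at x)"
  proof (rule has_derivative_integral[where S = "ball x 1" and g = "\<lambda>s. B * (indicator {0<..} s * s powr (- \<alpha>) * inverse (1 + s\<^sup>2))"
        and f' = "\<lambda>y s v. power_weight \<alpha> s * frechet_derivative \<phi> (at (y + s *\<^sub>R a)) v"])
    fix y assume y: "y \<in> ball x 1"
    show "integrable lborel (\<lambda>s. power_weight \<alpha> s * \<phi> (y + s *\<^sub>R a))"
    proof (rule Bochner_Integration.integrable_bound[OF weight[of B0]])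
      show "AE s in lborel. norm (power_weight \<alpha> s * \<phi> (y + s *\<^sub>R a)) \<le> norm (B0 * (indicator {0<..} s * s powr (- \<alpha>) * inverse (1 + s\<^sup>2)))"
        using norm_power_weight_mult_le[of _ "\<phi> (y + _ *\<^sub>R a)" B0 1 \<alpha>] B0(2)[OF y]
        by (auto intro!: AE_I2 order_trans[OF _ abs_ge_self])
    qed measurable
    fix s :: real
    have "((\<lambda>y. \<phi> (y + s *\<^sub>R a)) has_derivative (\<lambda>v. frechet_derivative \<phi> (at (y + s *\<^sub>R a)) v)) (at y)"
      by (rule has_derivative_compose[OF _ schwartz_has_derivative[OF \<phi>]]) (auto intro!: derivative_eq_intros)
    then show "((\<lambda>y. power_weight \<alpha> s * \<phi> (y + s *\<^sub>R a)) has_derivative (\<lambda>v. power_weight \<alpha> s * frechet_derivative \<phi> (at (y + s *\<^sub>R a)) v)) (at y)"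
      by (rule has_derivative_mult_right)
    show "onorm (\<lambda>v. power_weight \<alpha> s * frechet_derivative \<phi> (at (y + s *\<^sub>R a)) v) \<le> B * (indicator {0<..} s * s powr (- \<alpha>) * inverse (1 + s\<^sup>2))"
      by (intro onorm_le norm_power_weight_mult_le B(2)[OF y]) simp
  qed (use weight[of B] in auto)
  then have "frechet_derivative ?G (at x) = (\<lambda>v. LBINT s. power_weight \<alpha> s * frechet_derivative \<phi> (at (x + s *\<^sub>R a)) v)"
    by (rule frechet_derivative_at[symmetric])
  moreover have "frechet_derivative \<phi> (at p) (- a) = - frechet_derivative \<phi> (at p) a" for p
    unfolding frechet_derivative_schwartz[OF \<phi>] by (simp add: sum_negf)
  moreover have "(\<lambda>y. LINT s:{0<..}|lborel. (s powr (- \<alpha>)) *\<^sub>R \<phi> (y - s *\<^sub>R (- a))) = ?G"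
    unfolding set_lebesgue_integral_def power_weight_def
    by (intro ext Bochner_Integration.integral_cong) (auto simp: scaleR_conv_of_real)
  ultimately show ?thesis unfolding frac_dir_deriv_def by simp
qed

text \<open>Fourier inversion for the partial derivatives, combined linearly.\<close>

lemma frechet_derivative_inversion:
  fixes \<phi> :: "'a::euclidean_space \<Rightarrow> complex"
  assumes \<phi>: "schwartz \<phi>"
  shows "frechet_derivative \<phi> (at p) a = cpx (1 / (2 * pi) ^ DIM('a)) *
    (LBINT \<xi>. exp (- \<i> * cpx (\<xi> \<bullet> p)) * (- (\<i> * cpx (a \<bullet> \<xi>)) * fourier \<phi> \<xi>))"
proof -
  let ?c = "cpx (1 / (2 * pi) ^ DIM('a))" and ?E = "\<lambda>\<xi>. exp (- \<i> * cpx (\<xi> \<bullet> p))"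
  have int: "integrable lborel (\<lambda>\<xi>. cpx (a \<bullet> b) * (?E \<xi> * fourier (partial b \<phi>) \<xi>))" if "b \<in> Basis" for b
    using integrable_iexp_mult[OF integrable_fourier_schwartz[OF schwartz_partial[OF \<phi> that]], of "- p"]
    by (intro integrable_mult_right) (simp add: inner_commute)
  have "frechet_derivative \<phi> (at p) a = (\<Sum>b\<in>Basis. cpx (a \<bullet> b) * (?c * (LBINT \<xi>. ?E \<xi> * fourier (partial b \<phi>) \<xi>)))"
    unfolding frechet_derivative_schwartz[OF \<phi>]
    by (intro sum.cong refl arg_cong2[where f = "(*)"] fourier_inversion_schwartz schwartz_partial \<phi>)
  also have "\<dots> = ?c * (\<Sum>b\<in>Basis. LBINT \<xi>. cpx (a \<bullet> b) * (?E \<xi> * fourier (partial b \<phi>) \<xi>))"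
    unfolding integral_mult_right_zero sum_distrib_left by (intro sum.cong) (auto simp: mult_ac)
  also have "\<dots> = ?c * (LBINT \<xi>. (\<Sum>b\<in>Basis. cpx (a \<bullet> b) * (?E \<xi> * fourier (partial b \<phi>) \<xi>)))"
    by (subst Bochner_Integration.integral_sum) (use int in auto)
  also have "(\<lambda>\<xi>. \<Sum>b\<in>Basis. cpx (a \<bullet> b) * (?E \<xi> * fourier (partial b \<phi>) \<xi>)) = (\<lambda>\<xi>. ?E \<xi> * (- (\<i> * cpx (a \<bullet> \<xi>)) * fourier \<phi> \<xi>))"
  proof
    fix \<xi>
    have "(\<Sum>b\<in>Basis. cpx (a \<bullet> b) * (?E \<xi> * fourier (partial b \<phi>) \<xi>))
      = (\<Sum>b\<in>Basis. (?E \<xi> * fourier \<phi> \<xi> * - \<i>) * cpx ((a \<bullet> b) * (\<xi> \<bullet> b)))"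
      by (intro sum.cong refl) (simp add: fourier_partial[OF \<phi>] mult_ac)
    also have "\<dots> = (?E \<xi> * fourier \<phi> \<xi> * - \<i>) * cpx (\<Sum>b\<in>Basis. (a \<bullet> b) * (\<xi> \<bullet> b))"
      by (simp only: sum_distrib_left of_real_sum)
    also have "(\<Sum>b\<in>Basis. (a \<bullet> b) * (\<xi> \<bullet> b)) = a \<bullet> \<xi>" by (rule euclidean_inner[symmetric])
    finally show "(\<Sum>b\<in>Basis. cpx (a \<bullet> b) * (?E \<xi> * fourier (partial b \<phi>) \<xi>)) = ?E \<xi> * (- (\<i> * cpx (a \<bullet> \<xi>)) * fourier \<phi> \<xi>)"
      by (simp add: mult_ac)
  qed
  finally show ?thesis .
qed

text \<open>The undamped double integral in \<open>s\<close> and \<open>\<xi>\<close> does not converge absolutely, since \<open>s powr (- \<alpha>)\<close> is not integrable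
  at infinity. With the factor \<open>exp (- d s)\<close> the integrals can be exchanged, and the inner one becomes a Gamma
  integral at \<open>d + i a \<bullet> \<xi>\<close>.\<close>

lemma damped_power_integral_fourier:
  fixes g :: "'a::euclidean_space \<Rightarrow> complex"
  assumes g: "integrable lborel g" and \<alpha>: "\<alpha> < 1" and d: "d > 0"
  shows "(LBINT s. power_weight \<alpha> s * exp (- cpx (d * s)) * (LBINT \<xi>. exp (- \<i> * cpx (\<xi> \<bullet> (x + s *\<^sub>R a))) * g \<xi>))
     = (LBINT \<xi>. exp (- \<i> * cpx (\<xi> \<bullet> x)) * g \<xi> * (cpx (Gamma (1 - \<alpha>)) * (cpx d + \<i> * cpx (a \<bullet> \<xi>)) powr cpx (\<alpha> - 1)))"
proof -
  define k where "k s = power_weight \<alpha> s * exp (- cpx (d * s))" for s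
  let ?E = "\<lambda>p \<xi>. exp (- \<i> * cpx (\<xi> \<bullet> p))"
  let ?z = "\<lambda>\<xi>. cpx d + \<i> * cpx (a \<bullet> \<xi>)"
  have [measurable]: "k \<in> borel_measurable borel" unfolding k_def[abs_def] by measurable
  have "integrable lborel (\<lambda>s. cpx (indicator {0<..} s * (s powr (- \<alpha>) * exp (- d * s))))"
    using gamma_scaled[of "1 - \<alpha>" d] \<alpha> d unfolding complex_of_real_integrable_eq by (simp add: has_bochner_integral_iff)
  then have "integrable lborel k"
    by (simp add: k_def[abs_def] power_weight_def exp_of_real[symmetric] mult.assoc)
  then have "integrable (lborel \<Otimes>\<^sub>M lborel) (\<lambda>(s, \<xi>). k s * g \<xi> * (\<lambda>(s, \<xi>). ?E (x + s *\<^sub>R a) \<xi>) (s, \<xi>))"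
    by (rule lborel_pair.integrable_mult_kernel[OF _ g]) auto
  then have int: "integrable (lborel \<Otimes>\<^sub>M lborel) (\<lambda>(s, \<xi>). k s * g \<xi> * ?E (x + s *\<^sub>R a) \<xi>)" by simp
  have "(LBINT s. k s * (LBINT \<xi>. ?E (x + s *\<^sub>R a) \<xi> * g \<xi>)) = (LBINT s. (LBINT \<xi>. k s * g \<xi> * ?E (x + s *\<^sub>R a) \<xi>))"
    unfolding integral_mult_right_zero[symmetric] by (simp only: mult_ac)
  also have "\<dots> = (LBINT \<xi>. (LBINT s. k s * g \<xi> * ?E (x + s *\<^sub>R a) \<xi>))"
    by (rule lborel_pair.Fubini_integral[OF int, symmetric])
  also have "(\<lambda>\<xi>. LBINT s. k s * g \<xi> * ?E (x + s *\<^sub>R a) \<xi>) = (\<lambda>\<xi>. ?E x \<xi> * g \<xi> * (cpx (Gamma (1 - \<alpha>)) * ?z \<xi> powr cpx (\<alpha> - 1)))"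
  proof
    fix \<xi>
    have ex: "exp (- cpx (d * s)) * ?E (x + s *\<^sub>R a) \<xi> = ?E x \<xi> * exp (- (?z \<xi> * cpx s))" for s
      unfolding exp_add[symmetric] by (simp add: algebra_simps inner_commute)
    have "k s * g \<xi> * ?E (x + s *\<^sub>R a) \<xi> = power_weight \<alpha> s * g \<xi> * (exp (- cpx (d * s)) * ?E (x + s *\<^sub>R a) \<xi>)" for s
      by (simp only: k_def mult_ac)
    then have "k s * g \<xi> * ?E (x + s *\<^sub>R a) \<xi> = ?E x \<xi> * g \<xi> * (cpx (indicator {0<..} s * s powr ((1 - \<alpha>) - 1)) * exp (- (?z \<xi> * cpx s)))" for s
      unfolding ex power_weight_def by (simp add: mult_ac)
    then have "(LBINT s. k s * g \<xi> * ?E (x + s *\<^sub>R a) \<xi>)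
      = ?E x \<xi> * g \<xi> * (LBINT s. cpx (indicator {0<..} s * s powr ((1 - \<alpha>) - 1)) * exp (- (?z \<xi> * cpx s)))"
      by (simp only: integral_mult_right_zero)
    also have "(LBINT s. cpx (indicator {0<..} s * s powr ((1 - \<alpha>) - 1)) * exp (- (?z \<xi> * cpx s)))
      = cpx (Gamma (1 - \<alpha>)) * ?z \<xi> powr cpx (- (1 - \<alpha>))"
      by (rule gamma_scaled_complex) (use \<alpha> d in auto)
    finally show "(LBINT s. k s * g \<xi> * ?E (x + s *\<^sub>R a) \<xi>) = ?E x \<xi> * g \<xi> * (cpx (Gamma (1 - \<alpha>)) * ?z \<xi> powr cpx (\<alpha> - 1))"
      by simp
  qed
  finally show ?thesis by (simp only: k_def)
qed

text \<open>The derivative contributes \<open>- i a \<bullet> \<xi>\<close>, the weight \<open>s powr (- \<alpha>)\<close> contributes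
  \<open>Gamma (1 - \<alpha>) * (i a \<bullet> \<xi>) powr (\<alpha> - 1)\<close>, and the product is the claimed multiplier up to sign
  and normalisation. The identity is proved with damping \<open>d > 0\<close>, and both sides converge as \<open>d\<close> tends to \<open>0\<close>.\<close>

theorem frac_dir_deriv_schwartz:
  fixes \<phi> :: "'a::euclidean_space \<Rightarrow> complex"
  assumes \<phi>: "schwartz \<phi>" and \<alpha>: "\<alpha> \<in> {0<..<1}" and a: "norm a = 1"
  shows "frac_dir_deriv \<alpha> (- a) \<phi> x = cpx (1 / (2 * pi) ^ DIM('a)) *
    (LBINT \<xi>. exp (- \<i> * cpx (\<xi> \<bullet> x)) * ((\<i> * cpx (a \<bullet> \<xi>)) powr cpx \<alpha> * fourier \<phi> \<xi>))"
proof -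
  let ?c = "cpx (1 / (2 * pi) ^ DIM('a))" and ?\<Gamma> = "cpx (Gamma (1 - \<alpha>))"
  let ?E = "\<lambda>\<xi>. exp (- \<i> * cpx (\<xi> \<bullet> x))"
  define \<psi> where "\<psi> p = frechet_derivative \<phi> (at p) a" for p
  define \<eta> where "\<eta> \<xi> = \<i> * cpx (a \<bullet> \<xi>)" for \<xi>
  define F where "F d \<xi> = ?E \<xi> * (- \<eta> \<xi> * fourier \<phi> \<xi>) * (?\<Gamma> * (cpx d + \<eta> \<xi>) powr cpx (\<alpha> - 1))" for d \<xi>
  define F0 where "F0 \<xi> = ?E \<xi> * (\<eta> \<xi> powr cpx \<alpha> * fourier \<phi> \<xi>)" for \<xi>
  have gam: "Gamma (1 - \<alpha>) > 0" using \<alpha> by (intro Gamma_real_pos) auto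
  have [measurable]: "\<psi> \<in> borel_measurable borel"
    unfolding \<psi>_def[abs_def] by (rule borel_measurable_frechet_schwartz[OF \<phi>])
  have [measurable]: "fourier \<phi> \<in> borel_measurable borel" by (intro borel_measurable_fourier integrable_schwartz \<phi>)
  have [measurable]: "\<eta> \<in> borel_measurable borel" unfolding \<eta>_def[abs_def] by measurable
  have [measurable]: "F d \<in> borel_measurable borel" "F0 \<in> borel_measurable borel" for d
    unfolding F_def[abs_def] F0_def[abs_def] powr_def by measurable
  obtain B where B: "B \<ge> 0" "\<And>y s v. y \<in> ball x 1 \<Longrightarrow> s \<ge> 0 \<Longrightarrow>
      norm (frechet_derivative \<phi> (at (y + s *\<^sub>R a)) v) \<le> B * inverse (1 + s\<^sup>2) * norm v"
    using schwartz_derivative_decay_along_ray[OF \<phi> a] by blast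
  have int\<eta>: "integrable lborel (\<lambda>\<xi>. - \<eta> \<xi> * fourier \<phi> \<xi>)"
    by (rule integrable_fourier_schwartz_mult[OF \<phi>, where C = 1])
       (use inner_le_norm_unit[OF a] powr_le_one_plus_square[of "norm _" 1] in \<open>auto simp: \<eta>_def norm_mult intro: order_trans\<close>)
  have reg: "(LBINT s. power_weight \<alpha> s * exp (- cpx (d * s)) * \<psi> (x + s *\<^sub>R a)) = ?c * (LBINT \<xi>. F d \<xi>)" if d: "d > 0" for d
  proof -
    have "(LBINT s. power_weight \<alpha> s * exp (- cpx (d * s)) * \<psi> (x + s *\<^sub>R a))
      = (LBINT s. ?c * (power_weight \<alpha> s * exp (- cpx (d * s)) * (LBINT \<xi>. exp (- \<i> * cpx (\<xi> \<bullet> (x + s *\<^sub>R a))) * (- \<eta> \<xi> * fourier \<phi> \<xi>))))"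
      unfolding \<psi>_def \<eta>_def frechet_derivative_inversion[OF \<phi>] by (simp only: mult_ac)
    also have "\<dots> = ?c * (LBINT s. power_weight \<alpha> s * exp (- cpx (d * s)) * (LBINT \<xi>. exp (- \<i> * cpx (\<xi> \<bullet> (x + s *\<^sub>R a))) * (- \<eta> \<xi> * fourier \<phi> \<xi>)))"
      by (rule integral_mult_right_zero)
    also have "\<dots> = ?c * (LBINT \<xi>. F d \<xi>)"
      unfolding F_def using damped_power_integral_fourier[OF int\<eta> _ d, of \<alpha> x a] \<alpha> by (simp add: \<eta>_def)
    finally show ?thesis .
  qed
  have "((\<lambda>d. LBINT s. power_weight \<alpha> s * exp (- cpx (d * s)) * \<psi> (x + s *\<^sub>R a)) \<longlongrightarrow>
      (LBINT s. power_weight \<alpha> s * exp (- cpx (0 * s)) * \<psi> (x + s *\<^sub>R a))) (at 0 within {0<..1})"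
  proof (rule dominated_convergence_within)
    show "integrable lborel (\<lambda>s. B * (indicator {0<..} s * s powr (- \<alpha>) * inverse (1 + s\<^sup>2)) * 1)"
      using integrable_powr_decay[OF \<alpha>] by simp
    show "AE s in lborel. ((\<lambda>d. power_weight \<alpha> s * exp (- cpx (d * s)) * \<psi> (x + s *\<^sub>R a)) \<longlongrightarrow>
       power_weight \<alpha> s * exp (- cpx (0 * s)) * \<psi> (x + s *\<^sub>R a)) (at 0 within {0<..1})"
      by (intro AE_I2 tendsto_intros)
    fix d :: real assume d: "d \<in> {0<..1}"
    show "AE s in lborel. norm (power_weight \<alpha> s * exp (- cpx (d * s)) * \<psi> (x + s *\<^sub>R a)) \<le> B * (indicator {0<..} s * s powr (- \<alpha>) * inverse (1 + s\<^sup>2)) * 1"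
    proof (rule AE_I2, unfold mult.assoc[of "power_weight _ _"], rule norm_power_weight_mult_le)
      fix s :: real assume s: "s > 0"
      have "exp (- (d * s)) * norm (\<psi> (x + s *\<^sub>R a)) \<le> 1 * (B * inverse (1 + s\<^sup>2) * norm a)"
        unfolding \<psi>_def using d s by (intro mult_mono B(2)) auto
      then show "norm (exp (- cpx (d * s)) * \<psi> (x + s *\<^sub>R a)) \<le> B * inverse (1 + s\<^sup>2) * 1"
        by (simp add: norm_mult a)
    qed
  qed measurable
  then have 1: "((\<lambda>d. ?c * (LBINT \<xi>. F d \<xi>)) \<longlongrightarrow> (LBINT s. power_weight \<alpha> s * exp (- cpx (0 * s)) * \<psi> (x + s *\<^sub>R a))) (at 0 within {0<..1})"
    by (rule Lim_transform_within[where d = 1]) (use reg in auto)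
  have 2: "((\<lambda>d. ?c * (LBINT \<xi>. F d \<xi>)) \<longlongrightarrow> ?c * (LBINT \<xi>. - ?\<Gamma> * F0 \<xi>)) (at 0 within {0<..1})"
  proof (rule tendsto_mult[OF tendsto_const], rule dominated_convergence_within)
    show "integrable lborel (\<lambda>\<xi>. Gamma (1 - \<alpha>) * norm (\<eta> \<xi> powr cpx \<alpha> * fourier \<phi> \<xi>))"
      unfolding \<eta>_def
      by (intro integrable_mult_right integrable_norm integrable_fourier_schwartz_mult[OF \<phi>, where C = 1])
         (use norm_powr_inner_le[OF a, of \<alpha>] \<alpha> in auto)
    show "AE \<xi> in lborel. ((\<lambda>d. F d \<xi>) \<longlongrightarrow> - ?\<Gamma> * F0 \<xi>) (at 0 within {0<..1})"
    proof (rule AE_I2)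
      fix \<xi>
      show "((\<lambda>d. F d \<xi>) \<longlongrightarrow> - ?\<Gamma> * F0 \<xi>) (at 0 within {0<..1})"
      \<comment> \<open>At \<open>\<eta> \<xi> = 0\<close> the power with exponent \<open>\<alpha> - 1\<close> is singular, but the prefactor makes both sides vanish.\<close>
      proof (cases "\<eta> \<xi> = 0")
        case False
        then have "cpx 0 + \<eta> \<xi> \<notin> \<real>\<^sub>\<le>\<^sub>0" by (auto simp: complex_nonpos_Reals_iff complex_eq_iff \<eta>_def)
        then have "((\<lambda>d. F d \<xi>) \<longlongrightarrow> F 0 \<xi>) (at 0 within {0<..1})"
          unfolding F_def by (intro tendsto_mult tendsto_const tendsto_powr_complex tendsto_add tendsto_of_real tendsto_ident_at)
        moreover have "\<eta> \<xi> * \<eta> \<xi> powr cpx (\<alpha> - 1) = \<eta> \<xi> powr cpx \<alpha>"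
          using False by (simp add: powr_diff)
        then have "F 0 \<xi> = - ?\<Gamma> * F0 \<xi>" by (simp add: F_def F0_def mult_ac)
        ultimately show ?thesis by (simp only:)
      qed (simp add: F_def F0_def)
    qed
    fix d :: real assume d: "d \<in> {0<..1}"
    show "AE \<xi> in lborel. norm (F d \<xi>) \<le> Gamma (1 - \<alpha>) * norm (\<eta> \<xi> powr cpx \<alpha> * fourier \<phi> \<xi>)"
    proof (rule AE_I2)
      fix \<xi>
      have "norm (\<eta> \<xi>) * norm ((cpx d + \<eta> \<xi>) powr cpx (\<alpha> - 1)) \<le> norm (\<eta> \<xi> powr cpx \<alpha>)"
      proof (cases "\<eta> \<xi> = 0")
        case False
        \<comment> \<open>Since \<open>\<eta> \<xi>\<close> is purely imaginary, damping only increases the modulus, hence decreases the power with negative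
          exponent.\<close>
        have "norm (\<eta> \<xi>) \<le> norm (cpx d + \<eta> \<xi>)"
          using abs_Im_le_cmod[of "cpx d + \<eta> \<xi>"] by (simp add: \<eta>_def norm_mult)
        then have "norm (cpx d + \<eta> \<xi>) powr (\<alpha> - 1) \<le> norm (\<eta> \<xi>) powr (\<alpha> - 1)"
          using False \<alpha> by (intro powr_mono2') auto
        then have "norm (\<eta> \<xi>) * norm (cpx d + \<eta> \<xi>) powr (\<alpha> - 1) \<le> norm (\<eta> \<xi>) * norm (\<eta> \<xi>) powr (\<alpha> - 1)"
          by (rule mult_left_mono) simp
        also have "\<dots> = norm (\<eta> \<xi>) powr \<alpha>" using False by (simp add: powr_diff)
        finally show ?thesis by (subst norm_powr_real_powr', simp)+ simp
      qed simp
      then have "(norm (\<eta> \<xi>) * norm ((cpx d + \<eta> \<xi>) powr cpx (\<alpha> - 1))) * (Gamma (1 - \<alpha>) * norm (fourier \<phi> \<xi>))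
         \<le> norm (\<eta> \<xi> powr cpx \<alpha>) * (Gamma (1 - \<alpha>) * norm (fourier \<phi> \<xi>))"
        using gam by (intro mult_right_mono) auto
      then show "norm (F d \<xi>) \<le> Gamma (1 - \<alpha>) * norm (\<eta> \<xi> powr cpx \<alpha> * fourier \<phi> \<xi>)"
        using gam unfolding F_def norm_mult by (simp add: mult_ac del: of_real_diff)
    qed
  qed measurable
  have "at 0 within {0<..1::real} \<noteq> bot" by (simp add: trivial_limit_within)
  from tendsto_unique[OF this 1 2]
  have "(LBINT s. power_weight \<alpha> s * \<psi> (x + s *\<^sub>R a)) = - ?\<Gamma> * (?c * (LBINT \<xi>. F0 \<xi>))"
    unfolding integral_mult_right_zero by (simp add: mult_ac)
  then show ?thesis
    unfolding frac_dir_deriv_eq_integral[OF \<phi> \<alpha> a] \<psi>_def[symmetric] using gam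
    by (simp add: scaleR_conv_of_real F0_def \<eta>_def)
qed

section \<open>Caputo derivatives and Abel integral equations\<close>

text \<open>The affine substitution \<open>v \<mapsto> s + (t - s) * v\<close> in the Beta integral.\<close>

lemma nn_integral_beta_scaled:
  fixes p q s t :: real
  assumes p: "p > 0" and q: "q > 0" and st: "s < t"
  shows "(\<integral>\<^sup>+u. ennreal (indicator {s<..<t} u * ((t - u) powr (p - 1) * (u - s) powr (q - 1))) \<partial>lborel)
    = ennreal ((t - s) powr (p + q - 1) * (Gamma p * Gamma q / Gamma (p + q)))"
proof -
  let ?b = "\<lambda>v. v powr (q - 1) * (1 - v) powr (p - 1)"
  have Beta: "Beta q p = Gamma p * Gamma q / Gamma (p + q)" by (simp add: Beta_def add.commute mult.commute)
  have int: "set_integrable lborel {0..1} ?b" by (rule integrable_Beta[OF q p])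
  have "(LINT v:{0..1}|lborel. ?b v) = Beta q p"
    using set_borel_integral_eq_integral(2)[OF int] has_integral_Beta_real[OF q p] by (simp add: integral_unique)
  then have I: "(\<integral>\<^sup>+v. ennreal (indicator {0..1} v * ?b v) \<partial>lborel) = ennreal (Beta q p)"
    using int unfolding set_lebesgue_integral_def set_integrable_def
    by (subst nn_integral_eq_integral) (auto simp: real_scaleR_def)
  have "(\<integral>\<^sup>+u. ennreal (indicator {s<..<t} u * ((t - u) powr (p - 1) * (u - s) powr (q - 1))) \<partial>lborel)
     = ennreal \<bar>t - s\<bar> * (\<integral>\<^sup>+v. ennreal (indicator {s<..<t} (s + (t - s) * v) * ((t - (s + (t - s) * v)) powr (p - 1) * ((s + (t - s) * v) - s) powr (q - 1))) \<partial>lborel)"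
    by (rule nn_integral_real_affine) (use st in auto)
  also have "\<dots> = (\<integral>\<^sup>+v. ennreal \<bar>t - s\<bar> * ennreal (indicator {s<..<t} (s + (t - s) * v) * ((t - (s + (t - s) * v)) powr (p - 1) * ((s + (t - s) * v) - s) powr (q - 1))) \<partial>lborel)"
    by (rule nn_integral_cmult[symmetric]) measurable
  also have "\<dots> = (\<integral>\<^sup>+v. ennreal ((t - s) powr (p + q - 1)) * ennreal (indicator {0..1} v * ?b v) \<partial>lborel)"
  proof (intro nn_integral_cong)
    fix v :: real
    show "ennreal \<bar>t - s\<bar> * ennreal (indicator {s<..<t} (s + (t - s) * v) * ((t - (s + (t - s) * v)) powr (p - 1) * ((s + (t - s) * v) - s) powr (q - 1)))
       = ennreal ((t - s) powr (p + q - 1)) * ennreal (indicator {0..1} v * ?b v)"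
    proof (cases "0 < v \<and> v < 1")
      case True
      have *: "t - (s + (t - s) * v) = (t - s) * (1 - v)" "(s + (t - s) * v) - s = (t - s) * v"
        by (simp_all add: algebra_simps)
      have in1: "s + (t - s) * v \<in> {s<..<t}"
      proof -
        have "(t - s) * v < (t - s) * 1" "0 < (t - s) * v" using True st by (auto intro!: mult_strict_left_mono)
        then show ?thesis unfolding greaterThanLessThan_iff mult_1_right by linarith
      qed
      have "(t - s) * (((t - s) * (1 - v)) powr (p - 1) * ((t - s) * v) powr (q - 1))
         = ((t - s) * ((t - s) powr (p - 1) * (t - s) powr (q - 1))) * (v powr (q - 1) * (1 - v) powr (p - 1))"
        using True st by (simp add: powr_mult)
      also have "(t - s) * ((t - s) powr (p - 1) * (t - s) powr (q - 1)) = (t - s) powr (p + q - 1)"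
        using st by (simp add: powr_mult_base flip: powr_add)
      finally show ?thesis using True st in1 unfolding * by (simp flip: ennreal_mult)
    next
      case False
      then have "indicator {0..1} v * ?b v = 0" by (cases "v = 0"; cases "v = 1") (auto split: split_indicator)
      moreover have "s + (t - s) * v \<notin> {s<..<t}"
      proof -
        have "(t - s) * v \<le> 0 \<or> (t - s) * 1 \<le> (t - s) * v"
          using False st by (cases "v \<le> 0") (auto intro: mult_left_mono simp: mult_le_0_iff)
        then show ?thesis unfolding greaterThanLessThan_iff mult_1_right by linarith
      qed
      ultimately show ?thesis by simp
    qed
  qed
  also have "\<dots> = ennreal ((t - s) powr (p + q - 1)) * ennreal (Beta q p)"
    by (subst nn_integral_cmult) (auto simp: I)
  also have "\<dots> = ennreal ((t - s) powr (p + q - 1) * Beta q p)"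
    using p q by (subst ennreal_mult) (auto simp: Beta intro!: divide_nonneg_nonneg less_imp_le Gamma_real_pos)
  finally show ?thesis by (simp only: Beta)
qed

lemma beta_scaled:
  fixes p q s t :: real
  assumes p: "p > 0" and q: "q > 0" and st: "s < t"
  shows "has_bochner_integral lborel (\<lambda>u. indicator {s<..<t} u * ((t - u) powr (p - 1) * (u - s) powr (q - 1)))
     ((t - s) powr (p + q - 1) * (Gamma p * Gamma q / Gamma (p + q)))"
  using p q st by (intro has_bochner_integral_nn_integral nn_integral_beta_scaled)
    (auto intro!: divide_nonneg_nonneg less_imp_le Gamma_real_pos)

text \<open>The fundamental theorem of calculus holds on \<open>{e..t}\<close> for \<open>e > 0\<close>; then \<open>e\<close> tends to \<open>0\<close>.\<close>

lemma integral_vector_derivative_from_zero: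
  fixes f :: "real \<Rightarrow> complex"
  assumes t: "t > 0" and diff: "\<And>s. s > 0 \<Longrightarrow> f differentiable (at s)"
    and int: "set_integrable lborel {0<..<t} (\<lambda>s. vector_derivative f (at s))"
    and lim: "(f \<longlongrightarrow> f0) (at_right 0)"
  shows "(LINT s:{0<..<t}|lborel. vector_derivative f (at s)) = f t - f0"
proof -
  let ?g = "\<lambda>s. vector_derivative f (at s)"
  have FTC: "(LINT s:{e..t}|lborel. indicator {0<..<t} s *\<^sub>R ?g s) = f t - f e" if e: "0 < e" "e < t" for e
  proof -
    have si: "set_integrable lborel {e..t} (\<lambda>s. indicator {0<..<t} s *\<^sub>R ?g s)"
      using int unfolding set_integrable_def
      by (rule integrable_mult_indicator[rotated]) simp
    have h1: "(?g has_integral f t - f e) {e..t}"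
    proof (rule fundamental_theorem_of_calculus)
      fix s assume "s \<in> {e..t}"
      then show "(f has_vector_derivative ?g s) (at s within {e..t})"
        using diff[of s, unfolded vector_derivative_works, THEN has_vector_derivative_at_within] e by auto
    qed (use e in simp)
    have h2: "indicator {0<..<t} s *\<^sub>R ?g s = ?g s" if "s \<in> {e..t} - {t}" for s
      using that e by auto
    have "((\<lambda>s. indicator {0<..<t} s *\<^sub>R ?g s) has_integral f t - f e) {e..t}"
      by (rule has_integral_spike[OF negligible_sing h2 h1])
    then show ?thesis using set_borel_integral_eq_integral(2)[OF si] by (simp add: integral_unique)
  qed
  have "((\<lambda>e. LINT s:{e..t}|lborel. indicator {0<..<t} s *\<^sub>R ?g s) \<longlongrightarrow> (LINT s|lborel. indicator {0<..<t} s *\<^sub>R ?g s)) (at 0 within {0<..<t})"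
    unfolding set_lebesgue_integral_def
  proof (rule dominated_convergence_within)
    show "integrable lborel (\<lambda>s. norm (indicator {0<..<t} s *\<^sub>R ?g s))" using int by (intro integrable_norm) (simp add: set_integrable_def)
    have [measurable]: "(\<lambda>s. indicator {0<..<t} s *\<^sub>R ?g s) \<in> borel_measurable borel"
      using int by (auto simp: set_integrable_def)
    show "(\<lambda>s. indicator {0<..<t} s *\<^sub>R ?g s) \<in> borel_measurable lborel" by simp
    show "(\<lambda>s. indicat_real {p..t} s *\<^sub>R indicator {0<..<t} s *\<^sub>R ?g s) \<in> borel_measurable lborel" for p by measurable
    show "AE s in lborel. ((\<lambda>e. indicat_real {e..t} s *\<^sub>R indicator {0<..<t} s *\<^sub>R ?g s) \<longlongrightarrow> indicator {0<..<t} s *\<^sub>R ?g s) (at 0 within {0<..<t})"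
    proof (rule AE_I2)
      fix s
      show "((\<lambda>e. indicat_real {e..t} s *\<^sub>R indicator {0<..<t} s *\<^sub>R ?g s) \<longlongrightarrow> indicator {0<..<t} s *\<^sub>R ?g s) (at 0 within {0<..<t})"
      proof (cases "0 < s \<and> s < t")
        case True
        have "\<forall>\<^sub>F e in at 0 within {0<..<t}. indicator {0<..<t} s *\<^sub>R ?g s = indicat_real {e..t} s *\<^sub>R indicator {0<..<t} s *\<^sub>R ?g s"
          unfolding eventually_at using True by (intro exI[of _ s]) (auto simp: dist_real_def)
        then show ?thesis by (rule Lim_transform_eventually[OF tendsto_const])
      qed auto
    qed
  qed (auto split: split_indicator)
  then have "((\<lambda>e. f t - f e) \<longlongrightarrow> (LINT s|lborel. indicator {0<..<t} s *\<^sub>R ?g s)) (at 0 within {0<..<t})"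
    by (rule Lim_transform_within[where d = t]) (use FTC t in auto)
  moreover have "((\<lambda>e. f t - f e) \<longlongrightarrow> f t - f0) (at 0 within {0<..<t})"
    by (intro tendsto_intros tendsto_within_subset[OF lim]) auto
  moreover have "at 0 within {0<..<t} \<noteq> bot" using t by (simp add: trivial_limit_within islimpt_greaterThanLessThan1)
  ultimately show ?thesis unfolding set_lebesgue_integral_def using tendsto_unique by blast
qed

text \<open>The Caputo derivative \<open>D\<close> is the Abel integral of order \<open>1 - \<beta>\<close> of \<open>f'\<close>. Applying the Abel integral of order \<open>\<beta>\<close>
  and exchanging the integrals gives the integral of \<open>f'\<close>, because
  \<open>\<integral>\<^sub>s\<^sup>t (t - u) powr (\<beta> - 1) * (u - s) powr (- \<beta>) du = Gamma \<beta> * Gamma (1 - \<beta>)\<close> for all \<open>s < t\<close>. Measurability of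
  the integrand is part of the claim since nothing is known about \<open>D\<close> beyond its definition by an integral.\<close>

theorem caputo_volterra:
  fixes f :: "real \<Rightarrow> complex"
  assumes \<beta>: "\<beta> \<in> {0<..<1}" and cap: "\<And>u. u > 0 \<Longrightarrow> has_caputo_derivative \<beta> f (D u) u"
    and lim: "(f \<longlongrightarrow> f0) (at_right 0)" and t: "t > 0"
  shows "f t = f0 + cpx (1 / Gamma \<beta>) * (LBINT u. cpx (indicator {0<..<t} u * (t - u) powr (\<beta> - 1)) * D u)"
    and "(\<lambda>u. cpx (indicator {0<..<t} u * (t - u) powr (\<beta> - 1)) * D u) \<in> borel_measurable borel"
proof -
  define g where "g s = vector_derivative f (at s)" for s
  have diff: "f differentiable (at s)" if "s > 0" for s
    using cap[of "s + 1"] that by (auto simp: has_caputo_derivative_def)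
  have si: "set_integrable lborel {0<..<u} (\<lambda>s. g s /\<^sub>R ((u - s) powr \<beta>))" if "u > 0" for u
    using cap[OF that] by (simp add: has_caputo_derivative_def g_def)
  have D: "D u = (1 / Gamma (1 - \<beta>)) *\<^sub>R (LINT s:{0<..<u}|lborel. g s /\<^sub>R ((u - s) powr \<beta>))" if "u > 0" for u
    using cap[OF that] by (simp add: has_caputo_derivative_def g_def)
  have gm: "(\<lambda>s. indicator {0<..<t} s *\<^sub>R g s) \<in> borel_measurable borel"
  proof -
    have "(\<lambda>s. indicator {0<..<t} s *\<^sub>R (g s /\<^sub>R ((t - s) powr \<beta>))) \<in> borel_measurable borel"
      using si[OF t] by (auto simp: set_integrable_def)
    then have "(\<lambda>s. (t - s) powr \<beta> *\<^sub>R (indicator {0<..<t} s *\<^sub>R (g s /\<^sub>R ((t - s) powr \<beta>)))) \<in> borel_measurable borel"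
      by measurable
    also have "(\<lambda>s. (t - s) powr \<beta> *\<^sub>R (indicator {0<..<t} s *\<^sub>R (g s /\<^sub>R ((t - s) powr \<beta>)))) = (\<lambda>s. indicator {0<..<t} s *\<^sub>R g s)"
      by (auto simp: fun_eq_iff split: split_indicator)
    finally show ?thesis .
  qed
  \<comment> \<open>The kernel \<open>(t - s) powr (- \<beta>)\<close> is bounded below by \<open>t powr (- \<beta>)\<close> on \<open>{0<..<t}\<close>, so integrability passes to \<open>f'\<close> itself.\<close>
  have gi: "integrable lborel (\<lambda>s. indicator {0<..<t} s *\<^sub>R g s)"
  proof (rule Bochner_Integration.integrable_bound)
    show "integrable lborel (\<lambda>s. t powr \<beta> *\<^sub>R (indicator {0<..<t} s *\<^sub>R (g s /\<^sub>R ((t - s) powr \<beta>))))"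
      using si[OF t] unfolding set_integrable_def by (intro integrable_scaleR_right)
    show "AE s in lborel. norm (indicator {0<..<t} s *\<^sub>R g s) \<le> norm (t powr \<beta> *\<^sub>R (indicator {0<..<t} s *\<^sub>R (g s /\<^sub>R ((t - s) powr \<beta>))))"
    proof (rule AE_I2)
      fix s
      show "norm (indicator {0<..<t} s *\<^sub>R g s) \<le> norm (t powr \<beta> *\<^sub>R (indicator {0<..<t} s *\<^sub>R (g s /\<^sub>R ((t - s) powr \<beta>))))"
      proof (cases "s \<in> {0<..<t}")
        case True
        then have "(t - s) powr \<beta> \<le> t powr \<beta>" using \<beta> by (intro powr_mono2) auto
        then have "(t - s) powr \<beta> * norm (g s) \<le> t powr \<beta> * norm (g s)" by (rule mult_right_mono) simp
        then show ?thesis using True by (simp add: field_simps)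
      qed simp
    qed
  qed (use gm in simp)
  have FTC: "(LINT s:{0<..<t}|lborel. g s) = f t - f0"
    unfolding g_def by (rule integral_vector_derivative_from_zero[OF t diff _ lim]) (use gi in \<open>auto simp: set_integrable_def g_def\<close>)

  define G where "G s = indicator {0<..<t} s *\<^sub>R g s" for s
  have [measurable]: "G \<in> borel_measurable borel" using gm by (simp add: G_def[abs_def])
  define w where "w s u = indicator {s<..<t} u * ((t - u) powr (\<beta> - 1) * (u - s) powr ((1 - \<beta>) - 1))" for s u
  have [measurable]: "(\<lambda>(s, u). w s u) \<in> borel_measurable (borel \<Otimes>\<^sub>M borel)"
  proof -
    have "(\<lambda>(s, u). w s u) = (\<lambda>(s, u). (if s < u \<and> u < t then 1 else 0) * ((t - u) powr (\<beta> - 1) * (u - s) powr ((1 - \<beta>) - 1)))"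
      by (auto simp: w_def fun_eq_iff)
    also have "\<dots> \<in> borel_measurable (borel \<Otimes>\<^sub>M borel)" by measurable
    finally show ?thesis .
  qed
  have wB: "has_bochner_integral lborel (w s) (Gamma \<beta> * Gamma (1 - \<beta>))" if "s < t" for s
    using beta_scaled[of \<beta> "1 - \<beta>" s t] \<beta> that by (simp add: w_def[abs_def])
  have w0: "w s u \<ge> 0" for s u by (simp add: w_def)
  have wG: "(LBINT u. cpx (w s u) * G s) = cpx (Gamma \<beta> * Gamma (1 - \<beta>)) * G s" for s
  proof (cases "s < t")
    case True
    then show ?thesis using wB[OF True] by (simp add: has_bochner_integral_iff)
  qed (simp add: G_def)
  have int2: "integrable (lborel \<Otimes>\<^sub>M lborel) (\<lambda>(s, u). cpx (w s u) * G s)"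
  proof (rule lborel_pair.Fubini_integrable)
    show "integrable lborel (\<lambda>s. LBINT u. norm (case (s, u) of (s, u) \<Rightarrow> cpx (w s u) * G s))"
    proof -
      have "(LBINT u. norm (cpx (w s u) * G s)) = Gamma \<beta> * Gamma (1 - \<beta>) * norm (G s)" for s
      proof (cases "s < t")
        case True
        then show ?thesis using wB[OF True] w0 by (simp add: has_bochner_integral_iff norm_mult)
      qed (simp add: G_def)
      moreover have "integrable lborel G" using gi by (simp add: G_def[abs_def])
      ultimately show ?thesis by simp
    qed
    show "AE s in lborel. integrable lborel (\<lambda>u. case (s, u) of (s, u) \<Rightarrow> cpx (w s u) * G s)"
    proof (rule AE_I2)
      fix s
      show "integrable lborel (\<lambda>u. case (s, u) of (s, u) \<Rightarrow> cpx (w s u) * G s)"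
      proof (cases "s < t")
        case True
        then show ?thesis using wB[OF True] by (simp add: has_bochner_integral_iff complex_of_real_integrable_eq)
      qed (simp add: G_def)
    qed
    show "(\<lambda>(s, u). cpx (w s u) * G s) \<in> borel_measurable (lborel \<Otimes>\<^sub>M lborel)" by measurable
  qed
  have gam: "Gamma \<beta> > 0" "Gamma (1 - \<beta>) > 0" using \<beta> by (auto intro!: Gamma_real_pos)
  have inner: "(LBINT s. cpx (w s u) * G s) = cpx (Gamma (1 - \<beta>)) * (cpx (indicator {0<..<t} u * (t - u) powr (\<beta> - 1)) * D u)" for u
  proof (cases "u \<in> {0<..<t}")
    case True
    have "(LBINT s. cpx (w s u) * G s) = (LBINT s. cpx ((t - u) powr (\<beta> - 1)) * (indicator {0<..<u} s *\<^sub>R (g s /\<^sub>R ((u - s) powr \<beta>))))"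
      using True by (intro Bochner_Integration.integral_cong)
        (auto simp: w_def G_def scaleR_conv_of_real powr_minus split: split_indicator)
    also have "\<dots> = cpx ((t - u) powr (\<beta> - 1)) * (LINT s:{0<..<u}|lborel. g s /\<^sub>R ((u - s) powr \<beta>))"
      unfolding set_lebesgue_integral_def by (rule integral_mult_right_zero)
    also have "\<dots> = cpx (Gamma (1 - \<beta>)) * (cpx (indicator {0<..<t} u * (t - u) powr (\<beta> - 1)) * D u)"
      using True gam D[of u] by (simp add: scaleR_conv_of_real)
    finally show ?thesis .
  next
    case False
    then have "(\<lambda>s. cpx (w s u) * G s) = (\<lambda>_. 0)"
      by (auto simp: w_def G_def fun_eq_iff split: split_indicator)
    then show ?thesis using False by simp
  qed
  have "(\<lambda>u. LBINT s. cpx (w s u) * G s) \<in> borel_measurable borel" by measurable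
  then have "(\<lambda>u. cpx (1 / Gamma (1 - \<beta>)) * (LBINT s. cpx (w s u) * G s)) \<in> borel_measurable borel"
    by (rule borel_measurable_times[OF borel_measurable_const])
  then show "(\<lambda>u. cpx (indicator {0<..<t} u * (t - u) powr (\<beta> - 1)) * D u) \<in> borel_measurable borel"
  proof (rule measurable_cong[THEN iffD1, rotated])
    show "cpx (1 / Gamma (1 - \<beta>)) * (LBINT s. cpx (w s u) * G s) =
        cpx (indicator {0<..<t} u * (t - u) powr (\<beta> - 1)) * D u" for u
      unfolding inner using gam by simp
  qed
  have "(LBINT u. (LBINT s. cpx (w s u) * G s))
     = (LBINT s. (LBINT u. cpx (w s u) * G s))"
    by (rule lborel_pair.Fubini_integral[OF int2])
  also have "\<dots> = cpx (Gamma \<beta> * Gamma (1 - \<beta>)) * (LBINT s. G s)"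
    unfolding wG by (rule integral_mult_right_zero)
  also have "(LBINT s. G s) = f t - f0"
    using FTC by (simp add: G_def set_lebesgue_integral_def)
  finally have "cpx (Gamma (1 - \<beta>)) * (LBINT u. cpx (indicator {0<..<t} u * (t - u) powr (\<beta> - 1)) * D u)
     = cpx (Gamma (1 - \<beta>)) * (cpx (Gamma \<beta>) * (f t - f0))"
    unfolding inner integral_mult_right_zero by (simp only: of_real_mult mult_ac)
  then have "(LBINT u. cpx (indicator {0<..<t} u * (t - u) powr (\<beta> - 1)) * D u) = cpx (Gamma \<beta>) * (f t - f0)"
    using gam by (simp only: mult_cancel_left of_real_eq_0_iff) simp
  then show "f t = f0 + cpx (1 / Gamma \<beta>) * (LBINT u. cpx (indicator {0<..<t} u * (t - u) powr (\<beta> - 1)) * D u)"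
    using gam by (simp only:) simp
qed

text \<open>Let \<open>norm (v t) * exp (- \<mu> * t)\<close> be bounded by \<open>C\<close>. The equation improves the bound to
  \<open>norm c * Gamma \<beta> * \<mu> powr (- \<beta>) * C\<close>, which is at most \<open>C / 2\<close> if \<open>\<mu>\<close> is large. Iteration gives \<open>0\<close>. The exponential
  weight avoids a restriction to short time intervals.\<close>

theorem volterra_unique:
  fixes v :: "real \<Rightarrow> complex"
  assumes \<beta>: "\<beta> > 0" and bd: "\<And>t. t \<in> {0<..b} \<Longrightarrow> norm (v t) \<le> C"
    and eq: "\<And>t. t \<in> {0<..b} \<Longrightarrow> v t = c * (LBINT u. cpx (indicator {0<..<t} u * (t - u) powr (\<beta> - 1)) * v u)"
    and t: "t \<in> {0<..b}"
  shows "v t = 0"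
proof -
  have gam: "Gamma \<beta> > 0" using \<beta> by (rule Gamma_real_pos)
  \<comment> \<open>The summand \<open>1\<close> keeps \<open>A\<close> positive when \<open>c = 0\<close>.\<close>
  define A where "A = 2 * norm c * Gamma \<beta> + 1"
  have A: "A > 0" using gam unfolding A_def by (intro add_nonneg_pos mult_nonneg_nonneg) auto
  define \<mu> where "\<mu> = A powr (1 / \<beta>)"
  have \<mu>: "\<mu> > 0" using A by (simp add: \<mu>_def)
  have "\<mu> powr (- \<beta>) = inverse A" using A \<beta> by (simp add: \<mu>_def powr_powr powr_minus)
  then have half: "norm c * (Gamma \<beta> * \<mu> powr (- \<beta>)) \<le> 1 / 2"
  proof -
    have "A * \<mu> powr (- \<beta>) = 1" using A \<open>\<mu> powr (- \<beta>) = inverse A\<close> by simp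
    then have "2 * (norm c * (Gamma \<beta> * \<mu> powr (- \<beta>))) = 1 - \<mu> powr (- \<beta>)"
      by (simp add: A_def algebra_simps)
    then show ?thesis using powr_ge_zero[of \<mu> "- \<beta>"] by linarith
  qed
  have C: "C \<ge> 0" using bd[OF t] norm_ge_zero order_trans by blast
  have "norm (v t) * exp (- \<mu> * t) \<le> C / 2 ^ n" if "t \<in> {0<..b}" for n t
    using that
  proof (induction n arbitrary: t)
    case 0
    then have "norm (v t) * exp (- \<mu> * t) \<le> C * 1" using \<mu> C by (intro mult_mono bd) auto
    then show ?case by simp
  next
    case (Suc n)
    let ?K = "\<lambda>w. indicator {0<..} w * (w powr (\<beta> - 1) * exp (- \<mu> * w))"
    have gi: "integrable lborel ?K" "(LBINT w. ?K w) = Gamma \<beta> * \<mu> powr (- \<beta>)"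
      using gamma_scaled[OF \<beta> \<mu>] by (auto simp: has_bochner_integral_iff)
    have gi': "integrable lborel (\<lambda>u. ?K (t - u))" "(LBINT u. ?K (t - u)) = Gamma \<beta> * \<mu> powr (- \<beta>)"
      using gi lborel_integrable_real_affine_iff[of "-1" ?K t] lborel_integral_real_affine[of "-1" ?K t] by auto
    have "norm (LBINT u. cpx (indicator {0<..<t} u * (t - u) powr (\<beta> - 1)) * v u)
       \<le> (LBINT u. norm (cpx (indicator {0<..<t} u * (t - u) powr (\<beta> - 1)) * v u))"
      by (rule integral_norm_bound)
    also have "\<dots> \<le> (LBINT u. C / 2 ^ n * exp (\<mu> * t) * ?K (t - u))"
    proof (rule integral_mono')
      show "integrable lborel (\<lambda>u. C / 2 ^ n * exp (\<mu> * t) * ?K (t - u))" by (intro integrable_mult_right gi')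
      fix u
      show "norm (cpx (indicator {0<..<t} u * (t - u) powr (\<beta> - 1)) * v u) \<le> C / 2 ^ n * exp (\<mu> * t) * ?K (t - u)"
      proof (cases "u \<in> {0<..<t}")
        case True
        then have "norm (v u) * exp (- \<mu> * u) \<le> C / 2 ^ n" using Suc by auto
        then have "norm (v u) * exp (- \<mu> * u) * exp (\<mu> * u) \<le> C / 2 ^ n * exp (\<mu> * u)" by (rule mult_right_mono) simp
        then have "norm (v u) \<le> C / 2 ^ n * exp (\<mu> * u)" by (simp add: mult.assoc flip: exp_add)
        then have "(t - u) powr (\<beta> - 1) * norm (v u) \<le> (t - u) powr (\<beta> - 1) * (C / 2 ^ n * exp (\<mu> * u))" by (rule mult_left_mono) simp
        also have "exp (\<mu> * u) = exp (\<mu> * t) * exp (- \<mu> * (t - u))" by (simp add: algebra_simps flip: exp_add)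
        finally show ?thesis using True by (simp add: norm_mult mult_ac)
      next
        case False
        then show ?thesis using C by (simp add: mult_nonneg_nonneg)
      qed
    qed (use C in \<open>simp add: mult_nonneg_nonneg\<close>)
    also have "\<dots> = C / 2 ^ n * exp (\<mu> * t) * (Gamma \<beta> * \<mu> powr (- \<beta>))"
      unfolding integral_mult_right_zero gi' ..
    finally have "norm (v t) \<le> norm c * (C / 2 ^ n * exp (\<mu> * t) * (Gamma \<beta> * \<mu> powr (- \<beta>)))"
      unfolding eq[OF Suc.prems] norm_mult by (intro mult_left_mono) auto
    also have "\<dots> = (norm c * (Gamma \<beta> * \<mu> powr (- \<beta>))) * (C / 2 ^ n * exp (\<mu> * t))" by simp
    also have "\<dots> \<le> 1 / 2 * (C / 2 ^ n * exp (\<mu> * t))" using C by (intro mult_right_mono half) auto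
    finally have "norm (v t) * exp (- \<mu> * t) \<le> (1 / 2 * (C / 2 ^ n * exp (\<mu> * t))) * exp (- \<mu> * t)" by (rule mult_right_mono) simp
    also have "\<dots> = C / 2 ^ Suc n * (exp (\<mu> * t) * exp (- \<mu> * t))" by simp
    also have "exp (\<mu> * t) * exp (- \<mu> * t) = 1" by (simp flip: exp_add)
    finally show ?case by simp
  qed
  then have "norm (v t) * exp (- \<mu> * t) \<le> C * (1 / 2) ^ n" for n
    using t by (simp add: power_one_over)
  moreover have "(\<lambda>n. C * (1 / 2) ^ n) \<longlonglongrightarrow> C * 0"
    by (intro tendsto_mult tendsto_const LIMSEQ_power_zero) simp
  ultimately have "norm (v t) * exp (- \<mu> * t) \<le> C * 0"
    using LIMSEQ_le_const[of "\<lambda>n. C * (1 / 2) ^ n"] by blast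
  then have "norm (v t) * exp (- \<mu> * t) \<le> 0" by simp
  then have "norm (v t) \<le> 0" unfolding mult_le_0_iff using exp_gt_zero[of "- \<mu> * t"] by linarith
  then show ?thesis by simp
qed

section \<open>Mittag-Leffler functions as exponential moments\<close>

text \<open>Logarithmic convexity of the Gamma function: \<open>x\<close> lies between \<open>x - 1\<close> and \<open>x + \<beta>\<close>, and \<open>Gamma (x - 1)\<close> is
  \<open>Gamma x / (x - 1)\<close>.\<close>

lemma Gamma_ratio_ge:
  fixes x \<beta> :: real
  assumes x: "x > 1" and \<beta>: "\<beta> > 0"
  shows "Gamma x * (x - 1) powr \<beta> \<le> Gamma (x + \<beta>)"
proof -
  have pos: "Gamma y > 0" if "y > 0" for y :: real using that by (rule Gamma_real_pos)
  define p where "p = 1 / (1 + \<beta>)"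
  have p: "p * (1 + \<beta>) = 1" "p \<in> {0..1}" using \<beta> by (auto simp: p_def)
  have "(ln \<circ> Gamma) ((1 - p) *\<^sub>R (x - 1) + p *\<^sub>R (x + \<beta>)) \<le> (1 - p) * (ln \<circ> Gamma) (x - 1) + p * (ln \<circ> Gamma) (x + \<beta>)"
    using x \<beta> p by (intro convex_onD[OF log_convex_Gamma_real]) auto
  also have "(1 - p) *\<^sub>R (x - 1) + p *\<^sub>R (x + \<beta>) = x"
    using p(1) by (simp add: algebra_simps)
  finally have "(1 + \<beta>) * ln (Gamma x) \<le> (1 + \<beta>) * ((1 - p) * ln (Gamma (x - 1)) + p * ln (Gamma (x + \<beta>)))"
    using \<beta> by (intro mult_left_mono) auto
  also have "\<dots> = ((1 + \<beta>) - p * (1 + \<beta>)) * ln (Gamma (x - 1)) + (p * (1 + \<beta>)) * ln (Gamma (x + \<beta>))"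
    by (simp add: algebra_simps)
  finally have 1: "(1 + \<beta>) * ln (Gamma x) \<le> \<beta> * ln (Gamma (x - 1)) + ln (Gamma (x + \<beta>))"
    unfolding p(1) by simp
  have "Gamma x = (x - 1) * Gamma (x - 1)"
    using Gamma_plus1[of "x - 1"] x by (auto simp: nonpos_Ints_def)
  moreover have "Gamma (x - 1) > 0" using x by (intro pos) simp
  ultimately have "ln (Gamma x) = ln (x - 1) + ln (Gamma (x - 1))"
    using x ln_mult_pos[of "x - 1" "Gamma (x - 1)"] by simp
  with 1 have "ln (Gamma x) + \<beta> * ln (x - 1) \<le> ln (Gamma (x + \<beta>))"
    by (simp add: algebra_simps)
  then have "exp (ln (Gamma x) + \<beta> * ln (x - 1)) \<le> exp (ln (Gamma (x + \<beta>)))" by simp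
  then show ?thesis using x \<beta> pos[of x] pos[of "x + \<beta>"] by (simp add: exp_add powr_def)
qed

text \<open>By \<open>Gamma_ratio_ge\<close> the quotient of successive terms is at most \<open>c / (\<beta> k) powr \<beta>\<close>, which tends to \<open>0\<close>.\<close>

lemma summable_mittag_leffler:
  fixes c \<beta> :: real
  assumes \<beta>: "\<beta> > 0" and c: "c \<ge> 0"
  shows "summable (\<lambda>k. c ^ k / Gamma (\<beta> * real k + 1))"
proof -
  \<comment> \<open>From this index on the quotients are at most \<open>1 / 2\<close>; the summand \<open>1\<close> guarantees \<open>k \<ge> 1\<close>.\<close>
  obtain N where N: "real N \<ge> (2 * c) powr (1 / \<beta>) / \<beta> + 1" using real_arch_simple by blast
  have pos: "Gamma (\<beta> * real k + 1) > 0" for k using \<beta> by (intro Gamma_real_pos add_nonneg_pos) auto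
  show ?thesis
  proof (rule summable_ratio_test[where c = "1/2" and N = N])
    fix k assume k: "k \<ge> N"
    have "(2 * c) powr (1 / \<beta>) / \<beta> \<ge> 0" using \<beta> by simp
    then have k1: "real k \<ge> 1" "real k \<ge> (2 * c) powr (1 / \<beta>) / \<beta>" using N k by linarith+
    then have "(2 * c) powr (1 / \<beta>) \<le> \<beta> * real k" using \<beta> by (simp add: field_simps)
    then have "((2 * c) powr (1 / \<beta>)) powr \<beta> \<le> (\<beta> * real k) powr \<beta>" using \<beta> by (intro powr_mono2) auto
    then have 2: "2 * c \<le> (\<beta> * real k) powr \<beta>" using \<beta> c by (simp add: powr_powr)
    let ?x = "\<beta> * real k + 1"
    have "Gamma ?x * (2 * c) \<le> Gamma ?x * (?x - 1) powr \<beta>"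
      using 2 pos[of k] by (intro mult_left_mono) auto
    also have "\<dots> \<le> Gamma (?x + \<beta>)" using \<beta> k1 by (intro Gamma_ratio_ge) auto
    finally have "Gamma ?x * (2 * c) \<le> Gamma (\<beta> * real (Suc k) + 1)" by (simp add: algebra_simps)
    moreover have "c * inverse g' \<le> 1 / 2 * inverse g" if "g * (2 * c) \<le> g'" "g > 0" "g' > 0" for g g' :: real
      using that by (simp add: field_simps)
    ultimately have "c * inverse (Gamma (\<beta> * real (Suc k) + 1)) \<le> 1 / 2 * inverse (Gamma ?x)"
      using pos[of k] pos[of "Suc k"] by blast
    then have "c ^ k * (c * inverse (Gamma (\<beta> * real (Suc k) + 1))) \<le> c ^ k * (1 / 2 * inverse (Gamma ?x))"
      using c by (intro mult_left_mono) auto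
    moreover have "norm (c ^ Suc k / Gamma (\<beta> * real (Suc k) + 1)) = c ^ k * (c * inverse (Gamma (\<beta> * real (Suc k) + 1)))"
      using c pos[of "Suc k"] by (simp add: norm_mult norm_divide divide_inverse del: of_nat_Suc)
    moreover have "1 / 2 * norm (c ^ k / Gamma ?x) = c ^ k * (1 / 2 * inverse (Gamma ?x))"
    proof -
      have "c ^ k / Gamma ?x \<ge> 0" using c pos[of k] by (intro divide_nonneg_pos) auto
      then show ?thesis unfolding real_norm_def by (simp only: abs_of_nonneg) (simp only: divide_inverse mult_ac)
    qed
    ultimately show "norm (c ^ Suc k / Gamma (\<beta> * real (Suc k) + 1)) \<le> 1 / 2 * norm (c ^ k / Gamma ?x)"
      by (simp only:)
  qed simp
qed

text \<open>The factor \<open>Suc k\<close> is absorbed by enlarging the base of the power.\<close>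

lemma summable_mittag_leffler_Suc:
  fixes u \<beta> :: real
  assumes \<beta>: "\<beta> > 0" and u: "u \<ge> 0"
  shows "summable (\<lambda>k. u ^ k * (real (Suc k) / Gamma (\<beta> * real (Suc k) + 1)))"
proof -
  have Gamma_pos: "Gamma (\<beta> * real k + 1) > 0" for k using \<beta> by (intro Gamma_real_pos add_nonneg_pos) auto
  define c where "c = 2 * u + 2"
  have c: "c \<ge> 2" using u by (simp add: c_def)
  have "summable (\<lambda>k. c ^ k / Gamma (\<beta> * real k + 1))" using \<beta> c by (intro summable_mittag_leffler) auto
  then have "summable (\<lambda>k. c ^ Suc k / Gamma (\<beta> * real (Suc k) + 1))"
    using summable_Suc_iff[of "\<lambda>k. c ^ k / Gamma (\<beta> * real k + 1)"] by blast
  then show ?thesis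
  proof (rule summable_comparison_test'[where N = 0])
    fix k
    have "real (Suc k) \<le> 2 ^ k" by (induction k) auto
    then have "u ^ k * real (Suc k) \<le> u ^ k * 2 ^ k" using u by (intro mult_left_mono) auto
    also have "\<dots> = (2 * u) ^ k" by (simp add: power_mult_distrib)
    also have "\<dots> \<le> c ^ k" using u by (intro power_mono) (auto simp: c_def)
    also have "\<dots> \<le> c ^ Suc k" using c by simp
    finally have "u ^ k * real (Suc k) / Gamma (\<beta> * real (Suc k) + 1) \<le> c ^ Suc k / Gamma (\<beta> * real (Suc k) + 1)"
      using Gamma_pos[of "Suc k"] by (intro divide_right_mono) auto
    moreover have "u ^ k * (real (Suc k) / Gamma (\<beta> * real (Suc k) + 1)) \<ge> 0"
      using Gamma_pos[of "Suc k"] u by (intro mult_nonneg_nonneg divide_nonneg_nonneg) auto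
    ultimately show "norm (u ^ k * (real (Suc k) / Gamma (\<beta> * real (Suc k) + 1))) \<le> c ^ Suc k / Gamma (\<beta> * real (Suc k) + 1)"
      unfolding real_norm_def by (simp only: abs_of_nonneg times_divide_eq_right)
  qed
qed

lemma inverse_Gamma_Suc:
  fixes \<beta> :: real
  assumes "\<beta> > 0"
  shows "\<beta> * (real (Suc k) / Gamma (\<beta> * real (Suc k) + 1)) = 1 / Gamma (\<beta> * real k + \<beta>)"
proof -
  have e: "\<beta> * real (Suc k) = \<beta> * real k + \<beta>" by (simp add: algebra_simps)
  have p: "\<beta> * real (Suc k) > 0" using assms by simp
  then have "Gamma (\<beta> * real (Suc k) + 1) = (\<beta> * real (Suc k)) * Gamma (\<beta> * real (Suc k))"
    by (intro Gamma_plus1) (auto elim!: nonpos_Ints_cases)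
  then have "\<beta> * (real (Suc k) / Gamma (\<beta> * real (Suc k) + 1)) = (\<beta> * real (Suc k)) / ((\<beta> * real (Suc k)) * Gamma (\<beta> * real (Suc k)))"
    by (simp only: times_divide_eq_right)
  also have "\<dots> = 1 / Gamma (\<beta> * real (Suc k))"
    using p by (subst nonzero_divide_mult_cancel_left) auto
  finally show ?thesis unfolding e .
qed

text \<open>The moments are the Taylor coefficients of the Mittag-Leffler function \<open>E\<^sub>\<beta>\<close> times \<open>k!\<close>, so that
  \<open>E exp (z Y) = E\<^sub>\<beta> z\<close>. Working with the random variable instead of the series gives, in addition to
  the series, the bound \<open>1\<close> on the left half-plane, which the series does not show.\<close>

locale mittag_leffler_variable = prob_space M for M :: "'w measure" +
  fixes Y :: "'w \<Rightarrow> real" and \<beta> :: real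
  assumes Y_meas [measurable]: "Y \<in> borel_measurable M" and Y_nonneg: "\<And>\<omega>. Y \<omega> \<ge> 0" and \<beta>: "\<beta> \<in> {0<..<1}"
    and moments: "\<And>k. (\<integral>\<^sup>+\<omega>. ennreal (Y \<omega> ^ k) \<partial>M) = ennreal (fact k / Gamma (\<beta> * real k + 1))"
begin

text \<open>\<open>ml z t\<close> is the Mittag-Leffler function \<open>E\<^sub>\<beta> (- z * t powr \<beta>)\<close>; \<open>ml1\<close> is its
  derivative in \<open>z\<close> up to the factor \<open>- t powr \<beta>\<close>.\<close>

definition ml :: "complex \<Rightarrow> real \<Rightarrow> complex" where
  "ml z t = (\<integral>\<omega>. exp (- (z * cpx (t powr \<beta> * Y \<omega>))) \<partial>M)"

definition ml1 :: "complex \<Rightarrow> real \<Rightarrow> complex" where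
  "ml1 z t = (\<integral>\<omega>. cpx (Y \<omega>) * exp (- (z * cpx (t powr \<beta> * Y \<omega>))) \<partial>M)"

lemma Gamma_pos: "Gamma (\<beta> * real k + 1) > 0"
  using \<beta> by (intro Gamma_real_pos add_nonneg_pos) auto

lemma Y_moment: "has_bochner_integral M (\<lambda>\<omega>. Y \<omega> ^ k) (fact k / Gamma (\<beta> * real k + 1))"
  using moments[of k] Gamma_pos[of k] by (intro has_bochner_integral_nn_integral) (auto simp: Y_nonneg less_imp_le)

lemma integrable_Y: "integrable M Y" and integral_Y: "(\<integral>\<omega>. Y \<omega> \<partial>M) = 1 / Gamma (\<beta> + 1)"
  using Y_moment[of 1] by (simp_all add: has_bochner_integral_iff)

lemma norm_exp_le_one: "Re z \<ge> 0 \<Longrightarrow> norm (exp (- (z * cpx (t powr \<beta> * Y \<omega>)))) \<le> 1"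
  using Y_nonneg[of \<omega>] by simp

lemma integrable_ml: "Re z \<ge> 0 \<Longrightarrow> integrable M (\<lambda>\<omega>. exp (- (z * cpx (t powr \<beta> * Y \<omega>))))"
  by (rule integrable_const_bound[where B = 1]) (auto simp: Y_nonneg)

lemma norm_ml_le:
  assumes "Re z \<ge> 0" shows "norm (ml z t) \<le> 1"
proof -
  have "norm (ml z t) \<le> (\<integral>\<omega>. norm (exp (- (z * cpx (t powr \<beta> * Y \<omega>)))) \<partial>M)"
    unfolding ml_def by (rule integral_norm_bound)
  also have "\<dots> \<le> (\<integral>\<omega>. 1 \<partial>M)"
    by (rule integral_mono') (use norm_exp_le_one[OF assms] in auto)
  finally show ?thesis by (simp add: prob_space)
qed

lemma norm_ml1_le:
  assumes "Re z \<ge> 0" shows "norm (ml1 z t) \<le> 1 / Gamma (\<beta> + 1)"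
proof -
  have "norm (ml1 z t) \<le> (\<integral>\<omega>. norm (cpx (Y \<omega>) * exp (- (z * cpx (t powr \<beta> * Y \<omega>)))) \<partial>M)"
    unfolding ml1_def by (rule integral_norm_bound)
  also have "\<dots> \<le> (\<integral>\<omega>. Y \<omega> \<partial>M)"
  proof (rule integral_mono'[OF integrable_Y])
    fix \<omega>
    have "Y \<omega> * norm (exp (- (z * cpx (t powr \<beta> * Y \<omega>)))) \<le> Y \<omega> * 1"
      by (intro mult_left_mono norm_exp_le_one assms Y_nonneg)
    then show "norm (cpx (Y \<omega>) * exp (- (z * cpx (t powr \<beta> * Y \<omega>)))) \<le> Y \<omega>"
      using Y_nonneg[of \<omega>] by (simp only: norm_mult norm_of_real abs_of_nonneg mult_1_right)
  qed (rule Y_nonneg)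
  finally show ?thesis by (simp add: integral_Y)
qed

text \<open>The exponential series is integrated term by term; the sum of the integrals of the norms is again a series of
  Mittag-Leffler type.\<close>

lemma ml_sums:
  "(\<lambda>k. (- z * cpx (t powr \<beta>)) ^ k / cpx (Gamma (\<beta> * real k + 1))) sums ml z t"
proof -
  let ?u = "- z * cpx (t powr \<beta>)"
  let ?f = "\<lambda>k \<omega>. (?u ^ k / fact k) * cpx (Y \<omega> ^ k)"
  have ser: "(\<lambda>k. ?f k \<omega>) sums exp (- (z * cpx (t powr \<beta> * Y \<omega>)))" for \<omega>
  proof -
    have eq: "- (z * cpx (t powr \<beta> * Y \<omega>)) = ?u * cpx (Y \<omega>)" by simp
    have "?f k \<omega> = (?u * cpx (Y \<omega>)) ^ k /\<^sub>R fact k" for k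
      by (simp only: power_mult_distrib of_real_power scaleR_conv_of_real of_real_inverse of_real_fact divide_inverse mult_ac)
    then show ?thesis unfolding eq using exp_converges[of "?u * cpx (Y \<omega>)"] by (simp only:)
  qed
  have norm_f: "norm (?f k \<omega>) = (norm ?u ^ k / fact k) * Y \<omega> ^ k" for k \<omega>
    using Y_nonneg[of \<omega>] by (simp only: norm_mult norm_divide norm_power norm_of_real norm_fact abs_of_nonneg zero_le_power)
  have int: "integrable M (?f k)" for k
    using Y_moment[of k] by (intro integrable_mult_right) (simp only: complex_of_real_integrable_eq has_bochner_integral_iff)
  have intval: "(\<integral>\<omega>. ?f k \<omega> \<partial>M) = ?u ^ k / cpx (Gamma (\<beta> * real k + 1))" for k
  proof -
    have "(\<integral>\<omega>. ?f k \<omega> \<partial>M) = (?u ^ k / fact k) * (\<integral>\<omega>. cpx (Y \<omega> ^ k) \<partial>M)" by (rule integral_mult_right_zero)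
    also have "(\<integral>\<omega>. cpx (Y \<omega> ^ k) \<partial>M) = cpx (fact k / Gamma (\<beta> * real k + 1))"
      using Y_moment[of k] by (simp only: integral_complex_of_real has_bochner_integral_iff)
    finally show ?thesis by simp
  qed
  have intnorm: "(\<integral>\<omega>. norm (?f k \<omega>) \<partial>M) = norm ?u ^ k / Gamma (\<beta> * real k + 1)" for k
    unfolding norm_f integral_mult_right_zero using Y_moment[of k] by (simp add: has_bochner_integral_iff)
  have "(\<lambda>k. \<integral>\<omega>. ?f k \<omega> \<partial>M) sums (\<integral>\<omega>. (\<Sum>k. ?f k \<omega>) \<partial>M)"
  proof (rule sums_integral[OF int])
    show "AE \<omega> in M. summable (\<lambda>k. norm (?f k \<omega>))"
    proof (rule AE_I2)
      fix \<omega>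
      have "(\<lambda>k. (norm ?u * Y \<omega>) ^ k /\<^sub>R fact k) sums exp (norm ?u * Y \<omega>)" by (rule exp_converges)
      then show "summable (\<lambda>k. norm (?f k \<omega>))"
        unfolding norm_f by (simp add: sums_iff power_mult_distrib divide_inverse mult_ac)
    qed
    show "summable (\<lambda>k. \<integral>\<omega>. norm (?f k \<omega>) \<partial>M)"
      unfolding intnorm using \<beta> by (intro summable_mittag_leffler) auto
  qed
  moreover have "(\<Sum>k. ?f k \<omega>) = exp (- (z * cpx (t powr \<beta> * Y \<omega>)))" for \<omega>
    using ser by (rule sums_unique[symmetric])
  ultimately show ?thesis unfolding intval ml_def by simp
qed

lemma ml1_sums:
  "(\<lambda>k. (- z * cpx (t powr \<beta>)) ^ k * cpx (real (Suc k) / Gamma (\<beta> * real (Suc k) + 1))) sums ml1 z t"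
proof -
  let ?u = "- z * cpx (t powr \<beta>)"
  let ?f = "\<lambda>k \<omega>. (?u ^ k / fact k) * cpx (Y \<omega> ^ Suc k)"
  have ser: "(\<lambda>k. ?f k \<omega>) sums (cpx (Y \<omega>) * exp (- (z * cpx (t powr \<beta> * Y \<omega>))))" for \<omega>
  proof -
    have eq: "- (z * cpx (t powr \<beta> * Y \<omega>)) = ?u * cpx (Y \<omega>)" by simp
    have "?f k \<omega> = cpx (Y \<omega>) * ((?u * cpx (Y \<omega>)) ^ k /\<^sub>R fact k)" for k
      by (simp only: power_mult_distrib power_Suc of_real_mult of_real_power scaleR_conv_of_real of_real_inverse of_real_fact divide_inverse mult_ac)
    then show ?thesis unfolding eq using sums_mult[OF exp_converges[of "?u * cpx (Y \<omega>)"], of "cpx (Y \<omega>)"] by (simp only:)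
  qed
  have norm_f: "norm (?f k \<omega>) = (norm ?u ^ k / fact k) * Y \<omega> ^ Suc k" for k \<omega>
    using Y_nonneg[of \<omega>] by (simp only: norm_mult norm_divide norm_power norm_of_real norm_fact abs_of_nonneg zero_le_power)
  have int: "integrable M (?f k)" for k
    using Y_moment[of "Suc k"] by (intro integrable_mult_right) (simp only: complex_of_real_integrable_eq has_bochner_integral_iff)
  have fk: "fact (Suc k) / (fact k :: real) = real (Suc k)" for k by simp
  have intval: "(\<integral>\<omega>. ?f k \<omega> \<partial>M) = ?u ^ k * cpx (real (Suc k) / Gamma (\<beta> * real (Suc k) + 1))" for k
  proof -
    have "(\<integral>\<omega>. ?f k \<omega> \<partial>M) = (?u ^ k / fact k) * (\<integral>\<omega>. cpx (Y \<omega> ^ Suc k) \<partial>M)" by (rule integral_mult_right_zero)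
    also have "(\<integral>\<omega>. cpx (Y \<omega> ^ Suc k) \<partial>M) = cpx (fact (Suc k) / Gamma (\<beta> * real (Suc k) + 1))"
      using Y_moment[of "Suc k"] by (simp only: integral_complex_of_real has_bochner_integral_iff)
    also have "(?u ^ k / fact k) * cpx (fact (Suc k) / Gamma (\<beta> * real (Suc k) + 1))
       = ?u ^ k * cpx (fact (Suc k) / fact k / Gamma (\<beta> * real (Suc k) + 1))"
      by (simp only: of_real_divide of_real_mult of_real_fact times_divide_eq_left times_divide_eq_right divide_divide_eq_left mult.commute)
    finally show ?thesis unfolding fk .
  qed
  have intnorm: "(\<integral>\<omega>. norm (?f k \<omega>) \<partial>M) = norm ?u ^ k * (real (Suc k) / Gamma (\<beta> * real (Suc k) + 1))" for k
  proof -
    have "(\<integral>\<omega>. norm (?f k \<omega>) \<partial>M) = (norm ?u ^ k / fact k) * (fact (Suc k) / Gamma (\<beta> * real (Suc k) + 1))"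
      unfolding norm_f integral_mult_right_zero using Y_moment[of "Suc k"] by (simp only: has_bochner_integral_iff)
    also have "\<dots> = norm ?u ^ k * (fact (Suc k) / fact k / Gamma (\<beta> * real (Suc k) + 1))"
      by (simp only: times_divide_eq_left times_divide_eq_right divide_divide_eq_left mult.commute)
    finally show ?thesis unfolding fk .
  qed
  have "(\<lambda>k. \<integral>\<omega>. ?f k \<omega> \<partial>M) sums (\<integral>\<omega>. (\<Sum>k. ?f k \<omega>) \<partial>M)"
  proof (rule sums_integral[OF int])
    show "AE \<omega> in M. summable (\<lambda>k. norm (?f k \<omega>))"
    proof (rule AE_I2)
      fix \<omega>
      have "(\<lambda>k. Y \<omega> * ((norm ?u * Y \<omega>) ^ k /\<^sub>R fact k)) sums (Y \<omega> * exp (norm ?u * Y \<omega>))" by (intro sums_mult exp_converges)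
      then show "summable (\<lambda>k. norm (?f k \<omega>))"
        unfolding norm_f by (simp add: sums_iff power_mult_distrib divide_inverse mult_ac)
    qed
    show "summable (\<lambda>k. \<integral>\<omega>. norm (?f k \<omega>) \<partial>M)"
      unfolding intnorm using \<beta> by (intro summable_mittag_leffler_Suc) auto
  qed
  moreover have "(\<Sum>k. ?f k \<omega>) = cpx (Y \<omega>) * exp (- (z * cpx (t powr \<beta> * Y \<omega>)))" for \<omega>
    using ser by (rule sums_unique[symmetric])
  ultimately show ?thesis unfolding intval ml1_def by simp
qed

text \<open>The time derivative of \<open>ml z\<close>. It has a singularity at \<open>0\<close>, of an integrable order.\<close>

definition ml' :: "complex \<Rightarrow> real \<Rightarrow> complex" where
  "ml' z s = - z * cpx (\<beta> * s powr (\<beta> - 1)) * ml1 z s"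

text \<open>Up to the factor \<open>Gamma (1 - \<beta>)\<close> the left-hand side is the Caputo derivative of \<open>ml z\<close>. The \<open>k\<close>-th term of the
  series for \<open>ml' z s\<close> is a multiple of \<open>s powr (\<beta> k + \<beta> - 1)\<close>, and the Beta integral turns it into the \<open>k\<close>-th
  term of the series on the right.\<close>

lemma abel_integral_ml':
  assumes t: "t > 0"
  shows "(LBINT s. cpx (indicator {0<..<t} s * (t - s) powr (- \<beta>)) * ml' z s)
     = cpx (Gamma (1 - \<beta>)) * (- z * ml z t)"
proof -
  let ?b = "\<lambda>k s. indicator {0<..<t} s * ((t - s) powr ((1 - \<beta>) - 1) * (s - 0) powr ((\<beta> * real k + \<beta>) - 1))"
  let ?f = "\<lambda>k s. ((- z) ^ Suc k / cpx (Gamma (\<beta> * real k + \<beta>))) * cpx (?b k s)"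
  have gb: "Gamma (\<beta> * real k + \<beta>) > 0" for k using \<beta> by (intro Gamma_real_pos add_nonneg_pos) auto
  have bint: "has_bochner_integral lborel (?b k) (t powr (\<beta> * real k) * (Gamma (1 - \<beta>) * Gamma (\<beta> * real k + \<beta>) / Gamma (\<beta> * real k + 1)))" for k
  proof -
    have pr: "0 < 1 - \<beta>" "0 < \<beta> * real k + \<beta>" using \<beta> by (auto intro: add_nonneg_pos)
    have e: "1 - \<beta> + (\<beta> * real k + \<beta>) = \<beta> * real k + 1" by simp
    show ?thesis using beta_scaled[OF pr t] by (simp only: e diff_zero add_diff_cancel_right')
  qed
  have tk: "t powr (\<beta> * real k) = (t powr \<beta>) ^ k" for k using t by (simp add: powr_power mult.commute)
  have int: "integrable lborel (?f k)" for k
    using bint[of k] by (intro integrable_mult_right) (simp only: complex_of_real_integrable_eq has_bochner_integral_iff)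
  have b0: "?b k s \<ge> 0" for k s by simp
  have norm_f: "norm (?f k s) = (norm z ^ Suc k / Gamma (\<beta> * real k + \<beta>)) * ?b k s" for k s
    using b0[of s k] gb[of k] by (simp only: norm_mult norm_divide norm_power norm_of_real abs_of_nonneg abs_of_pos norm_minus_cancel)
  have coef: "c ^ Suc k / g * (c' ^ k * (G * g / G')) = G * (c * ((c * c') ^ k / G'))" if "g \<noteq> 0" for c c' g G G' :: complex and k
    using that by (simp add: power_mult_distrib)
  have coefr: "c ^ Suc k / g * (c' ^ k * (G * g / G')) = G * (c * ((c * c') ^ k / G'))" if "g \<noteq> 0" for c c' g G G' :: real and k
    using that by (simp add: power_mult_distrib)
  have intval: "(LBINT s. ?f k s) = cpx (Gamma (1 - \<beta>)) * (- z * ((- z * cpx (t powr \<beta>)) ^ k / cpx (Gamma (\<beta> * real k + 1))))" for k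
  proof -
    have "(LBINT s. ?f k s) = ((- z) ^ Suc k / cpx (Gamma (\<beta> * real k + \<beta>))) * (LBINT s. cpx (?b k s))"
      by (rule integral_mult_right_zero)
    also have "(LBINT s. cpx (?b k s)) = cpx (t powr \<beta>) ^ k * (cpx (Gamma (1 - \<beta>)) * cpx (Gamma (\<beta> * real k + \<beta>)) / cpx (Gamma (\<beta> * real k + 1)))"
    proof -
      have "(LBINT s. ?b k s) = (t powr \<beta>) ^ k * (Gamma (1 - \<beta>) * Gamma (\<beta> * real k + \<beta>) / Gamma (\<beta> * real k + 1))"
        using bint[of k] by (simp only: has_bochner_integral_iff tk)
      then show ?thesis unfolding integral_complex_of_real by (simp only: of_real_mult of_real_divide of_real_power)
    qed
    finally show ?thesis using gb[of k] by (subst (asm) coef) auto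
  qed
  have intnorm: "(LBINT s. norm (?f k s)) = Gamma (1 - \<beta>) * (norm z * ((norm z * t powr \<beta>) ^ k / Gamma (\<beta> * real k + 1)))" for k
  proof -
    have "(LBINT s. norm (?f k s)) = (norm z ^ Suc k / Gamma (\<beta> * real k + \<beta>)) * ((t powr \<beta>) ^ k * (Gamma (1 - \<beta>) * Gamma (\<beta> * real k + \<beta>) / Gamma (\<beta> * real k + 1)))"
      unfolding norm_f integral_mult_right_zero using bint[of k] by (simp only: has_bochner_integral_iff tk)
    then show ?thesis using gb[of k] by (subst (asm) coefr) auto
  qed
  have ser: "(\<lambda>k. ?f k s) sums (cpx (indicator {0<..<t} s * (t - s) powr (- \<beta>)) * ml' z s)" for s
  proof (cases "s \<in> {0<..<t}")
    case True
    have "(\<lambda>k. cpx ((t - s) powr (- \<beta>)) * (- z * cpx (\<beta> * s powr (\<beta> - 1)) * ((- z * cpx (s powr \<beta>)) ^ k * cpx (real (Suc k) / Gamma (\<beta> * real (Suc k) + 1)))))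
       sums (cpx ((t - s) powr (- \<beta>)) * (- z * cpx (\<beta> * s powr (\<beta> - 1)) * ml1 z s))"
      by (intro sums_mult ml1_sums)
    moreover have "cpx ((t - s) powr (- \<beta>)) * (- z * cpx (\<beta> * s powr (\<beta> - 1)) * ((- z * cpx (s powr \<beta>)) ^ k * cpx (real (Suc k) / Gamma (\<beta> * real (Suc k) + 1)))) = ?f k s" for k
    proof -
      have g: "\<beta> * (real (Suc k) / Gamma (\<beta> * real (Suc k) + 1)) = 1 / Gamma (\<beta> * real k + \<beta>)"
        using \<beta> by (intro inverse_Gamma_Suc) auto
      have sp: "s powr (\<beta> - 1) * (s powr \<beta>) ^ k = s powr ((\<beta> * real k + \<beta>) - 1)"
        using True by (simp add: powr_power mult.commute flip: powr_add) (simp add: algebra_simps)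
      have "cpx ((t - s) powr (- \<beta>)) * (- z * cpx (\<beta> * s powr (\<beta> - 1)) * ((- z * cpx (s powr \<beta>)) ^ k * cpx (real (Suc k) / Gamma (\<beta> * real (Suc k) + 1))))
        = (- z) ^ Suc k * cpx ((t - s) powr (- \<beta>) * (s powr (\<beta> - 1) * (s powr \<beta>) ^ k) * (\<beta> * (real (Suc k) / Gamma (\<beta> * real (Suc k) + 1))))"
        by (simp only: power_mult_distrib of_real_mult of_real_power power_Suc mult_ac)
      also have "\<dots> = ?f k s" unfolding g sp using True by (simp add: mult_ac)
      finally show ?thesis .
    qed
    ultimately show ?thesis using True by (simp add: ml'_def)
  qed simp
  have sum: "(\<Sum>k. ?f k s) = cpx (indicator {0<..<t} s * (t - s) powr (- \<beta>)) * ml' z s" for s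
    using ser by (rule sums_unique[symmetric])
  have "(\<lambda>k. LBINT s. ?f k s) sums (LBINT s. (\<Sum>k. ?f k s))"
  proof (rule sums_integral[OF int])
    show "summable (\<lambda>k. LBINT s. norm (?f k s))"
      unfolding intnorm using \<beta> by (intro summable_mult summable_mittag_leffler) auto
    show "AE s in lborel. summable (\<lambda>k. norm (?f k s))"
    proof (rule AE_I2)
      fix s
      show "summable (\<lambda>k. norm (?f k s))"
      proof (cases "s \<in> {0<..<t}")
        case True
        have "norm (?f k s) = (norm z * ((t - s) powr (- \<beta>) * s powr (\<beta> - 1)) * \<beta>) * ((norm z * s powr \<beta>) ^ k * (real (Suc k) / Gamma (\<beta> * real (Suc k) + 1)))" for k
        proof -
          have g: "1 / Gamma (\<beta> * real k + \<beta>) = \<beta> * (real (Suc k) / Gamma (\<beta> * real (Suc k) + 1))"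
            using \<beta> by (intro inverse_Gamma_Suc[symmetric]) auto
          have sp: "s powr ((\<beta> * real k + \<beta>) - 1) = s powr (\<beta> - 1) * (s powr \<beta>) ^ k"
            using True by (simp add: powr_power mult.commute flip: powr_add) (simp add: algebra_simps)
          have "norm (?f k s) = norm z ^ Suc k * (1 / Gamma (\<beta> * real k + \<beta>)) * ((t - s) powr (- \<beta>) * s powr ((\<beta> * real k + \<beta>) - 1))"
            unfolding norm_f using True by simp
          then show ?thesis unfolding g sp by (simp only: power_mult_distrib power_Suc mult_ac)
        qed
        moreover have "summable (\<lambda>k. (norm z * ((t - s) powr (- \<beta>) * s powr (\<beta> - 1)) * \<beta>) * ((norm z * s powr \<beta>) ^ k * (real (Suc k) / Gamma (\<beta> * real (Suc k) + 1))))"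
          using \<beta> by (intro summable_mult summable_mittag_leffler_Suc) auto
        ultimately show ?thesis by (simp only:)
      qed simp
    qed
  qed
  then have "(\<lambda>k. cpx (Gamma (1 - \<beta>)) * (- z * ((- z * cpx (t powr \<beta>)) ^ k / cpx (Gamma (\<beta> * real k + 1))))) sums
      (LBINT s. cpx (indicator {0<..<t} s * (t - s) powr (- \<beta>)) * ml' z s)"
    unfolding intval sum .
  moreover have "(\<lambda>k. cpx (Gamma (1 - \<beta>)) * (- z * ((- z * cpx (t powr \<beta>)) ^ k / cpx (Gamma (\<beta> * real k + 1))))) sums
      (cpx (Gamma (1 - \<beta>)) * (- z * ml z t))"
    by (intro sums_mult ml_sums)
  ultimately show ?thesis by (rule sums_unique2)
qed

lemma borel_measurable_ml [measurable (raw)]: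
  assumes [measurable]: "f \<in> borel_measurable N" "g \<in> borel_measurable N"
  shows "(\<lambda>x. ml (f x) (g x)) \<in> borel_measurable N"
  unfolding ml_def by measurable

lemma borel_measurable_ml1 [measurable (raw)]:
  assumes [measurable]: "f \<in> borel_measurable N" "g \<in> borel_measurable N"
  shows "(\<lambda>x. ml1 (f x) (g x)) \<in> borel_measurable N"
  unfolding ml1_def by measurable

lemma borel_measurable_ml' [measurable (raw)]:
  assumes [measurable]: "f \<in> borel_measurable N" "g \<in> borel_measurable N"
  shows "(\<lambda>x. ml' (f x) (g x)) \<in> borel_measurable N"
  unfolding ml'_def by measurable

lemma norm_ml'_le:
  assumes "Re z \<ge> 0"
  shows "norm (ml' z s) \<le> norm z * (s powr (\<beta> - 1)) * (\<beta> / Gamma (\<beta> + 1))"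
proof -
  have "norm (ml' z s) = norm z * (\<beta> * s powr (\<beta> - 1)) * norm (ml1 z s)"
    using \<beta> by (simp add: ml'_def norm_mult)
  also have "\<dots> \<le> norm z * (\<beta> * s powr (\<beta> - 1)) * (1 / Gamma (\<beta> + 1))"
    using \<beta> by (intro mult_left_mono norm_ml1_le assms) auto
  finally show ?thesis by (simp add: mult_ac)
qed

lemma powr_mono_half:
  assumes "s > 0" "p \<in> {s / 2<..}"
  shows "p powr (\<beta> - 1) \<le> (s / 2) powr (\<beta> - 1)"
  using assms \<beta> by (intro powr_mono2') auto

text \<open>The majorant must not involve the singularity at \<open>0\<close>, hence the neighbourhood \<open>{s / 2<..}\<close> of \<open>s\<close>.\<close>

lemma has_derivative_ml:
  assumes z: "Re z \<ge> 0" and s: "s > 0"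
  shows "((\<lambda>s. ml z s) has_derivative (\<lambda>v. v *\<^sub>R ml' z s)) (at s)"
proof -
  let ?f = "\<lambda>p \<omega>. exp (- (z * cpx (p powr \<beta> * Y \<omega>)))"
  let ?d = "\<lambda>p \<omega>. - z * cpx (\<beta> * p powr (\<beta> - 1)) * (cpx (Y \<omega>) * ?f p \<omega>)"
  let ?B = "norm z * (\<beta> * (s / 2) powr (\<beta> - 1))"
  have "((\<lambda>p. \<integral>\<omega>. ?f p \<omega> \<partial>M) has_derivative (\<lambda>v. \<integral>\<omega>. v *\<^sub>R ?d s \<omega> \<partial>M)) (at s)"
  proof (rule has_derivative_integral[where S = "{s / 2<..}" and g = "\<lambda>\<omega>. ?B * Y \<omega>" and f' = "\<lambda>p \<omega> v. v *\<^sub>R ?d p \<omega>"])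
    show "integrable M (\<lambda>\<omega>. ?B * Y \<omega>)" by (intro integrable_mult_right integrable_Y)
    fix p \<omega> assume p: "p \<in> {s / 2<..}"
    then have p0: "p > 0" using s by simp
    show "integrable M (?f p)" by (rule integrable_ml[OF z])
    show "((\<lambda>p. ?f p \<omega>) has_derivative (\<lambda>v. v *\<^sub>R ?d p \<omega>)) (at p)"
      using p0 by (intro has_derivative_eq_rhs[OF has_derivative_cexp])
        (auto intro!: derivative_eq_intros simp: scaleR_conv_of_real powr_diff fun_eq_iff)
    show "onorm (\<lambda>v. v *\<^sub>R ?d p \<omega>) \<le> ?B * Y \<omega>"
    proof (rule onorm_le)
      fix v :: real
      have "norm (?d p \<omega>) = norm z * (\<beta> * p powr (\<beta> - 1)) * (Y \<omega> * norm (?f p \<omega>))"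
        using \<beta> Y_nonneg[of \<omega>] by (simp only: norm_mult norm_minus_cancel norm_of_real abs_of_nonneg) simp
      also have "\<dots> \<le> norm z * (\<beta> * (s / 2) powr (\<beta> - 1)) * (Y \<omega> * 1)"
        using \<beta> Y_nonneg[of \<omega>] by (intro mult_mono mult_left_mono powr_mono_half[OF s p] norm_exp_le_one[OF z]) auto
      finally have "norm (?d p \<omega>) \<le> ?B * Y \<omega>" by (simp only: mult_1_right)
      then have "\<bar>v\<bar> * norm (?d p \<omega>) \<le> \<bar>v\<bar> * (?B * Y \<omega>)" by (rule mult_left_mono) simp
      then show "norm (v *\<^sub>R ?d p \<omega>) \<le> ?B * Y \<omega> * norm v" by (simp only: norm_scaleR real_norm_def mult.commute)
    qed
  qed (use s in auto)
  moreover have "(\<integral>\<omega>. v *\<^sub>R ?d s \<omega> \<partial>M) = v *\<^sub>R ml' z s" for v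
    unfolding ml'_def ml1_def integral_scaleR_right integral_mult_right_zero ..
  ultimately show ?thesis unfolding ml_def by (simp only:)
qed

text \<open>For each \<open>\<xi>\<close> the function \<open>ml (\<Lambda> \<xi>)\<close> has Caputo derivative \<open>- \<Lambda> \<xi> * ml (\<Lambda> \<xi>)\<close>. Integration over \<open>\<xi>\<close> commutes
  with the Caputo derivative because the time derivative of \<open>ml (\<Lambda> \<xi>)\<close> is bounded by a multiple of
  \<open>norm (\<Lambda> \<xi>) * s powr (\<beta> - 1)\<close> and \<open>\<Lambda> \<xi> * q \<xi>\<close> is integrable.\<close>

theorem caputo_superposition:
  fixes q \<Lambda> :: "'b::euclidean_space \<Rightarrow> complex"
  assumes q: "integrable lborel q" and \<Lambda>_meas [measurable]: "\<Lambda> \<in> borel_measurable borel" and \<Lambda>: "\<And>\<xi>. Re (\<Lambda> \<xi>) \<ge> 0"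
    and q\<Lambda>: "integrable lborel (\<lambda>\<xi>. \<Lambda> \<xi> * q \<xi>)" and t: "t > 0"
  shows "has_caputo_derivative \<beta> (\<lambda>s. LBINT \<xi>. q \<xi> * ml (\<Lambda> \<xi>) s) (- (LBINT \<xi>. \<Lambda> \<xi> * q \<xi> * ml (\<Lambda> \<xi>) t)) t"
proof -
  let ?F = "\<lambda>s. LBINT \<xi>. q \<xi> * ml (\<Lambda> \<xi>) s"
  let ?F' = "\<lambda>s. LBINT \<xi>. q \<xi> * ml' (\<Lambda> \<xi>) s"
  define m where "m = \<beta> / Gamma (\<beta> + 1)"
  have m: "m > 0" using \<beta> Gamma_pos[of 1] by (simp add: m_def)
  have [measurable]: "q \<in> borel_measurable borel" using q by auto
  have F': "(?F has_vector_derivative ?F' s) (at s)" if s: "s > 0" for s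
  proof -
    let ?B = "(s / 2) powr (\<beta> - 1) * m"
    have "(?F has_derivative (\<lambda>v. LBINT \<xi>. v *\<^sub>R (q \<xi> * ml' (\<Lambda> \<xi>) s))) (at s)"
    proof (rule has_derivative_integral[where S = "{s / 2<..}" and g = "\<lambda>\<xi>. ?B * norm (\<Lambda> \<xi> * q \<xi>)" and f' = "\<lambda>p \<xi> v. v *\<^sub>R (q \<xi> * ml' (\<Lambda> \<xi>) p)"])
      show "(\<lambda>\<xi>. v *\<^sub>R (q \<xi> * ml' (\<Lambda> \<xi>) s)) \<in> borel_measurable lborel" for v by measurable
      show "integrable lborel (\<lambda>\<xi>. ?B * norm (\<Lambda> \<xi> * q \<xi>))" by (intro integrable_mult_right integrable_norm q\<Lambda>)
      fix p \<xi> assume p: "p \<in> {s / 2<..}"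
      then have p0: "p > 0" using s by simp
      show "integrable lborel (\<lambda>\<xi>. q \<xi> * ml (\<Lambda> \<xi>) p)"
      proof (rule Bochner_Integration.integrable_bound[OF q])
        show "AE \<xi> in lborel. norm (q \<xi> * ml (\<Lambda> \<xi>) p) \<le> norm (q \<xi>)"
          unfolding norm_mult by (intro AE_I2 mult_left_le norm_ml_le \<Lambda>) auto
      qed measurable
      show "((\<lambda>p. q \<xi> * ml (\<Lambda> \<xi>) p) has_derivative (\<lambda>v. v *\<^sub>R (q \<xi> * ml' (\<Lambda> \<xi>) p))) (at p)"
        using has_derivative_mult_right[OF has_derivative_ml[OF \<Lambda> p0], of "q \<xi>"] by simp
      show "onorm (\<lambda>v. v *\<^sub>R (q \<xi> * ml' (\<Lambda> \<xi>) p)) \<le> ?B * norm (\<Lambda> \<xi> * q \<xi>)"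
      proof (rule onorm_le)
        fix v :: real
        have "norm (ml' (\<Lambda> \<xi>) p) \<le> norm (\<Lambda> \<xi>) * (p powr (\<beta> - 1)) * m"
          unfolding m_def by (rule norm_ml'_le[OF \<Lambda>])
        also have "\<dots> \<le> norm (\<Lambda> \<xi>) * ((s / 2) powr (\<beta> - 1)) * m"
          using m by (intro mult_right_mono mult_left_mono powr_mono_half[OF s p]) auto
        finally have "\<bar>v\<bar> * (norm (q \<xi>) * norm (ml' (\<Lambda> \<xi>) p)) \<le> \<bar>v\<bar> * (norm (q \<xi>) * (norm (\<Lambda> \<xi>) * ((s / 2) powr (\<beta> - 1)) * m))"
          by (intro mult_left_mono) auto
        then show "norm (v *\<^sub>R (q \<xi> * ml' (\<Lambda> \<xi>) p)) \<le> ?B * norm (\<Lambda> \<xi> * q \<xi>) * norm v"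
          by (simp only: norm_scaleR norm_mult real_norm_def mult_ac)
      qed
    qed (use s in auto)
    then show ?thesis by (simp add: has_vector_derivative_def)
  qed
  have vd: "vector_derivative ?F (at s) = ?F' s" if "s > 0" for s
    using F'[OF that] by (rule vector_derivative_at)

  let ?u = "\<lambda>s. cpx (indicator {0<..<t} s * ((t - s) powr (- \<beta>) * s powr (\<beta> - 1)))"
  \<comment> \<open>Division by \<open>m\<close> makes this a kernel bounded by \<open>1\<close>; the factor \<open>m\<close> is moved to the function of \<open>\<xi>\<close>.\<close>
  let ?k = "\<lambda>(s, \<xi>). - cpx \<beta> * ml1 (\<Lambda> \<xi>) s / cpx m"
  have "integrable (lborel \<Otimes>\<^sub>M lborel) (\<lambda>(s, \<xi>). ?u s * (cpx m * (\<Lambda> \<xi> * q \<xi>)) * ?k (s, \<xi>))"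
  proof (rule lborel_pair.integrable_mult_kernel)
    show "integrable lborel ?u"
      unfolding complex_of_real_integrable_eq
      using beta_scaled[of "1 - \<beta>" \<beta> 0 t] \<beta> t by (simp add: has_bochner_integral_iff)
    show "integrable lborel (\<lambda>\<xi>. cpx m * (\<Lambda> \<xi> * q \<xi>))" by (intro integrable_mult_right q\<Lambda>)
    show "?k \<in> borel_measurable (lborel \<Otimes>\<^sub>M lborel)" by measurable
    show "norm (?k (s, \<xi>)) \<le> 1" for s \<xi>
    proof -
      have "\<beta> * norm (ml1 (\<Lambda> \<xi>) s) \<le> \<beta> * (1 / Gamma (\<beta> + 1))"
        using \<beta> by (intro mult_left_mono norm_ml1_le \<Lambda>) auto
      then have "\<beta> * norm (ml1 (\<Lambda> \<xi>) s) \<le> m" by (simp add: m_def)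
      then show ?thesis using m \<beta> by (simp add: norm_mult norm_divide)
    qed
  qed
  also have "(\<lambda>(s, \<xi>). ?u s * (cpx m * (\<Lambda> \<xi> * q \<xi>)) * ?k (s, \<xi>)) =
     (\<lambda>(s, \<xi>). q \<xi> * (cpx (indicator {0<..<t} s * (t - s) powr (- \<beta>)) * ml' (\<Lambda> \<xi>) s))"
    using m by (auto simp: fun_eq_iff ml'_def split: split_indicator)
  finally have int: "integrable (lborel \<Otimes>\<^sub>M lborel) (\<lambda>(s, \<xi>). q \<xi> * (cpx (indicator {0<..<t} s * (t - s) powr (- \<beta>)) * ml' (\<Lambda> \<xi>) s))" .
  have eq: "indicator {0<..<t} s *\<^sub>R (vector_derivative ?F (at s) /\<^sub>R ((t - s) powr \<beta>)) =
      (LBINT \<xi>. q \<xi> * (cpx (indicator {0<..<t} s * (t - s) powr (- \<beta>)) * ml' (\<Lambda> \<xi>) s))" for s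
  proof (cases "s \<in> {0<..<t}")
    case True
    have "(LBINT \<xi>. q \<xi> * (cpx (indicator {0<..<t} s * (t - s) powr (- \<beta>)) * ml' (\<Lambda> \<xi>) s))
      = (LBINT \<xi>. cpx ((t - s) powr (- \<beta>)) * (q \<xi> * ml' (\<Lambda> \<xi>) s))"
      using True by (simp add: mult_ac)
    also have "\<dots> = cpx ((t - s) powr (- \<beta>)) * ?F' s" by (rule integral_mult_right_zero)
    finally show ?thesis using True vd[of s] by (simp add: scaleR_conv_of_real powr_minus)
  qed simp
  have "integrable lborel (\<lambda>s. LBINT \<xi>. q \<xi> * (cpx (indicator {0<..<t} s * (t - s) powr (- \<beta>)) * ml' (\<Lambda> \<xi>) s))"
    by (rule lborel_pair.integrable_fst[OF int])
  then have si: "set_integrable lborel {0<..<t} (\<lambda>s. vector_derivative ?F (at s) /\<^sub>R ((t - s) powr \<beta>))"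
    unfolding set_integrable_def eq .
  have "(LINT s:{0<..<t}|lborel. vector_derivative ?F (at s) /\<^sub>R ((t - s) powr \<beta>))
     = (LBINT s. (LBINT \<xi>. q \<xi> * (cpx (indicator {0<..<t} s * (t - s) powr (- \<beta>)) * ml' (\<Lambda> \<xi>) s)))"
    unfolding set_lebesgue_integral_def eq ..
  also have "\<dots> = (LBINT \<xi>. (LBINT s. q \<xi> * (cpx (indicator {0<..<t} s * (t - s) powr (- \<beta>)) * ml' (\<Lambda> \<xi>) s)))"
    by (rule lborel_pair.Fubini_integral[OF int, symmetric])
  also have "\<dots> = (LBINT \<xi>. q \<xi> * (cpx (Gamma (1 - \<beta>)) * (- \<Lambda> \<xi> * ml (\<Lambda> \<xi>) t)))"
    unfolding integral_mult_right_zero abel_integral_ml'[OF t] ..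
  also have "\<dots> = (LBINT \<xi>. - cpx (Gamma (1 - \<beta>)) * (\<Lambda> \<xi> * q \<xi> * ml (\<Lambda> \<xi>) t))"
    by (intro Bochner_Integration.integral_cong) auto
  also have "\<dots> = - cpx (Gamma (1 - \<beta>)) * (LBINT \<xi>. \<Lambda> \<xi> * q \<xi> * ml (\<Lambda> \<xi>) t)"
    by (rule integral_mult_right_zero)
  finally have val: "(LINT s:{0<..<t}|lborel. vector_derivative ?F (at s) /\<^sub>R ((t - s) powr \<beta>))
     = - cpx (Gamma (1 - \<beta>)) * (LBINT \<xi>. \<Lambda> \<xi> * q \<xi> * ml (\<Lambda> \<xi>) t)" .
  have "Gamma (1 - \<beta>) > 0" using \<beta> by (intro Gamma_real_pos) auto
  then have "- (LBINT \<xi>. \<Lambda> \<xi> * q \<xi> * ml (\<Lambda> \<xi>) t) = (1 / Gamma (1 - \<beta>)) *\<^sub>R (LINT s:{0<..<t}|lborel. vector_derivative ?F (at s) /\<^sub>R ((t - s) powr \<beta>))"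
    unfolding val by (simp add: scaleR_conv_of_real)
  moreover have "\<forall>s\<in>{0<..<t}. ?F differentiable (at s)"
    by (intro ballI differentiableI_vector[OF F']) auto
  ultimately show ?thesis unfolding has_caputo_derivative_def using si by blast
qed

text \<open>\<open>ml z s\<close> tends to \<open>1\<close> and is bounded by \<open>1\<close>, so dominated convergence applies twice.\<close>

theorem superposition_initial:
  fixes q \<Lambda> :: "'b::euclidean_space \<Rightarrow> complex"
  assumes q: "integrable lborel q" and \<Lambda>_meas [measurable]: "\<Lambda> \<in> borel_measurable borel" and \<Lambda>: "\<And>\<xi>. Re (\<Lambda> \<xi>) \<ge> 0"
  shows "((\<lambda>s. LBINT \<xi>. q \<xi> * ml (\<Lambda> \<xi>) s) \<longlongrightarrow> (LBINT \<xi>. q \<xi>)) (at_right 0)"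
proof -
  have [measurable]: "q \<in> borel_measurable borel" using q by auto
  have ml_lim: "((\<lambda>s. ml z s) \<longlongrightarrow> 1) (at_right 0)" if z: "Re z \<ge> 0" for z
  proof -
    have "((\<lambda>s. ml z s) \<longlongrightarrow> (\<integral>\<omega>. 1 \<partial>M)) (at_right 0)"
      unfolding ml_def
    proof (rule dominated_convergence_within[where g = "\<lambda>_. 1"])
      show "AE \<omega> in M. ((\<lambda>s. exp (- (z * cpx (s powr \<beta> * Y \<omega>)))) \<longlongrightarrow> 1) (at_right 0)"
      proof (rule AE_I2)
        fix \<omega>
        have "((\<lambda>s::real. s powr \<beta>) \<longlongrightarrow> 0 powr \<beta>) (at_right 0)"
          using \<beta> by (intro tendsto_powr' tendsto_intros) (auto simp: eventually_at_right_less eventually_at_filter)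
        then have "((\<lambda>s. exp (- (z * cpx (s powr \<beta> * Y \<omega>)))) \<longlongrightarrow> exp (- (z * cpx (0 powr \<beta> * Y \<omega>)))) (at_right 0)"
          by (intro tendsto_exp tendsto_minus tendsto_mult tendsto_of_real tendsto_const)
        then show "((\<lambda>s. exp (- (z * cpx (s powr \<beta> * Y \<omega>)))) \<longlongrightarrow> 1) (at_right 0)" by simp
      qed
    qed (auto simp: Y_nonneg z)
    then show ?thesis by (simp add: prob_space)
  qed
  show ?thesis
  proof (rule dominated_convergence_within[OF _ _ integrable_norm[OF q]])
    show "AE \<xi> in lborel. ((\<lambda>s. q \<xi> * ml (\<Lambda> \<xi>) s) \<longlongrightarrow> q \<xi>) (at_right 0)"
      using tendsto_mult[OF tendsto_const ml_lim[OF \<Lambda>]] by (auto intro!: AE_I2)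
    show "AE \<xi> in lborel. norm (q \<xi> * ml (\<Lambda> \<xi>) s) \<le> norm (q \<xi>)" for s
      unfolding norm_mult by (intro AE_I2 mult_left_le norm_ml_le \<Lambda>) auto
  qed measurable
qed

end

section \<open>Stable subordinators and the law of the inverse process\<close>

lemma (in prob_space) integrable_exp_neg:
  assumes [measurable]: "X \<in> borel_measurable M" and "AE \<omega> in M. X \<omega> \<ge> 0" and "\<xi> \<ge> (0::real)"
  shows "integrable M (\<lambda>\<omega>. exp (- \<xi> * X \<omega>))"
  by (rule integrable_const_bound[where B = 1]) (use assms in \<open>auto elim!: eventually_mono\<close>)

lemma stable_subordinatorD:
  assumes "stable_subordinator \<alpha> M H"
  shows "prob_space M" "\<And>t. t \<ge> 0 \<Longrightarrow> H t \<in> borel_measurable M" "AE \<omega> in M. H 0 \<omega> = 0"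
    "AE \<omega> in M. mono_on {0..} (\<lambda>t. H t \<omega>)"
    "\<And>t \<xi>. t \<ge> 0 \<Longrightarrow> \<xi> \<ge> 0 \<Longrightarrow> (LINT \<omega>|M. exp (- \<xi> * H t \<omega>)) = exp (- t * \<xi> powr \<alpha>)"
  using assms by (auto simp: stable_subordinator_def levy_process_def)

lemma subordinator_nonneg:
  assumes H: "stable_subordinator \<alpha> M H" and t: "t \<ge> 0"
  shows "AE \<omega> in M. H t \<omega> \<ge> 0"
  using stable_subordinatorD(3,4)[OF H]
proof eventually_elim
  fix \<omega> assume "H 0 \<omega> = 0" "mono_on {0..} (\<lambda>t. H t \<omega>)"
  then show "H t \<omega> \<ge> 0" using t mono_onD[of "{0..}" "\<lambda>t. H t \<omega>" 0 t] by simp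
qed

text \<open>Chernoff's bound with the Laplace transform of \<open>H t\<close>.\<close>

lemma subordinator_le_prob:
  assumes H: "stable_subordinator \<alpha> M H" and t: "t \<ge> 0" and \<xi>: "\<xi> \<ge> 0"
  shows "measure M {\<omega> \<in> space M. H t \<omega> \<le> c} \<le> exp (\<xi> * c - t * \<xi> powr \<alpha>)"
proof -
  interpret prob_space M by (rule stable_subordinatorD[OF H])
  have [measurable]: "H t \<in> borel_measurable M" by (rule stable_subordinatorD(2)[OF H t])
  have "measure M {\<omega> \<in> space M. H t \<omega> \<le> c} = (\<integral>\<omega>. indicator {\<omega> \<in> space M. H t \<omega> \<le> c} \<omega> \<partial>M)" by simp
  also have "\<dots> \<le> (\<integral>\<omega>. exp (\<xi> * c) * exp (- \<xi> * H t \<omega>) \<partial>M)"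
  proof (rule integral_mono)
    show "integrable M (\<lambda>\<omega>. exp (\<xi> * c) * exp (- \<xi> * H t \<omega>))"
      by (intro integrable_mult_right integrable_exp_neg subordinator_nonneg[OF H t] \<xi>) measurable
    show "indicator {\<omega> \<in> space M. H t \<omega> \<le> c} \<omega> \<le> exp (\<xi> * c) * exp (- \<xi> * H t \<omega>)" for \<omega>
      using \<xi> mult_left_mono[of "H t \<omega>" c \<xi>] by (auto split: split_indicator simp flip: exp_add)
  qed (auto simp: less_top[symmetric])
  also have "\<dots> = exp (\<xi> * c) * exp (- t * \<xi> powr \<alpha>)"
    unfolding integral_mult_right_zero stable_subordinatorD(5)[OF H t \<xi>] ..
  also have "\<dots> = exp (\<xi> * c - t * \<xi> powr \<alpha>)" by (simp flip: exp_add)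
  finally show ?thesis .
qed

text \<open>For \<open>c = 0\<close> Chernoff's bound is \<open>exp (- t * \<xi> powr \<alpha>)\<close> with \<open>\<xi>\<close> arbitrary.\<close>

lemma subordinator_pos:
  assumes H: "stable_subordinator \<alpha> M H" and t: "t > 0" and \<alpha>: "\<alpha> > 0"
  shows "AE \<omega> in M. H t \<omega> > 0"
proof -
  interpret prob_space M by (rule stable_subordinatorD[OF H])
  have [measurable]: "H t \<in> borel_measurable M" using t by (intro stable_subordinatorD[OF H]) simp
  let ?A = "{\<omega> \<in> space M. H t \<omega> \<le> 0}"
  have "measure M ?A \<le> exp (- real n)" for n
  proof -
    have "measure M ?A \<le> exp (((real n / t) powr (1 / \<alpha>)) * 0 - t * ((real n / t) powr (1 / \<alpha>)) powr \<alpha>)"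
      using t by (intro subordinator_le_prob[OF H]) auto
    then show ?thesis using t \<alpha> by (simp add: powr_powr)
  qed
  moreover have "(\<lambda>n. exp (- real n)) \<longlonglongrightarrow> 0"
    by (intro filterlim_compose[OF exp_at_bot]) (simp add: filterlim_uminus_at_top[symmetric] filterlim_real_sequentially)
  ultimately have "measure M ?A \<le> 0" by (intro LIMSEQ_le_const[of "\<lambda>n. exp (- real n)" 0]) auto
  then have "prob ?A = 0" using measure_nonneg[of M ?A] by linarith
  then have "AE \<omega> in M. \<omega> \<notin> ?A" by (subst (asm) prob_eq_0) auto
  then show ?thesis by (rule AE_mp) (auto intro!: AE_I2)
qed

text \<open>Chernoff's bound at fixed \<open>\<xi> = 1\<close> tends to \<open>0\<close> as the time tends to infinity.\<close>

lemma subordinator_unbounded: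
  assumes H: "stable_subordinator \<alpha> M H"
  shows "AE \<omega> in M. \<exists>n::nat. H (real n) \<omega> > c"
proof -
  interpret prob_space M by (rule stable_subordinatorD[OF H])
  have [measurable]: "H (real n) \<in> borel_measurable M" for n by (intro stable_subordinatorD[OF H]) simp
  let ?A = "{\<omega> \<in> space M. \<forall>n::nat. H (real n) \<omega> \<le> c}"
  have "measure M ?A \<le> exp c * exp (- real n)" for n
  proof -
    have "measure M ?A \<le> measure M {\<omega> \<in> space M. H (real n) \<omega> \<le> c}" by (intro finite_measure_mono) auto
    also have "\<dots> \<le> exp (1 * c - real n * 1 powr \<alpha>)" by (intro subordinator_le_prob[OF H]) auto
    finally show ?thesis by (simp add: exp_diff exp_minus divide_inverse)
  qed
  moreover have "(\<lambda>n. exp (- real n)) \<longlonglongrightarrow> 0"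
    by (intro filterlim_compose[OF exp_at_bot]) (simp add: filterlim_uminus_at_top[symmetric] filterlim_real_sequentially)
  then have "(\<lambda>n. exp c * exp (- real n)) \<longlonglongrightarrow> exp c * 0" by (intro tendsto_intros)
  ultimately have "measure M ?A \<le> exp c * 0" by (intro LIMSEQ_le_const[of "\<lambda>n. exp c * exp (- real n)"]) auto
  then have "prob ?A = 0" using measure_nonneg[of M ?A] by linarith
  then have "AE \<omega> in M. \<omega> \<notin> ?A" by (subst (asm) prob_eq_0) auto
  then show ?thesis by (rule AE_mp) (auto intro!: AE_I2 simp: not_le)
qed

lemma subordinator_char:
  assumes H: "stable_subordinator \<alpha> M H" and t: "t \<ge> 0" and \<alpha>: "\<alpha> > 0"
  shows "(\<integral>\<omega>. iexp (y * H t \<omega>) \<partial>M) = exp (- cpx t * (- \<i> * cpx y) powr cpx \<alpha>)"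
proof -
  interpret prob_space M by (rule stable_subordinatorD[OF H])
  have [measurable]: "H t \<in> borel_measurable M" by (rule stable_subordinatorD(2)[OF H t])
  have "(\<integral>x. iexp (y * x) \<partial>distr M borel (H t)) = exp (- cpx t * (- \<i> * cpx y) powr cpx \<alpha>)"
  proof (rule char_from_laplace)
    show "prob_space (distr M borel (H t))" by (rule prob_space_distr) measurable
    show "AE x in distr M borel (H t). 0 \<le> x" using subordinator_nonneg[OF H t] by (subst AE_distr_iff) auto
    show "(\<integral>x. exp (- \<xi> * x) \<partial>distr M borel (H t)) = exp (- t * \<xi> powr \<alpha>)" if "\<xi> > 0" for \<xi>
      using stable_subordinatorD(5)[OF H t, of \<xi>] that by (subst integral_distr) auto
  qed (use \<alpha> in auto)
  then show ?thesis by (subst (asm) integral_distr) auto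
qed

text \<open>Equal Laplace transforms give equal characteristic functions by \<open>char_from_laplace\<close>, and these determine the law.\<close>

lemma subordinator_scaling:
  assumes H: "stable_subordinator \<alpha> M H" and t: "t > 0" and \<alpha>: "\<alpha> > 0"
  shows "distr M borel (H t) = distr M borel (\<lambda>\<omega>. t powr (1 / \<alpha>) * H 1 \<omega>)"
proof -
  interpret prob_space M by (rule stable_subordinatorD[OF H])
  have [measurable]: "H t \<in> borel_measurable M" "H 1 \<in> borel_measurable M" using t by (auto intro: stable_subordinatorD[OF H])
  let ?c = "t powr (1 / \<alpha>)"
  have "(\<integral>x. iexp (y * x) \<partial>distr M borel (\<lambda>\<omega>. ?c * H 1 \<omega>)) = exp (- cpx t * (- \<i> * cpx y) powr cpx \<alpha>)" for y
  proof (rule char_from_laplace)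
    show "prob_space (distr M borel (\<lambda>\<omega>. ?c * H 1 \<omega>))" by (rule prob_space_distr) measurable
    show "AE x in distr M borel (\<lambda>\<omega>. ?c * H 1 \<omega>). 0 \<le> x"
      using subordinator_nonneg[OF H, of 1] by (subst AE_distr_iff) (auto elim!: eventually_mono)
    show "(\<integral>x. exp (- \<xi> * x) \<partial>distr M borel (\<lambda>\<omega>. ?c * H 1 \<omega>)) = exp (- t * \<xi> powr \<alpha>)" if "\<xi> > 0" for \<xi>
    proof -
      have "(\<integral>x. exp (- \<xi> * x) \<partial>distr M borel (\<lambda>\<omega>. ?c * H 1 \<omega>)) = (\<integral>\<omega>. exp (- (\<xi> * ?c) * H 1 \<omega>) \<partial>M)"
        by (subst integral_distr) (auto simp: mult_ac)
      also have "\<dots> = exp (- 1 * (\<xi> * ?c) powr \<alpha>)" using that by (intro stable_subordinatorD(5)[OF H]) auto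
      also have "(\<xi> * ?c) powr \<alpha> = t * \<xi> powr \<alpha>" using that t \<alpha> by (simp add: powr_mult powr_powr)
      finally show ?thesis by simp
    qed
  qed (use \<alpha> in auto)
  moreover have "(\<integral>x. iexp (y * x) \<partial>distr M borel (H t)) = exp (- cpx t * (- \<i> * cpx y) powr cpx \<alpha>)" for y
    using subordinator_char[OF H _ \<alpha>, of t y] t by (subst integral_distr) auto
  ultimately show ?thesis
    by (intro Levy_uniqueness) (auto simp: char_def fun_eq_iff intro!: real_distribution_distr)
qed

lemma powr_less_iff_base:
  fixes a x y :: real
  assumes "0 < a" "0 < x" "0 < y"
  shows "x powr a < y powr a \<longleftrightarrow> x < y"
  using assms powr_less_cancel2 powr_less_mono2 less_imp_le by metis

text \<open>On a nondecreasing, positive and unbounded path the set in the definition of the inverse is an upper set of times,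
  nonempty and without negative elements, so its infimum behaves as a passage time. Positivity at the times
  \<open>1 / Suc n\<close> suffices by monotonicity; it is a countable family of almost sure conditions.\<close>

lemma inverse_process_bounds:
  assumes t: "t > 0" and x: "x > 0" and mono: "mono_on {0..} (\<lambda>t. K t \<omega>)"
    and pos: "\<And>n::nat. K (1 / real (Suc n)) \<omega> > 0" and unb: "K (real m) \<omega> > t"
  shows "inverse_process K t \<omega> \<ge> 0" "inverse_process K t \<omega> > x \<Longrightarrow> K x \<omega> < t"
    "K x \<omega> < t \<Longrightarrow> inverse_process K t \<omega> \<ge> x"
proof -
  let ?A = "{s. 0 < s \<and> K s \<omega> \<notin> {0<..<t}}"
  have p: "K s \<omega> > 0" if s: "s > 0" for s
  proof -
    obtain n where "1 / real (Suc n) < s" by (rule nat_approx_posE[OF s])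
    then have "K (1 / real (Suc n)) \<omega> \<le> K s \<omega>" using s by (intro mono_onD[OF mono]) auto
    then show ?thesis using pos[of n] by linarith
  qed
  have "K s \<omega> \<notin> {0<..<t} \<longleftrightarrow> t \<le> K s \<omega>" if "s > 0" for s
    using p[OF that] by auto
  then have A: "?A = {s. 0 < s \<and> t \<le> K s \<omega>}" by (intro Collect_cong conj_cong refl)
  have "K (real (Suc m)) \<omega> \<ge> K (real m) \<omega>" by (intro mono_onD[OF mono]) auto
  then have ne: "real (Suc m) \<in> ?A" unfolding A using unb by auto
  have bdd: "bdd_below ?A" by (rule bdd_belowI[of _ 0]) auto
  show "inverse_process K t \<omega> \<ge> 0" unfolding inverse_process_def
  proof (rule cInf_greatest)
    show "?A \<noteq> {}" using ne by blast
  qed simp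
  show "K x \<omega> < t" if "inverse_process K t \<omega> > x"
  proof (rule ccontr)
    assume "\<not> K x \<omega> < t"
    then have "x \<in> ?A" unfolding A using x by auto
    then have "inverse_process K t \<omega> \<le> x" unfolding inverse_process_def by (rule cInf_lower[OF _ bdd])
    with that show False by simp
  qed
  show "inverse_process K t \<omega> \<ge> x" if "K x \<omega> < t"
    unfolding inverse_process_def
  proof (rule cInf_greatest)
    show "?A \<noteq> {}" using ne by blast
    fix s assume "s \<in> ?A"
    then have s: "0 < s" "t \<le> K s \<omega>" unfolding A by auto
    show "x \<le> s"
    proof (rule ccontr)
      assume "\<not> x \<le> s"
      then have "K s \<omega> \<le> K x \<omega>" using s by (intro mono_onD[OF mono]) auto
      with s that show False by simp
    qed
  qed
qed

text \<open>For \<open>x > 0\<close> the events \<open>L\<^sub>t > x\<close> and \<open>K\<^sub>x < t\<close> agree up to the event \<open>L\<^sub>t = x\<close>, which is null because \<open>L\<^sub>t\<close> has a density.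
  By self-similarity \<open>K\<^sub>x < t\<close> is as likely as \<open>x powr (1 / \<beta>) * K\<^sub>1 < t\<close>, that is, \<open>t powr \<beta> * K\<^sub>1 powr (- \<beta>) > x\<close>. The
  absolute value only fixes a nonnegative version on the null set where \<open>K\<^sub>1\<close> is not positive.\<close>

theorem inverse_process_law:
  assumes K: "stable_subordinator \<beta> M K" and \<beta>: "\<beta> > 0" and t: "t > 0"
    and dens: "distributed M lborel (inverse_process K t) f"
  shows "distr M borel (inverse_process K t) = distr M borel (\<lambda>\<omega>. t powr \<beta> * \<bar>K 1 \<omega>\<bar> powr (- \<beta>))"
proof -
  interpret prob_space M by (rule stable_subordinatorD[OF K])
  let ?L = "inverse_process K t" and ?Z = "\<lambda>\<omega>. t powr \<beta> * \<bar>K 1 \<omega>\<bar> powr (- \<beta>)"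
  have L_meas [measurable]: "?L \<in> borel_measurable M" using distributed_measurable[OF dens] by simp
  have K_meas: "K s \<in> borel_measurable M" if "s \<ge> 0" for s by (rule stable_subordinatorD(2)[OF K that])
  have [measurable]: "K 1 \<in> borel_measurable M" by (rule K_meas) simp
  have pos1: "AE \<omega> in M. K 1 \<omega> > 0" by (rule subordinator_pos[OF K _ \<beta>]) simp
  have good: "AE \<omega> in M. mono_on {0..} (\<lambda>t. K t \<omega>) \<and> (\<forall>n::nat. K (1 / real (Suc n)) \<omega> > 0) \<and> (\<exists>n::nat. K (real n) \<omega> > t)"
    unfolding AE_conj_iff AE_all_countable
    by (intro conjI allI stable_subordinatorD(4)[OF K] subordinator_pos[OF K _ \<beta>] subordinator_unbounded[OF K]) simp
  have good_bounds: "?L \<omega> \<ge> 0" "\<And>x. x > 0 \<Longrightarrow> ?L \<omega> > x \<Longrightarrow> K x \<omega> < t" "\<And>x. x > 0 \<Longrightarrow> K x \<omega> < t \<Longrightarrow> ?L \<omega> \<ge> x"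
    if g: "mono_on {0..} (\<lambda>t. K t \<omega>) \<and> (\<forall>n::nat. K (1 / real (Suc n)) \<omega> > 0) \<and> (\<exists>n::nat. K (real n) \<omega> > t)" for \<omega>
  proof -
    from g obtain m :: nat where m: "K (real m) \<omega> > t" by blast
    have mono: "mono_on {0..} (\<lambda>t. K t \<omega>)" and pos: "\<And>n::nat. K (1 / real (Suc n)) \<omega> > 0" using g by (blast, blast)
    show "?L \<omega> \<ge> 0" by (rule inverse_process_bounds(1)[of t 1 K \<omega> m, OF t zero_less_one mono pos m])
    show "K x \<omega> < t" if "x > 0" "?L \<omega> > x" for x by (rule inverse_process_bounds(2)[of t x K \<omega> m, OF t that(1) mono pos m that(2)])
    show "?L \<omega> \<ge> x" if "x > 0" "K x \<omega> < t" for x by (rule inverse_process_bounds(3)[of t x K \<omega> m, OF t that(1) mono pos m that(2)])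
  qed
  have L_nonneg: "AE \<omega> in M. ?L \<omega> \<ge> 0"
    using good by eventually_elim (rule good_bounds(1))
  have atom: "measure M {\<omega> \<in> space M. ?L \<omega> = x} = 0" for x
  proof -
    have [measurable]: "f \<in> borel_measurable borel" using distributed_borel_measurable[OF dens] by simp
    have "emeasure M {\<omega> \<in> space M. ?L \<omega> = x} = emeasure M (?L -` {x} \<inter> space M)" by (intro arg_cong2[where f = emeasure]) auto
    also have "\<dots> = (\<integral>\<^sup>+y. f y * indicator {x} y \<partial>lborel)" by (rule distributed_emeasure[OF dens]) simp
    also have "\<dots> = (\<integral>\<^sup>+(y::real). 0 \<partial>lborel)"
    proof (rule nn_integral_cong_AE)
      have "AE y in lborel. y \<noteq> x" by (rule AE_lborel_singleton)
      then show "AE y in lborel. f y * indicator {x} y = 0" by eventually_elim auto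
    qed
    finally show ?thesis by (simp add: measure_def)
  qed
  have tail: "measure M {\<omega> \<in> space M. ?L \<omega> > x} = measure M {\<omega> \<in> space M. ?Z \<omega> > x}" if x: "x > 0" for x
  proof -
    have [measurable]: "K x \<in> borel_measurable M" using x by (intro K_meas) simp
    have 1: "measure M {\<omega> \<in> space M. ?L \<omega> > x} \<le> measure M {\<omega> \<in> space M. K x \<omega> < t}"
    proof (rule finite_measure_mono_AE)
      show "AE \<omega> in M. \<omega> \<in> {\<omega> \<in> space M. ?L \<omega> > x} \<longrightarrow> \<omega> \<in> {\<omega> \<in> space M. K x \<omega> < t}"
        using good
      proof eventually_elim
        fix \<omega> assume g: "mono_on {0..} (\<lambda>t. K t \<omega>) \<and> (\<forall>n::nat. K (1 / real (Suc n)) \<omega> > 0) \<and> (\<exists>n::nat. K (real n) \<omega> > t)"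
        show "\<omega> \<in> {\<omega> \<in> space M. ?L \<omega> > x} \<longrightarrow> \<omega> \<in> {\<omega> \<in> space M. K x \<omega> < t}"
          using good_bounds(2)[OF g x] by auto
      qed
    qed measurable
    have "measure M {\<omega> \<in> space M. K x \<omega> < t} \<le> measure M ({\<omega> \<in> space M. ?L \<omega> > x} \<union> {\<omega> \<in> space M. ?L \<omega> = x})"
    proof (rule finite_measure_mono_AE)
      show "AE \<omega> in M. \<omega> \<in> {\<omega> \<in> space M. K x \<omega> < t} \<longrightarrow> \<omega> \<in> {\<omega> \<in> space M. ?L \<omega> > x} \<union> {\<omega> \<in> space M. ?L \<omega> = x}"
        using good
      proof eventually_elim
        fix \<omega> assume g: "mono_on {0..} (\<lambda>t. K t \<omega>) \<and> (\<forall>n::nat. K (1 / real (Suc n)) \<omega> > 0) \<and> (\<exists>n::nat. K (real n) \<omega> > t)"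
        show "\<omega> \<in> {\<omega> \<in> space M. K x \<omega> < t} \<longrightarrow> \<omega> \<in> {\<omega> \<in> space M. ?L \<omega> > x} \<union> {\<omega> \<in> space M. ?L \<omega> = x}"
          using good_bounds(3)[OF g x] by auto
      qed
    qed measurable
    also have "\<dots> \<le> measure M {\<omega> \<in> space M. ?L \<omega> > x} + measure M {\<omega> \<in> space M. ?L \<omega> = x}"
      by (rule measure_Un_le) measurable
    finally have "measure M {\<omega> \<in> space M. ?L \<omega> > x} = measure M {\<omega> \<in> space M. K x \<omega> < t}" using 1 atom[of x] by linarith
    also have "\<dots> = measure (distr M borel (K x)) {..<t}"
      by (subst measure_distr) (auto intro!: arg_cong2[where f = measure])
    also have "\<dots> = measure (distr M borel (\<lambda>\<omega>. x powr (1 / \<beta>) * K 1 \<omega>)) {..<t}"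
      unfolding subordinator_scaling[OF K x \<beta>] ..
    also have "\<dots> = measure M {\<omega> \<in> space M. x powr (1 / \<beta>) * K 1 \<omega> < t}"
      by (subst measure_distr) (auto intro!: arg_cong2[where f = measure])
    also have "\<dots> = measure M {\<omega> \<in> space M. ?Z \<omega> > x}"
    proof (rule measure_eq_AE)
      show "AE \<omega> in M. (\<omega> \<in> {\<omega> \<in> space M. x powr (1 / \<beta>) * K 1 \<omega> < t}) = (\<omega> \<in> {\<omega> \<in> space M. ?Z \<omega> > x})"
        using pos1
      proof eventually_elim
        fix \<omega> assume k: "K 1 \<omega> > 0"
        have "x powr (1 / \<beta>) * K 1 \<omega> < t \<longleftrightarrow> (x powr (1 / \<beta>) * K 1 \<omega>) powr \<beta> < t powr \<beta>"
          using k x t \<beta> by (intro powr_less_iff_base[symmetric]) auto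
        also have "(x powr (1 / \<beta>) * K 1 \<omega>) powr \<beta> = x * K 1 \<omega> powr \<beta>"
          using k x \<beta> by (simp add: powr_mult powr_powr)
        also have "x * K 1 \<omega> powr \<beta> < t powr \<beta> \<longleftrightarrow> x < ?Z \<omega>"
          using k by (simp add: powr_minus field_simps)
        finally show "(\<omega> \<in> {\<omega> \<in> space M. x powr (1 / \<beta>) * K 1 \<omega> < t}) = (\<omega> \<in> {\<omega> \<in> space M. ?Z \<omega> > x})" by auto
      qed
    qed measurable
    finally show ?thesis .
  qed
  \<comment> \<open>Both variables are almost surely positive, so that the distribution functions vanish for \<open>x \<le> 0\<close>.\<close>
  have cdf_eq: "cdf (distr M borel ?L) x = cdf (distr M borel ?Z) x" for x
  proof (cases "x > 0")
    case True
    have c: "cdf (distr M borel V) x = 1 - measure M {\<omega> \<in> space M. V \<omega> > x}" if [measurable]: "V \<in> borel_measurable M" for V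
    proof -
      have "cdf (distr M borel V) x = measure M {\<omega> \<in> space M. \<not> V \<omega> > x}"
        by (simp add: cdf_def measure_distr) (auto intro!: arg_cong2[where f = measure])
      also have "\<dots> = 1 - measure M {\<omega> \<in> space M. V \<omega> > x}" by (rule prob_neg) measurable
      finally show ?thesis .
    qed
    have "?Z \<in> borel_measurable M" by measurable
    from c[OF L_meas] c[OF this] tail[OF True] show ?thesis by simp
  next
    case False
    have c: "cdf (distr M borel V) x = 0" if [measurable]: "V \<in> borel_measurable M" and "AE \<omega> in M. V \<omega> > 0" for V
    proof -
      have "cdf (distr M borel V) x = measure M {\<omega> \<in> space M. V \<omega> \<le> x}"
        by (simp add: cdf_def measure_distr) (auto intro!: arg_cong2[where f = measure])
      also have "\<dots> = 0"
      proof (subst prob_eq_0)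
        show "AE \<omega> in M. \<omega> \<notin> {\<omega> \<in> space M. V \<omega> \<le> x}" using that(2) by eventually_elim (use False in auto)
      qed measurable
      finally show ?thesis .
    qed
    have "AE \<omega> in M. \<omega> \<notin> {\<omega> \<in> space M. ?L \<omega> = 0}" using atom[of 0] by (subst (asm) prob_eq_0) auto
    then have "AE \<omega> in M. ?L \<omega> \<noteq> 0" using AE_space by eventually_elim auto
    with L_nonneg have "AE \<omega> in M. ?L \<omega> > 0" by eventually_elim auto
    moreover have "AE \<omega> in M. ?Z \<omega> > 0" using pos1 by eventually_elim (use t in auto)
    moreover have "?Z \<in> borel_measurable M" by measurable
    ultimately show ?thesis using c L_meas by metis
  qed
  show ?thesis
    by (rule cdf_unique') (auto simp: cdf_eq fun_eq_iff intro!: real_distribution.finite_borel_measure_M real_distribution_distr)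
qed

lemma nn_integral_exp_tail:
  fixes c :: real
  shows "(\<integral>\<^sup>+v. ennreal (indicator {c<..} v * exp (- v)) \<partial>lborel) = ennreal (exp (- c))"
proof -
  have "(\<integral>\<^sup>+v. ennreal (indicator {c<..} v * exp (- v)) \<partial>lborel)
     = ennreal \<bar>1\<bar> * (\<integral>\<^sup>+v. ennreal (indicator {c<..} (c + 1 * v) * exp (- (c + 1 * v))) \<partial>lborel)"
    by (rule nn_integral_real_affine) auto
  also have "\<dots> = (\<integral>\<^sup>+v. ennreal (exp (- c)) * ennreal (indicator {0<..} v * (v powr (1 - 1) * exp (- 1 * v))) \<partial>lborel)"
    by (auto intro!: nn_integral_cong split: split_indicator simp: exp_diff exp_minus divide_inverse simp flip: ennreal_mult)
  also have "\<dots> = ennreal (exp (- c)) * ennreal (Gamma 1 * 1 powr (- 1))"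
    by (subst nn_integral_cmult) (auto simp: nn_integral_gamma_scaled[of 1 1, simplified])
  finally show ?thesis by simp
qed

text \<open>Writing \<open>exp (- (u powr \<beta>))\<close> as the integral of \<open>exp (- v)\<close> over \<open>v > u powr \<beta>\<close> and exchanging the integrals reduces
  the claim to the Gamma integral, without a nonlinear change of variables.\<close>

lemma nn_integral_stretched_exp:
  fixes \<beta> :: real
  assumes \<beta>: "\<beta> > 0" and k: "k > 0"
  shows "(\<integral>\<^sup>+u. ennreal (indicator {0<..} u * u powr (\<beta> * real k - 1)) * ennreal (exp (- (u powr \<beta>))) \<partial>lborel) = ennreal (fact k / (\<beta> * real k))"
proof -
  define p where "p = \<beta> * real k"
  have p: "p > 0" using \<beta> k by (simp add: p_def)
  have "(\<integral>\<^sup>+u. ennreal (indicator {0<..} u * u powr (p - 1)) * ennreal (exp (- (u powr \<beta>))) \<partial>lborel)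
     = (\<integral>\<^sup>+u. (\<integral>\<^sup>+v. ennreal (indicator {0<..} u * u powr (p - 1)) * ennreal ((if u powr \<beta> < v then 1 else 0) * exp (- v)) \<partial>lborel) \<partial>lborel)"
  proof (intro nn_integral_cong)
    fix u :: real
    have "(\<lambda>v. ennreal ((if u powr \<beta> < v then 1 else 0) * exp (- v))) = (\<lambda>v. ennreal (indicator {u powr \<beta><..} v * exp (- v)))"
      by (auto simp: fun_eq_iff)
    then have "(\<integral>\<^sup>+v. ennreal ((if u powr \<beta> < v then 1 else 0) * exp (- v)) \<partial>lborel) = ennreal (exp (- (u powr \<beta>)))"
      by (simp only: nn_integral_exp_tail)
    then show "ennreal (indicator {0<..} u * u powr (p - 1)) * ennreal (exp (- (u powr \<beta>))) =
        (\<integral>\<^sup>+v. ennreal (indicator {0<..} u * u powr (p - 1)) * ennreal ((if u powr \<beta> < v then 1 else 0) * exp (- v)) \<partial>lborel)"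
      by (subst nn_integral_cmult) auto
  qed
  also have "\<dots> = (\<integral>\<^sup>+v. (\<integral>\<^sup>+u. ennreal (indicator {0<..} u * u powr (p - 1)) * ennreal ((if u powr \<beta> < v then 1 else 0) * exp (- v)) \<partial>lborel) \<partial>lborel)"
    by (rule lborel_pair.Fubini') measurable
  also have "\<dots> = (\<integral>\<^sup>+v. ennreal (1 / p) * ennreal (indicator {0<..} v * (v powr ((real k + 1) - 1) * exp (- 1 * v))) \<partial>lborel)"
  proof (intro nn_integral_cong)
    fix v :: real
    show "(\<integral>\<^sup>+u. ennreal (indicator {0<..} u * u powr (p - 1)) * ennreal ((if u powr \<beta> < v then 1 else 0) * exp (- v)) \<partial>lborel)
      = ennreal (1 / p) * ennreal (indicator {0<..} v * (v powr ((real k + 1) - 1) * exp (- 1 * v)))"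
    proof (cases "v > 0")
      case True
      have iff: "u powr \<beta> < v \<longleftrightarrow> u < v powr (1 / \<beta>)" if "u > 0" for u
      proof -
        have "(v powr (1 / \<beta>)) powr \<beta> = v" using True \<beta> by (simp add: powr_powr)
        then have "u powr \<beta> < v \<longleftrightarrow> u powr \<beta> < (v powr (1 / \<beta>)) powr \<beta>" by simp
        also have "\<dots> \<longleftrightarrow> u < v powr (1 / \<beta>)" using that \<beta> True by (intro powr_less_iff_base) auto
        finally show ?thesis .
      qed
      have "(\<integral>\<^sup>+u. ennreal (indicator {0<..} u * u powr (p - 1)) * ennreal ((if u powr \<beta> < v then 1 else 0) * exp (- v)) \<partial>lborel)
        = (\<integral>\<^sup>+u. ennreal (exp (- v)) * ennreal (indicator {0<..<v powr (1 / \<beta>)} u * ((v powr (1 / \<beta>) - u) powr (1 - 1) * (u - 0) powr (p - 1))) \<partial>lborel)"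
        using iff by (intro nn_integral_cong) (auto split: split_indicator simp: mult.commute)
      also have "\<dots> = ennreal (exp (- v)) * ennreal ((v powr (1 / \<beta>) - 0) powr (1 + p - 1) * (Gamma 1 * Gamma p / Gamma (1 + p)))"
        using True p by (subst nn_integral_cmult, measurable, subst nn_integral_beta_scaled) auto
      also have "Gamma 1 * Gamma p / Gamma (1 + p) = 1 / p"
      proof -
        have "p \<notin> \<int>\<^sub>\<le>\<^sub>0" using p by (auto elim!: nonpos_Ints_cases)
        then have "Gamma (p + 1) = p * Gamma p" by (rule Gamma_plus1)
        moreover have "Gamma p \<noteq> 0" using Gamma_real_pos[OF p] by (rule less_imp_neq[symmetric])
        ultimately show ?thesis using p by (simp add: add.commute)
      qed
      also have "(v powr (1 / \<beta>) - 0) powr (1 + p - 1) = v powr real k" using True \<beta> by (simp add: powr_powr p_def)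
      finally show ?thesis using True p by (simp add: mult_ac flip: ennreal_mult)
    next
      case False
      then have "\<not> u powr \<beta> < v" for u using powr_ge_zero[of u \<beta>] by linarith
      then show ?thesis using False by simp
    qed
  qed
  also have "\<dots> = ennreal (1 / p) * ennreal (Gamma (real k + 1) * 1 powr (- (real k + 1)))"
    by (subst nn_integral_cmult, measurable, subst nn_integral_gamma_scaled) auto
  also have "\<dots> = ennreal (fact k / p)"
    using p Gamma_fact[of k, where 'a = real] by (simp add: add.commute flip: ennreal_mult)
  finally show ?thesis by (simp add: p_def)
qed

text \<open>For \<open>k > 0\<close> and \<open>p = \<beta> k\<close>, \<open>Gamma p * x powr (- p)\<close> is the integral of \<open>u powr (p - 1) * exp (- u x)\<close>. Taking \<open>x = K\<^sub>1\<close>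
  and expectations turns the exponential into \<open>exp (- (u powr \<beta>))\<close>, and the remaining integral is \<open>k! / p\<close>.\<close>

theorem subordinator_inverse_power_moments:
  assumes K: "stable_subordinator \<beta> M K" and \<beta>: "\<beta> \<in> {0<..<1}"
  shows "mittag_leffler_variable M (\<lambda>\<omega>. \<bar>K 1 \<omega>\<bar> powr (- \<beta>)) \<beta>"
proof -
  interpret prob_space M by (rule stable_subordinatorD[OF K])
  have [measurable]: "K 1 \<in> borel_measurable M" by (rule stable_subordinatorD[OF K]) simp
  have pos1: "AE \<omega> in M. K 1 \<omega> > 0" by (rule subordinator_pos[OF K]) (use \<beta> in auto)
  show ?thesis
  proof
    fix k :: nat
    show "(\<integral>\<^sup>+\<omega>. ennreal ((\<bar>K 1 \<omega>\<bar> powr (- \<beta>)) ^ k) \<partial>M) = ennreal (fact k / Gamma (\<beta> * real k + 1))"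
    proof (cases "k = 0")
      case True
      then show ?thesis by (simp add: emeasure_space_1)
    next
      case False
      define p where "p = \<beta> * real k"
      have p: "p > 0" using \<beta> False by (simp add: p_def)
      let ?g = "\<lambda>u. ennreal (indicator {0<..} u * u powr (p - 1))"
      have "ennreal (Gamma p) * (\<integral>\<^sup>+\<omega>. ennreal ((\<bar>K 1 \<omega>\<bar> powr (- \<beta>)) ^ k) \<partial>M)
        = (\<integral>\<^sup>+\<omega>. ennreal (Gamma p) * ennreal ((\<bar>K 1 \<omega>\<bar> powr (- \<beta>)) ^ k) \<partial>M)"
        by (rule nn_integral_cmult[symmetric]) measurable
      also have "\<dots> = (\<integral>\<^sup>+\<omega>. (\<integral>\<^sup>+u. ?g u * ennreal (exp (- u * K 1 \<omega>)) \<partial>lborel) \<partial>M)"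
      proof (rule nn_integral_cong_AE)
        show "AE \<omega> in M. ennreal (Gamma p) * ennreal ((\<bar>K 1 \<omega>\<bar> powr (- \<beta>)) ^ k) = (\<integral>\<^sup>+u. ?g u * ennreal (exp (- u * K 1 \<omega>)) \<partial>lborel)"
          using pos1
        proof eventually_elim
          fix \<omega> assume k1: "K 1 \<omega> > 0"
          have "(\<integral>\<^sup>+u. ?g u * ennreal (exp (- u * K 1 \<omega>)) \<partial>lborel) = (\<integral>\<^sup>+u. ennreal (indicator {0<..} u * (u powr (p - 1) * exp (- K 1 \<omega> * u))) \<partial>lborel)"
            by (intro nn_integral_cong) (auto split: split_indicator simp: mult_ac simp flip: ennreal_mult)
          also have "\<dots> = ennreal (Gamma p * K 1 \<omega> powr (- p))" by (rule nn_integral_gamma_scaled[OF p k1])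
          also have "K 1 \<omega> powr (- p) = (\<bar>K 1 \<omega>\<bar> powr (- \<beta>)) ^ k" using k1 by (simp add: powr_power p_def mult.commute)
          finally show "ennreal (Gamma p) * ennreal ((\<bar>K 1 \<omega>\<bar> powr (- \<beta>)) ^ k) = (\<integral>\<^sup>+u. ?g u * ennreal (exp (- u * K 1 \<omega>)) \<partial>lborel)"
            using Gamma_real_pos[OF p] by (simp add: ennreal_mult)
        qed
      qed
      also have "\<dots> = (\<integral>\<^sup>+u. (\<integral>\<^sup>+\<omega>. ?g u * ennreal (exp (- u * K 1 \<omega>)) \<partial>M) \<partial>lborel)"
      proof -
        interpret P: pair_sigma_finite lborel M ..
        have "(\<lambda>(u, \<omega>). ?g u * ennreal (exp (- u * K 1 \<omega>))) \<in> borel_measurable (lborel \<Otimes>\<^sub>M M)" by measurable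
        then show ?thesis by (rule P.Fubini')
      qed
      also have "\<dots> = (\<integral>\<^sup>+u. ?g u * ennreal (exp (- (u powr \<beta>))) \<partial>lborel)"
      proof (intro nn_integral_cong)
        fix u :: real
        show "(\<integral>\<^sup>+\<omega>. ?g u * ennreal (exp (- u * K 1 \<omega>)) \<partial>M) = ?g u * ennreal (exp (- (u powr \<beta>)))"
        proof (cases "u > 0")
          case True
          have "(\<integral>\<^sup>+\<omega>. ennreal (exp (- u * K 1 \<omega>)) \<partial>M) = ennreal (\<integral>\<omega>. exp (- u * K 1 \<omega>) \<partial>M)"
            using True subordinator_nonneg[OF K, of 1] by (intro nn_integral_eq_integral integrable_exp_neg) auto
          also have "\<dots> = ennreal (exp (- (u powr \<beta>)))" using stable_subordinatorD(5)[OF K, of 1 u] True by simp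
          finally show ?thesis by (subst nn_integral_cmult) auto
        qed simp
      qed
      also have "\<dots> = ennreal (fact k / p)" unfolding p_def by (rule nn_integral_stretched_exp) (use \<beta> False in auto)
      finally have "ennreal (1 / Gamma p) * (ennreal (Gamma p) * (\<integral>\<^sup>+\<omega>. ennreal ((\<bar>K 1 \<omega>\<bar> powr (- \<beta>)) ^ k) \<partial>M)) = ennreal (1 / Gamma p) * ennreal (fact k / p)"
        by simp
      also have "ennreal (1 / Gamma p) * (ennreal (Gamma p) * (\<integral>\<^sup>+\<omega>. ennreal ((\<bar>K 1 \<omega>\<bar> powr (- \<beta>)) ^ k) \<partial>M)) = (\<integral>\<^sup>+\<omega>. ennreal ((\<bar>K 1 \<omega>\<bar> powr (- \<beta>)) ^ k) \<partial>M)"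
        using Gamma_real_pos[OF p] by (simp flip: mult.assoc ennreal_mult)
      also have "ennreal (1 / Gamma p) * ennreal (fact k / p) = ennreal (fact k / Gamma (p + 1))"
      proof -
        have "p \<notin> \<int>\<^sub>\<le>\<^sub>0" using p by (auto elim!: nonpos_Ints_cases)
        then have "Gamma (p + 1) = p * Gamma p" by (rule Gamma_plus1)
        then show ?thesis using p Gamma_real_pos[OF p] by (simp add: mult_ac flip: ennreal_mult)
      qed
      finally show ?thesis by (simp add: p_def)
    qed
  qed (use \<beta> in auto)
qed

section \<open>Solutions on the Fourier side\<close>

text \<open>Parseval's formula, by inserting the inversion formula for \<open>\<phi>\<close>.\<close>

lemma pairing_schwartz:
  fixes u :: "'a::euclidean_space \<Rightarrow> real"
  assumes u: "integrable lborel u" and \<phi>: "schwartz \<phi>"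
  shows "pairing u \<phi> = cpx (1 / (2 * pi) ^ DIM('a)) *
    (LBINT \<xi>. fourier \<phi> \<xi> * fourier (\<lambda>x. cpx (u x)) (- \<xi>))"
proof -
  let ?c = "cpx (1 / (2 * pi) ^ DIM('a))"
  have "\<phi> = (\<lambda>x. ?c * (LBINT \<xi>. exp (- \<i> * cpx (\<xi> \<bullet> x)) * fourier \<phi> \<xi>))"
    by (rule ext) (rule fourier_inversion_schwartz[OF \<phi>])
  then have "pairing u \<phi> = pairing u (\<lambda>x. ?c * (LBINT \<xi>. exp (- \<i> * cpx (\<xi> \<bullet> x)) * fourier \<phi> \<xi>))"
    by (rule arg_cong)
  also have "\<dots> = ?c * (LBINT \<xi>. fourier \<phi> \<xi> * fourier (\<lambda>x. cpx (u x)) (- \<xi>))"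
    by (rule pairing_inverse_fourier[OF u integrable_fourier_schwartz[OF \<phi>]])
  finally show ?thesis .
qed

lemma integrable_fourier_mult_bounded:
  fixes g :: "'a::euclidean_space \<Rightarrow> complex" and u :: "'a \<Rightarrow> real"
  assumes u: "integrable lborel u" and g: "integrable lborel g"
  shows "integrable lborel (\<lambda>\<xi>. g \<xi> * fourier (\<lambda>x. cpx (u x)) (- \<xi>))"
proof -
  have uc: "integrable lborel (\<lambda>x. cpx (u x))" using u by (simp add: complex_of_real_integrable_eq)
  have [measurable]: "fourier (\<lambda>x. cpx (u x)) \<in> borel_measurable borel"
    by (rule borel_measurable_fourier[OF uc])
  have [measurable]: "g \<in> borel_measurable borel" using g by auto
  let ?N = "LBINT x. norm (cpx (u x))"
  show ?thesis
  proof (rule Bochner_Integration.integrable_bound)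
    show "integrable lborel (\<lambda>\<xi>. ?N * norm (g \<xi>))" by (intro integrable_mult_right integrable_norm g)
    show "AE \<xi> in lborel. norm (g \<xi> * fourier (\<lambda>x. cpx (u x)) (- \<xi>)) \<le> norm (?N * norm (g \<xi>))"
    proof (rule AE_I2)
      fix \<xi>
      have "norm (g \<xi>) * norm (fourier (\<lambda>x. cpx (u x)) (- \<xi>)) \<le> norm (g \<xi>) * ?N"
        by (intro mult_left_mono norm_fourier_le) auto
      also have "\<dots> \<le> norm (?N * norm (g \<xi>))" by (simp add: abs_mult mult.commute)
      finally show "norm (g \<xi> * fourier (\<lambda>x. cpx (u x)) (- \<xi>)) \<le> norm (?N * norm (g \<xi>))"
        by (simp only: norm_mult)
    qed
  qed measurable
qed

text \<open>The right-hand side of the equation in Fourier variables: each operator multiplies the transform of \<open>\<phi>\<close> by its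
  multiplier, and Parseval's formula does the rest.\<close>

theorem distr_operators_schwartz:
  fixes u :: "'a::euclidean_space \<Rightarrow> real"
  assumes u: "integrable lborel u" and \<phi>: "schwartz \<phi>" and \<theta>: "\<theta> \<in> {0<..<1}" and \<alpha>: "\<alpha> \<in> {0<..<1}" and a: "norm a = 1"
  shows "- distr_frac_laplacian \<theta> u \<phi> - distr_frac_dir_deriv \<alpha> a u \<phi> =
    - (cpx (1 / (2 * pi) ^ DIM('a)) *
      (LBINT \<xi>. symbol \<theta> \<alpha> a \<xi> * fourier \<phi> \<xi> * fourier (\<lambda>x. cpx (u x)) (- \<xi>)))"
proof -
  let ?c = "cpx (1 / (2 * pi) ^ DIM('a))"
  let ?g1 = "\<lambda>\<xi>. cpx (norm \<xi> powr (2 * \<theta>)) * fourier \<phi> \<xi>"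
  let ?g2 = "\<lambda>\<xi>. (\<i> * cpx (a \<bullet> \<xi>)) powr cpx \<alpha> * fourier \<phi> \<xi>"
  let ?u = "\<lambda>\<xi>. fourier (\<lambda>x. cpx (u x)) (- \<xi>)"
  have g1: "integrable lborel ?g1"
    by (rule integrable_fourier_schwartz_mult[OF \<phi>, where C = 1])
       (use \<theta> powr_le_one_plus_square[of _ "2 * \<theta>"] in auto)
  have g2: "integrable lborel ?g2"
    by (rule integrable_fourier_schwartz_mult[OF \<phi>, where C = 1])
       (use \<alpha> norm_powr_inner_le[OF a, of \<alpha>] in auto)
  have "frac_laplacian \<theta> \<phi> = (\<lambda>x. ?c * (LBINT \<xi>. exp (- \<i> * cpx (\<xi> \<bullet> x)) * ?g1 \<xi>))"
    unfolding frac_laplacian_def[abs_def] by simp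
  then have 1: "distr_frac_laplacian \<theta> u \<phi> = ?c * (LBINT \<xi>. ?g1 \<xi> * ?u \<xi>)"
    unfolding distr_frac_laplacian_def by (simp only: pairing_inverse_fourier[OF u g1])
  have "frac_dir_deriv \<alpha> (- a) \<phi> = (\<lambda>x. ?c * (LBINT \<xi>. exp (- \<i> * cpx (\<xi> \<bullet> x)) * ?g2 \<xi>))"
    by (rule ext) (rule frac_dir_deriv_schwartz[OF \<phi> \<alpha> a])
  then have 2: "distr_frac_dir_deriv \<alpha> a u \<phi> = ?c * (LBINT \<xi>. ?g2 \<xi> * ?u \<xi>)"
    unfolding distr_frac_dir_deriv_def by (simp only: pairing_inverse_fourier[OF u g2])
  have "(LBINT \<xi>. symbol \<theta> \<alpha> a \<xi> * fourier \<phi> \<xi> * ?u \<xi>) = (LBINT \<xi>. ?g1 \<xi> * ?u \<xi> + ?g2 \<xi> * ?u \<xi>)"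
    by (simp add: symbol_def algebra_simps)
  also have "\<dots> = (LBINT \<xi>. ?g1 \<xi> * ?u \<xi>) + (LBINT \<xi>. ?g2 \<xi> * ?u \<xi>)"
    by (intro Bochner_Integration.integral_add integrable_fourier_mult_bounded u g1 g2)
  finally show ?thesis unfolding 1 2 by (simp add: ring_distribs)
qed

text \<open>A Gaussian is, up to a constant, the transform of a Schwartz function.\<close>

lemma integrable_weight_gauss: "integrable lborel (\<lambda>y::'a::euclidean_space. (1 + (norm y)\<^sup>2) * gauss y)"
proof -
  let ?\<phi> = "\<lambda>x::'a. iexp (0 \<bullet> x) * cpx (exp (- (norm (1 *\<^sub>R x))\<^sup>2 / 2))"
  have "integrable lborel (\<lambda>\<xi>. cpx (1 + (norm \<xi>)\<^sup>2) * fourier ?\<phi> \<xi>)"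
    by (intro integrable_weight_fourier_schwartz schwartz_modulated_gauss) simp
  also have "(\<lambda>\<xi>. cpx (1 + (norm \<xi>)\<^sup>2) * fourier ?\<phi> \<xi>) =
      (\<lambda>\<xi>. cpx ((2 * pi) ^ DIM('a)) * cpx ((1 + (norm \<xi>)\<^sup>2) * gauss \<xi>))"
    by (rule ext, subst fourier_modulated_gauss(1)) (auto simp: mult_ac)
  finally have A: "integrable lborel (\<lambda>\<xi>::'a. cpx ((2 * pi) ^ DIM('a)) * cpx ((1 + (norm \<xi>)\<^sup>2) * gauss \<xi>))" .
  have "cpx ((2 * pi) ^ DIM('a)) \<noteq> 0" by simp
  then show ?thesis
    unfolding complex_of_real_integrable_eq[symmetric] by (rule iffD1[OF integrable_complex_mult_iff A])
qed

lemma solves_frac_problemD: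
  assumes "solves_frac_problem \<theta> \<alpha> \<beta> a w"
  shows "\<And>t. t > 0 \<Longrightarrow> integrable lborel (\<lambda>x. w x t)"
    "\<And>b. b > 0 \<Longrightarrow> \<exists>C. \<forall>t\<in>{0<..b}. (LINT x|lborel. \<bar>w x t\<bar>) \<le> C"
    "\<And>\<phi> t. schwartz \<phi> \<Longrightarrow> t > 0 \<Longrightarrow> has_caputo_derivative \<beta> (\<lambda>s. pairing (\<lambda>x. w x s) \<phi>)
           (- distr_frac_laplacian \<theta> (\<lambda>x. w x t) \<phi> - distr_frac_dir_deriv \<alpha> a (\<lambda>x. w x t) \<phi>) t"
    "\<And>\<phi>. schwartz \<phi> \<Longrightarrow> ((\<lambda>t. pairing (\<lambda>x. w x t) \<phi>) \<longlongrightarrow> \<phi> 0) (at_right 0)"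
  using assms unfolding solves_frac_problem_def by blast+

lemma norm_fourier_solution_le:
  "norm (fourier (\<lambda>x. cpx (w x)) \<xi>) \<le> (LINT x|lborel. \<bar>w x\<bar>)"
  using norm_fourier_le[of "\<lambda>x. cpx (w x)" \<xi>] by simp

text \<open>Multiplier and transform are continuous and grow at most quadratically, so Gaussian averages around \<open>- \<xi>0\<close>
  converge to the value there. The bound does not depend on \<open>e\<close> nor, through \<open>N\<close>, on more of \<open>u\<close> than its norm; it
  is the majorant for the limit under the time integral.\<close>

lemma symbol_fourier_gauss_limit:
  fixes u :: "'a::euclidean_space \<Rightarrow> real" and \<xi>0 :: 'a
  assumes u: "integrable lborel u" and N: "(LINT x|lborel. \<bar>u x\<bar>) \<le> N"
    and \<theta>: "\<theta> \<in> {0<..<1}" and \<alpha>: "\<alpha> \<in> {0<..<1}" and a: "norm a = 1"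
  defines "G \<equiv> \<lambda>e. LBINT y. (symbol \<theta> \<alpha> a (- \<xi>0 + e *\<^sub>R y) * fourier (\<lambda>x. cpx (u x)) (- (- \<xi>0 + e *\<^sub>R y))) * cpx (gauss y)"
  shows "(G \<longlongrightarrow> symbol \<theta> \<alpha> a (- \<xi>0) * fourier (\<lambda>x. cpx (u x)) \<xi>0) (at 0 within {0<..1})"
    and "\<And>e. e \<in> {0<..1} \<Longrightarrow> norm (G e) \<le> (LBINT y. 4 * (1 + (norm \<xi>0)\<^sup>2) * N * ((1 + (norm y)\<^sup>2) * gauss (y::'a)))"
proof -
  have uc: "integrable lborel (\<lambda>x. cpx (u x))" using u by (simp add: complex_of_real_integrable_eq)
  let ?f = "\<lambda>\<xi>. symbol \<theta> \<alpha> a \<xi> * fourier (\<lambda>x. cpx (u x)) (- \<xi>)"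
  let ?g = "\<lambda>y. 4 * (1 + (norm \<xi>0)\<^sup>2) * N * (1 + (norm y)\<^sup>2)"
  have [measurable]: "fourier (\<lambda>x. cpx (u x)) \<in> borel_measurable borel"
    by (rule borel_measurable_fourier[OF uc])
  have N0: "N \<ge> 0" by (rule order_trans[OF _ N]) simp
  have bd: "norm (?f (- \<xi>0 + e *\<^sub>R y)) \<le> ?g y" if e: "0 < e" "e \<le> 1" for e y
  proof -
    have "norm (- \<xi>0 + e *\<^sub>R y) \<le> norm \<xi>0 + norm y"
    proof -
      have "norm (- \<xi>0 + e *\<^sub>R y) \<le> norm (- \<xi>0) + norm (e *\<^sub>R y)" by (rule norm_triangle_ineq)
      also have "norm (e *\<^sub>R y) \<le> norm y" using e by (simp add: mult_left_le_one_le)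
      finally show ?thesis by simp
    qed
    then have "(norm (- \<xi>0 + e *\<^sub>R y))\<^sup>2 \<le> (norm \<xi>0 + norm y)\<^sup>2" by (intro power_mono) auto
    also have "\<dots> \<le> 2 * (norm \<xi>0)\<^sup>2 + 2 * (norm y)\<^sup>2"
      using sum_squares_bound[of "norm \<xi>0" "norm y"] by (simp add: power2_sum)
    finally have sq: "2 * (1 + (norm (- \<xi>0 + e *\<^sub>R y))\<^sup>2) \<le> 4 * (1 + (norm \<xi>0)\<^sup>2) * (1 + (norm y)\<^sup>2)"
    proof -
      have arith: "2 * (1 + q) \<le> 4 * (1 + c) * (1 + d)" if "q \<le> 2 * c + 2 * d" "0 \<le> c" "0 \<le> d" for q c d :: real
      proof -
        have "4 * (1 + c) * (1 + d) = 4 + 4 * c + 4 * d + 4 * (c * d)" by (simp add: algebra_simps)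
        moreover have "2 * (1 + q) \<le> 4 + 4 * c + 4 * d + 4 * (c * d)"
          using that mult_nonneg_nonneg[OF that(2,3)] by argo
        ultimately show ?thesis by (simp only:)
      qed
      assume "(norm (- \<xi>0 + e *\<^sub>R y))\<^sup>2 \<le> 2 * (norm \<xi>0)\<^sup>2 + 2 * (norm y)\<^sup>2"
      then show ?thesis by (rule arith) auto
    qed
    have "norm (?f (- \<xi>0 + e *\<^sub>R y)) \<le> (2 * (1 + (norm (- \<xi>0 + e *\<^sub>R y))\<^sup>2)) * N"
      unfolding norm_mult
      by (intro mult_mono norm_symbol_le[OF a \<theta> \<alpha>] order_trans[OF norm_fourier_solution_le N]) auto
    also have "\<dots> \<le> (4 * (1 + (norm \<xi>0)\<^sup>2) * (1 + (norm y)\<^sup>2)) * N" using N0 by (intro mult_right_mono sq)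
    finally show ?thesis by (simp only: mult_ac)
  qed
  have cont: "isCont ?f (- \<xi>0)"
    using \<theta> \<alpha> by (intro continuous_mult isCont_symbol isCont_o2[OF _ isCont_fourier[OF uc]] continuous_intros) auto
  have int: "integrable lborel (\<lambda>y::'a. ?g y * gauss y)"
    using integrable_mult_right[OF integrable_weight_gauss, of "4 * (1 + (norm \<xi>0)\<^sup>2) * N"] by (simp only: mult.assoc) 
  have "?f \<in> borel_measurable borel" by measurable
  from gauss_approx_identity[OF this cont bd int]
  show "(G \<longlongrightarrow> symbol \<theta> \<alpha> a (- \<xi>0) * fourier (\<lambda>x. cpx (u x)) \<xi>0) (at 0 within {0<..1})"
    unfolding G_def by simp
  fix e :: real assume e: "e \<in> {0<..1}"
  have "norm (G e) \<le> (LBINT y. norm (?f (- \<xi>0 + e *\<^sub>R y) * cpx (gauss y)))"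
    unfolding G_def by (rule integral_norm_bound)
  also have "\<dots> \<le> (LBINT y. ?g y * gauss (y::'a))"
  proof (rule integral_mono'[OF int])
    fix y :: 'a
    show "norm (?f (- \<xi>0 + e *\<^sub>R y) * cpx (gauss y)) \<le> ?g y * gauss y"
      unfolding norm_mult[of _ "cpx (gauss y)"] norm_of_real abs_of_nonneg[OF gauss_nonneg]
      using e by (intro mult_right_mono bd) auto
    show "0 \<le> ?g y * gauss y" using N0 by (intro mult_nonneg_nonneg) auto
  qed
  finally show "norm (G e) \<le> (LBINT y. 4 * (1 + (norm \<xi>0)\<^sup>2) * N * ((1 + (norm y)\<^sup>2) * gauss (y::'a)))"
    by (simp only: mult.assoc)
qed

text \<open>Tested with the modulated Gaussian of width \<open>1 / e\<close>, the equation has the right-hand side \<open>- G e s\<close>, a Gaussian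
  average of the product of symbol and transform around \<open>- \<xi>0\<close>, and the initial value is \<open>1\<close>. In the integrated
  form of the equation \<open>e\<close> can tend to \<open>0\<close>: the pairing tends to the transform at \<open>\<xi>0\<close> and \<open>G e s\<close> to the product at
  \<open>- \<xi>0\<close>. Integrability is stated as well, because differences of two such equations are formed later.\<close>

theorem solution_fourier_volterra:
  fixes w :: "'a::euclidean_space \<Rightarrow> real \<Rightarrow> real"
  assumes sol: "solves_frac_problem \<theta> \<alpha> \<beta> a w"
    and \<theta>: "\<theta> \<in> {0<..<1}" and \<alpha>: "\<alpha> \<in> {0<..<1}" and \<beta>: "\<beta> \<in> {0<..<1}" and a: "norm a = 1" and t: "t > 0"
  shows "integrable lborel (\<lambda>u. cpx (indicator {0<..<t} u * (t - u) powr (\<beta> - 1)) * fourier (\<lambda>x. cpx (w x u)) \<xi>0)"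
    and "fourier (\<lambda>x. cpx (w x t)) \<xi>0 = 1 - symbol \<theta> \<alpha> a (- \<xi>0) / cpx (Gamma \<beta>) *
      (LBINT u. cpx (indicator {0<..<t} u * (t - u) powr (\<beta> - 1)) * fourier (\<lambda>x. cpx (w x u)) \<xi>0)"
proof -
  note solD = solves_frac_problemD[OF sol]
  let ?c = "cpx (1 / (2 * pi) ^ DIM('a))"
  let ?F = "\<lambda>s. fourier (\<lambda>x. cpx (w x s)) \<xi>0"
  let ?\<Psi> = "symbol \<theta> \<alpha> a (- \<xi>0)"
  let ?k = "\<lambda>u. cpx (indicator {0<..<t} u * (t - u) powr (\<beta> - 1))"
  let ?\<phi> = "\<lambda>e x. iexp (\<xi>0 \<bullet> x) * cpx (exp (- (norm (e *\<^sub>R x))\<^sup>2 / 2))"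
  define G where "G e s = (LBINT y. (symbol \<theta> \<alpha> a (- \<xi>0 + e *\<^sub>R y) * fourier (\<lambda>x. cpx (w x s)) (- (- \<xi>0 + e *\<^sub>R y))) * cpx (gauss y))" for e s
  obtain N where N: "\<And>s. s \<in> {0<..t} \<Longrightarrow> (LINT x|lborel. \<bar>w x s\<bar>) \<le> N" using solD(2)[OF t] by blast
  define e where "e k = 1 / real (Suc k)" for k
  have e: "e k \<in> {0<..1}" "e k > 0" for k by (auto simp: e_def)
  have e_lim: "e \<longlonglongrightarrow> 0" unfolding e_def[abs_def] by (rule LIMSEQ_Suc[OF lim_1_over_n])
  have G_lim: "(\<lambda>k. G (e k) s) \<longlonglongrightarrow> ?\<Psi> * ?F s" if s: "s \<in> {0<..t}" for s
  proof -
    have "((\<lambda>e. G e s) \<longlongrightarrow> ?\<Psi> * ?F s) (at 0 within {0<..1})"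
      unfolding G_def using s by (intro symbol_fourier_gauss_limit(1) solD N \<theta> \<alpha> a) auto
    then show ?thesis
      using e e_lim unfolding tendsto_at_iff_sequentially comp_def by (auto simp: less_imp_neq[symmetric])
  qed
  define B where "B = (LBINT y. 4 * (1 + (norm \<xi>0)\<^sup>2) * N * ((1 + (norm y)\<^sup>2) * gauss (y::'a)))"
  have G_bd: "norm (G (e k) s) \<le> B" if s: "s \<in> {0<..t}" for s k
    unfolding G_def B_def using s by (intro symbol_fourier_gauss_limit(2) solD N \<theta> \<alpha> a e) auto
  have D: "- distr_frac_laplacian \<theta> (\<lambda>x. w x s) (?\<phi> (e k)) - distr_frac_dir_deriv \<alpha> a (\<lambda>x. w x s) (?\<phi> (e k)) = - G (e k) s"
    if s: "s > 0" for s k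
  proof -
    let ?f = "\<lambda>\<xi>. symbol \<theta> \<alpha> a \<xi> * fourier (\<lambda>x. cpx (w x s)) (- \<xi>)"
    have uc: "integrable lborel (\<lambda>x. cpx (w x s))" using solD(1)[OF s] by (simp add: complex_of_real_integrable_eq)
    have [measurable]: "fourier (\<lambda>x. cpx (w x s)) \<in> borel_measurable borel" by (rule borel_measurable_fourier[OF uc])
    have cc: "?c * cpx ((2 * pi) ^ DIM('a) / e k ^ DIM('a) * gauss ((\<xi> + \<xi>0) /\<^sub>R e k)) = cpx (1 / e k ^ DIM('a) * gauss ((\<xi> - - \<xi>0) /\<^sub>R e k))" for \<xi> :: 'a
      unfolding of_real_mult[symmetric] by simp
    have "?c * (LBINT \<xi>. symbol \<theta> \<alpha> a \<xi> * fourier (?\<phi> (e k)) \<xi> * fourier (\<lambda>x. cpx (w x s)) (- \<xi>))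
      = (LBINT \<xi>. ?c * (symbol \<theta> \<alpha> a \<xi> * fourier (?\<phi> (e k)) \<xi> * fourier (\<lambda>x. cpx (w x s)) (- \<xi>)))"
      by (rule integral_mult_right_zero[symmetric])
    also have "\<dots> = (LBINT \<xi>. ?f \<xi> * (?c * fourier (?\<phi> (e k)) \<xi>))" by (simp only: mult_ac)
    also have "\<dots> = (LBINT \<xi>. ?f \<xi> * cpx (1 / e k ^ DIM('a) * gauss ((\<xi> - - \<xi>0) /\<^sub>R e k)))"
      unfolding fourier_modulated_gauss(1)[OF e(2)] cc ..
    also have "\<dots> = G (e k) s" unfolding G_def by (rule integral_mult_scaled_gauss[OF e(2)]) measurable
    finally show ?thesis unfolding distr_operators_schwartz[OF solD(1)[OF s] schwartz_modulated_gauss[OF e(2)] \<theta> \<alpha> a] by simp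
  qed
  have cap: "has_caputo_derivative \<beta> (\<lambda>s. pairing (\<lambda>x. w x s) (?\<phi> (e k))) (- G (e k) s) s" if "s > 0" for s k
    using solD(3)[OF schwartz_modulated_gauss[OF e(2)[of k], of \<xi>0] that] unfolding D[OF that] .
  have init: "((\<lambda>s. pairing (\<lambda>x. w x s) (?\<phi> (e k))) \<longlongrightarrow> 1) (at_right 0)" for k
    using solD(4)[OF schwartz_modulated_gauss[OF e(2)], of \<xi>0 k] by simp
  have V: "pairing (\<lambda>x. w x t) (?\<phi> (e k)) = 1 + cpx (1 / Gamma \<beta>) * (LBINT u. ?k u * - G (e k) u)" for k
    by (rule caputo_volterra(1)[OF \<beta> cap init t])
  have Vm: "(\<lambda>u. ?k u * - G (e k) u) \<in> borel_measurable borel" for k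
    by (rule caputo_volterra(2)[OF \<beta> cap init t])
  have pair_lim: "(\<lambda>k. pairing (\<lambda>x. w x s) (?\<phi> (e k))) \<longlonglongrightarrow> ?F s" if s: "s > 0" for s
    unfolding pairing_def fourier_def
  proof (rule integral_dominated_convergence)
    have [measurable]: "(\<lambda>x. w x s) \<in> borel_measurable borel" using solD(1)[OF s] by auto
    show "integrable lborel (\<lambda>x. norm (w x s))" using solD(1)[OF s] by (rule integrable_norm)
    show "(\<lambda>x. iexp (\<xi>0 \<bullet> x) * cpx (w x s)) \<in> borel_measurable lborel" by measurable
    show "(\<lambda>x. cpx (w x s) * ?\<phi> (e k) x) \<in> borel_measurable lborel" for k by measurable
    show "AE x in lborel. (\<lambda>k. cpx (w x s) * ?\<phi> (e k) x) \<longlonglongrightarrow> iexp (\<xi>0 \<bullet> x) * cpx (w x s)"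
    proof (rule AE_I2)
      fix x
      have "(\<lambda>k. cpx (w x s) * ?\<phi> (e k) x) \<longlonglongrightarrow> cpx (w x s) * ?\<phi> 0 x"
        by (intro tendsto_mult tendsto_const tendsto_of_real tendsto_exp tendsto_divide tendsto_minus tendsto_power tendsto_norm tendsto_scaleR e_lim) simp
      then show "(\<lambda>k. cpx (w x s) * ?\<phi> (e k) x) \<longlonglongrightarrow> iexp (\<xi>0 \<bullet> x) * cpx (w x s)"
        by (simp add: mult.commute)
    qed
    show "AE x in lborel. norm (cpx (w x s) * ?\<phi> (e k) x) \<le> norm (w x s)" for k
      by (rule AE_I2) (simp add: norm_mult mult_left_le)
  qed
  have kint: "integrable lborel (\<lambda>u. indicator {0<..<t} u * (t - u) powr (\<beta> - 1))"
  proof -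
    have "integrable lborel (\<lambda>u. indicator {0<..<t} u * ((t - u) powr (\<beta> - 1) * (u - 0) powr (1 - 1)))"
      using beta_scaled[of \<beta> 1 0 t] \<beta> t by (simp add: has_bochner_integral_iff)
    also have "(\<lambda>u. indicator {0<..<t} u * ((t - u) powr (\<beta> - 1) * (u - 0) powr (1 - 1))) = (\<lambda>u. indicator {0<..<t} u * (t - u) powr (\<beta> - 1))"
      by (auto simp: fun_eq_iff split: split_indicator)
    finally show ?thesis .
  qed
  have int_lim: "(\<lambda>k. ?k u * - G (e k) u) \<longlonglongrightarrow> ?k u * - (?\<Psi> * ?F u)" for u
  proof (cases "u \<in> {0<..<t}")
    case True
    then show ?thesis by (intro tendsto_mult tendsto_const tendsto_minus G_lim) auto
  qed simp
  have bd: "norm (?k u * - G (e k) u) \<le> B * (indicator {0<..<t} u * (t - u) powr (\<beta> - 1))" for u k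
  proof (cases "u \<in> {0<..<t}")
    case True
    then have "(t - u) powr (\<beta> - 1) * norm (G (e k) u) \<le> (t - u) powr (\<beta> - 1) * B" by (intro mult_left_mono G_bd) auto
    then show ?thesis using True by (simp add: norm_mult mult_ac)
  qed simp
  \<comment> \<open>A solution need not be jointly measurable in space and time; measurability in time comes from the approximations.\<close>
  have km: "(\<lambda>u. ?k u * - (?\<Psi> * ?F u)) \<in> borel_measurable lborel"
  proof (rule borel_measurable_LIMSEQ_metric)
    show "(\<lambda>u. ?k u * - G (e k) u) \<in> borel_measurable lborel" for k using Vm[of k] by simp
    show "(\<lambda>k. ?k u * - G (e k) u) \<longlonglongrightarrow> ?k u * - (?\<Psi> * ?F u)" for u by (rule int_lim)
  qed
  have "(\<lambda>k. LBINT u. ?k u * - G (e k) u) \<longlonglongrightarrow> (LBINT u. ?k u * - (?\<Psi> * ?F u))"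
  proof (rule integral_dominated_convergence[OF km])
    show "(\<lambda>u. ?k u * - G (e k) u) \<in> borel_measurable lborel" for k using Vm[of k] by simp
    show "integrable lborel (\<lambda>u. B * (indicator {0<..<t} u * (t - u) powr (\<beta> - 1)))" by (intro integrable_mult_right kint)
    show "AE u in lborel. (\<lambda>k. ?k u * - G (e k) u) \<longlonglongrightarrow> ?k u * - (?\<Psi> * ?F u)" by (intro AE_I2 int_lim)
    show "AE u in lborel. norm (?k u * - G (e k) u) \<le> B * (indicator {0<..<t} u * (t - u) powr (\<beta> - 1))" for k by (intro AE_I2 bd)
  qed
  then have "(\<lambda>k. 1 + cpx (1 / Gamma \<beta>) * (LBINT u. ?k u * - G (e k) u)) \<longlonglongrightarrow>
      1 + cpx (1 / Gamma \<beta>) * (LBINT u. ?k u * - (?\<Psi> * ?F u))"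
    by (intro tendsto_intros)
  then have "?F t = 1 + cpx (1 / Gamma \<beta>) * (LBINT u. ?k u * - (?\<Psi> * ?F u))"
    unfolding V[symmetric] using pair_lim[OF t] LIMSEQ_unique by blast
  also have "(LBINT u. ?k u * - (?\<Psi> * ?F u)) = (LBINT u. - ?\<Psi> * (?k u * ?F u))"
    by (intro Bochner_Integration.integral_cong) auto
  also have "\<dots> = - ?\<Psi> * (LBINT u. ?k u * ?F u)" by (rule integral_mult_right_zero)
  finally show "?F t = 1 - ?\<Psi> / cpx (Gamma \<beta>) * (LBINT u. ?k u * ?F u)" by simp
  \<comment> \<open>The symbol may vanish at \<open>- \<xi>0\<close>, so the measurability of \<open>?F\<close> is obtained from the pairings, which are
    differentiable in time, and not by division.\<close>
  have Fm: "(\<lambda>u. ?k u * ?F u) \<in> borel_measurable lborel"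
  proof (rule borel_measurable_LIMSEQ_metric[of "\<lambda>k u. ?k u * pairing (\<lambda>x. w x u) (?\<phi> (e k))"])
    fix k
    let ?P = "\<lambda>u. pairing (\<lambda>x. w x u) (?\<phi> (e k))"
    have "?P differentiable (at u)" if "u \<in> {0<..<t}" for u
      using cap[of t k] t that by (auto simp: has_caputo_derivative_def)
    then have "continuous_on {0<..<t} ?P"
      by (intro continuous_at_imp_continuous_on ballI differentiable_imp_continuous_within) auto
    then have "(\<lambda>u. indicator {0<..<t} u *\<^sub>R ?P u) \<in> borel_measurable borel"
      by (intro borel_measurable_continuous_on_indicator) auto
    then have "(\<lambda>u. cpx ((t - u) powr (\<beta> - 1)) * (indicator {0<..<t} u *\<^sub>R ?P u)) \<in> borel_measurable borel"
      by measurable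
    also have "(\<lambda>u. cpx ((t - u) powr (\<beta> - 1)) * (indicator {0<..<t} u *\<^sub>R ?P u)) = (\<lambda>u. ?k u * ?P u)"
      by (auto simp: fun_eq_iff split: split_indicator)
    finally show "(\<lambda>u. ?k u * ?P u) \<in> borel_measurable lborel" by simp
  next
    fix u
    show "(\<lambda>k. ?k u * pairing (\<lambda>x. w x u) (?\<phi> (e k))) \<longlonglongrightarrow> ?k u * ?F u"
    proof (cases "u \<in> {0<..<t}")
      case True
      then show ?thesis by (intro tendsto_mult tendsto_const pair_lim) auto
    qed simp
  qed
  show "integrable lborel (\<lambda>u. ?k u * ?F u)"
  proof (rule Bochner_Integration.integrable_bound[OF _ Fm])
    show "integrable lborel (\<lambda>u. N * (indicator {0<..<t} u * (t - u) powr (\<beta> - 1)))"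
      by (intro integrable_mult_right kint)
    show "AE u in lborel. norm (?k u * ?F u) \<le> norm (N * (indicator {0<..<t} u * (t - u) powr (\<beta> - 1)))"
    proof (rule AE_I2)
      fix u
      show "norm (?k u * ?F u) \<le> norm (N * (indicator {0<..<t} u * (t - u) powr (\<beta> - 1)))"
      proof (cases "u \<in> {0<..<t}")
        case True
        have "norm (?F u) \<le> N" using True by (intro order_trans[OF norm_fourier_solution_le N]) auto
        then have "(t - u) powr (\<beta> - 1) * norm (?F u) \<le> (t - u) powr (\<beta> - 1) * \<bar>N\<bar>" by (intro mult_left_mono) auto
        then show ?thesis using True by (simp add: norm_mult abs_mult mult_ac)
      qed simp
    qed
  qed
qed

section \<open>The Fourier transform of the mixture\<close>

text \<open>\<open>has_density\<close> makes \<open>ennreal (f x t)\<close> measurable; the real-valued version follows since \<open>f x t\<close> is nonnegative.\<close>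

lemma has_densityD:
  assumes "has_density M X f" and t: "t > 0"
  shows "\<And>x. 0 \<le> f x t" "distributed M lborel (X t) (\<lambda>x. ennreal (f x t))"
    "(\<lambda>x. f x t) \<in> borel_measurable borel" "X t \<in> borel_measurable M"
    "distr M borel (X t) = density lborel (\<lambda>x. ennreal (f x t))"
proof -
  show nn: "\<And>x. 0 \<le> f x t" and d: "distributed M lborel (X t) (\<lambda>x. ennreal (f x t))"
    using assms by (auto simp: has_density_def)
  have "(\<lambda>x. ennreal (f x t)) \<in> borel_measurable lborel" using distributed_borel_measurable[OF d] .
  then have "(\<lambda>x. enn2real (ennreal (f x t))) \<in> borel_measurable lborel" by (rule borel_measurable_enn2real)
  then show "(\<lambda>x. f x t) \<in> borel_measurable borel" by (simp add: nn)
  show "X t \<in> borel_measurable M" using distributed_measurable[OF d] by simp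
  have "distr M borel (X t) = distr M lborel (X t)" by (rule distr_cong) auto
  then show "distr M borel (X t) = density lborel (\<lambda>x. ennreal (f x t))" using distributed_distr_eq_density[OF d] by simp
qed

lemma has_density_integral:
  fixes g :: "'a::euclidean_space \<Rightarrow> complex"
  assumes D: "has_density M X f" and t: "t > 0" and [measurable]: "g \<in> borel_measurable borel"
  shows "(LBINT x. cpx (f x t) * g x) = (\<integral>\<omega>. g (X t \<omega>) \<partial>M)"
proof -
  note d = has_densityD[OF D t]
  have [measurable]: "(\<lambda>x. f x t) \<in> borel_measurable borel" "X t \<in> borel_measurable M" by (rule d)+
  have "(\<integral>\<omega>. g (X t \<omega>) \<partial>M) = (\<integral>x. g x \<partial>distr M borel (X t))" by (subst integral_distr) auto
  also have "\<dots> = (LBINT x. f x t *\<^sub>R g x)" unfolding d(5) by (subst integral_density) (auto simp: d(1))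
  finally show ?thesis by (simp add: scaleR_conv_of_real)
qed

lemma has_density_total:
  assumes D: "has_density M X f" and t: "t > 0" and M: "prob_space M"
  shows "(\<integral>\<^sup>+x. ennreal (f x t) \<partial>lborel) = 1"
proof -
  interpret prob_space M by (rule M)
  note d = has_densityD[OF D t]
  have [measurable]: "(\<lambda>x. f x t) \<in> borel_measurable borel" "X t \<in> borel_measurable M" by (rule d)+
  have "emeasure (distr M borel (X t)) UNIV = 1" by (simp add: emeasure_distr emeasure_space_1)
  then show ?thesis unfolding d(5) by (simp add: emeasure_density)
qed

text \<open>A density vanishes almost everywhere off a set that carries the law. This justifies the restrictions of the
  integrals in \<open>stable_mixture\<close> to half-lines.\<close>

lemma has_density_AE_support:
  fixes X :: "real \<Rightarrow> 'w \<Rightarrow> 'a::euclidean_space"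
  assumes D: "has_density M X f" and t: "t > 0" and P: "AE \<omega> in M. P (X t \<omega>)" and [measurable]: "Measurable.pred borel P"
  shows "AE x in lborel. 0 < f x t \<longrightarrow> P x"
proof -
  note d = has_densityD[OF D t]
  have [measurable]: "(\<lambda>x. f x t) \<in> borel_measurable borel" "X t \<in> borel_measurable M" by (rule d)+
  have "AE x in distr M borel (X t). P x" using P by (subst AE_distr_iff) auto
  then show ?thesis unfolding d(5) by (subst (asm) AE_density) auto
qed

text \<open>A density is measurable jointly in space and time only for positive times; extension by \<open>0\<close> yields a function
  that is measurable on the whole product space.\<close>

definition positive_time :: "('a \<Rightarrow> real \<Rightarrow> real) \<Rightarrow> 'a \<Rightarrow> real \<Rightarrow> real" where
  "positive_time f x z = (if 0 < z then f x z else 0)"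

lemma borel_measurable_positive_time:
  fixes f :: "'a::euclidean_space \<Rightarrow> real \<Rightarrow> real"
  assumes "(\<lambda>(x, t). f x t) \<in> borel_measurable (borel \<Otimes>\<^sub>M restrict_space borel {0<..})"
  shows "(\<lambda>(x, z). positive_time f x z) \<in> borel_measurable (borel \<Otimes>\<^sub>M borel)"
proof -
  let ?S = "{p :: 'a \<times> real. 0 < snd p}"
  have S: "?S \<inter> space (borel \<Otimes>\<^sub>M borel) \<in> sets (borel \<Otimes>\<^sub>M borel)" by measurable
  have "(\<lambda>p. (fst p, snd p)) \<in> restrict_space (borel \<Otimes>\<^sub>M borel) ?S \<rightarrow>\<^sub>M (borel \<Otimes>\<^sub>M restrict_space borel {0<..} :: ('a \<times> real) measure)"
  proof (rule measurable_Pair)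
    show "fst \<in> restrict_space (borel \<Otimes>\<^sub>M borel) ?S \<rightarrow>\<^sub>M (borel :: 'a measure)" by (rule measurable_restrict_space1) measurable
    show "snd \<in> restrict_space (borel \<Otimes>\<^sub>M borel) ?S \<rightarrow>\<^sub>M restrict_space borel {0<..}"
      by (rule measurable_restrict_space2) (auto simp: space_restrict_space intro!: measurable_restrict_space1)
  qed
  from measurable_compose[OF this assms]
  have "(\<lambda>p. f (fst p) (snd p)) \<in> borel_measurable (restrict_space (borel \<Otimes>\<^sub>M borel) ?S)" by (simp add: case_prod_unfold)
  then have "(\<lambda>p. if p \<in> ?S then f (fst p) (snd p) else 0) \<in> borel_measurable (borel \<Otimes>\<^sub>M borel)"
    using S by (subst (asm) measurable_restrict_space_iff) auto
  then show ?thesis by (simp add: positive_time_def case_prod_beta)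
qed

lemma nonneg_orthant_measurable: "(nonneg_orthant :: (real ^ 'n) set) \<in> sets borel"
proof -
  have "(nonneg_orthant :: (real ^ 'n) set) = (\<Inter>k. {s. 0 \<le> s $ k})" by (auto simp: nonneg_orthant_def)
  moreover have "closed (\<Inter>k. {s :: real ^ 'n. 0 \<le> s $ k})"
    by (intro closed_INT ballI closed_Collect_le continuous_intros)
  ultimately show ?thesis by simp
qed

lemma lborel_integral_pair:
  fixes J :: "real \<times> real \<Rightarrow> complex"
  assumes "integrable lborel J"
  shows "(LBINT p. J p) = (LBINT z. (LBINT r. J (z, r)))"
  using lborel_pair.integral_fst[of "\<lambda>z r. J (z, r)"] assms by (simp add: lborel_prod)

locale stable_mixture_setting =
  fixes \<theta> \<alpha> \<beta> :: real
    and a :: "real ^ 'n"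
    and M :: "'w measure"
    and S :: "real \<Rightarrow> 'w \<Rightarrow> real ^ 'n"
    and H K :: "real \<Rightarrow> 'w \<Rightarrow> real"
    and T :: "real ^ 'n \<Rightarrow> real \<Rightarrow> real"
    and h l :: "real \<Rightarrow> real \<Rightarrow> real"
  assumes \<theta>: "\<theta> \<in> {0<..<1}" and \<alpha>: "\<alpha> \<in> {0<..<1}" and \<beta>: "\<beta> \<in> {0<..<1}"
    and a: "a \<in> nonneg_orthant" and norm_a: "norm a = 1"
    and S: "isotropic_stable_process \<theta> M S" and T: "has_density M S T"
    and H: "stable_subordinator \<alpha> M H" and h: "has_density M H h"
    and K: "stable_subordinator \<beta> M K" and l: "has_density M (inverse_process K) l"
begin

sublocale Y: mittag_leffler_variable M "\<lambda>\<omega>. \<bar>K 1 \<omega>\<bar> powr (- \<beta>)" \<beta>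
  by (rule subordinator_inverse_power_moments[OF K \<beta>])

text \<open>The integrand of the mixture after \<open>s = r a\<close> has been inserted; the parameters \<open>(z, r)\<close> form a pair so that
  the integral over \<open>x\<close> can be exchanged with both at once.\<close>

definition kernel :: "real \<Rightarrow> real ^ 'n \<Rightarrow> real \<times> real \<Rightarrow> real" where
  "kernel t x = (\<lambda>(z, r). positive_time T (x - r *\<^sub>R a) z * (indicator {0..} r * positive_time h r z) * (indicator {0<..} z * l z t))"

lemma h_integral:
  fixes g :: "real \<Rightarrow> complex"
  assumes z: "z > 0" and [measurable]: "g \<in> borel_measurable borel"
  shows "(LBINT r. cpx (indicator {0..} r * h r z) * g r) = (\<integral>\<omega>. g (H z \<omega>) \<partial>M)"
proof -
  have [measurable]: "(\<lambda>r. h r z) \<in> borel_measurable borel" by (rule has_densityD[OF h z])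
  have "AE r in lborel. 0 < h r z \<longrightarrow> 0 \<le> r"
    using subordinator_nonneg[OF H, of z] z by (intro has_density_AE_support[OF h z]) auto
  then have "AE r in lborel. cpx (indicator {0..} r * h r z) * g r = cpx (h r z) * g r"
    by eventually_elim (use has_densityD(1)[OF h z] in \<open>auto simp: less_le split: split_indicator\<close>)
  then have "(LBINT r. cpx (indicator {0..} r * h r z) * g r) = (LBINT r. cpx (h r z) * g r)"
    by (intro integral_cong_AE) auto
  then show ?thesis using has_density_integral[OF h z] by simp
qed

lemma h_total:
  assumes z: "z > 0"
  shows "(\<integral>\<^sup>+r. ennreal (indicator {0..} r * h r z) \<partial>lborel) = 1"
proof -
  have "AE r in lborel. 0 < h r z \<longrightarrow> 0 \<le> r"
    using subordinator_nonneg[OF H, of z] z by (intro has_density_AE_support[OF h z]) auto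
  then have "AE r in lborel. ennreal (indicator {0..} r * h r z) = ennreal (h r z)"
    by eventually_elim (use has_densityD(1)[OF h z] in \<open>auto simp: less_le split: split_indicator\<close>)
  then have "(\<integral>\<^sup>+r. ennreal (indicator {0..} r * h r z) \<partial>lborel) = (\<integral>\<^sup>+r. ennreal (h r z) \<partial>lborel)"
    by (rule nn_integral_cong_AE)
  then show ?thesis using has_density_total[OF h z Y.prob_space_axioms] by simp
qed

lemma inverse_law:
  assumes t: "t > 0"
  shows "distr M borel (inverse_process K t) = distr M borel (\<lambda>\<omega>. t powr \<beta> * \<bar>K 1 \<omega>\<bar> powr (- \<beta>))"
  using \<beta> by (intro inverse_process_law[OF K _ t has_densityD(2)[OF l t]]) auto

lemma K1_measurable [measurable]: "K 1 \<in> borel_measurable M"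
  by (rule stable_subordinatorD[OF K]) simp

lemma inverse_positive:
  assumes t: "t > 0"
  shows "AE \<omega> in M. inverse_process K t \<omega> > 0"
proof -
  have [measurable]: "inverse_process K t \<in> borel_measurable M" by (rule has_densityD[OF l t])
  have "AE \<omega> in M. K 1 \<omega> > 0" using \<beta> by (intro subordinator_pos[OF K]) auto
  then have "AE \<omega> in M. t powr \<beta> * \<bar>K 1 \<omega>\<bar> powr (- \<beta>) > 0" by eventually_elim (use t in auto)
  then have "AE x in distr M borel (\<lambda>\<omega>. t powr \<beta> * \<bar>K 1 \<omega>\<bar> powr (- \<beta>)). x > 0" by (subst AE_distr_iff) auto
  then have "AE x in distr M borel (inverse_process K t). x > 0" unfolding inverse_law[OF t] .
  then show ?thesis by (subst (asm) AE_distr_iff) auto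
qed

text \<open>The inverse process is replaced by \<open>t powr \<beta> * Y\<close> already here; from this point on time enters only through the
  factor \<open>t powr \<beta>\<close>.\<close>

lemma l_integral:
  fixes g :: "real \<Rightarrow> complex"
  assumes t: "t > 0" and [measurable]: "g \<in> borel_measurable borel"
  shows "(LBINT z. cpx (indicator {0<..} z * l z t) * g z) = (\<integral>\<omega>. g (t powr \<beta> * \<bar>K 1 \<omega>\<bar> powr (- \<beta>)) \<partial>M)"
proof -
  have [measurable]: "(\<lambda>r. l r t) \<in> borel_measurable borel" "inverse_process K t \<in> borel_measurable M" by (rule has_densityD[OF l t])+
  have "AE r in lborel. 0 < l r t \<longrightarrow> 0 < r"
    by (intro has_density_AE_support[OF l t inverse_positive[OF t]]) auto
  then have "AE r in lborel. cpx (indicator {0<..} r * l r t) * g r = cpx (l r t) * g r"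
    by eventually_elim (use has_densityD(1)[OF l t] in \<open>auto simp: less_le split: split_indicator\<close>)
  then have "(LBINT r. cpx (indicator {0<..} r * l r t) * g r) = (LBINT r. cpx (l r t) * g r)"
    by (intro integral_cong_AE) auto
  also have "\<dots> = (\<integral>\<omega>. g (inverse_process K t \<omega>) \<partial>M)" by (rule has_density_integral[OF l t]) measurable
  also have "\<dots> = (\<integral>x. g x \<partial>distr M borel (inverse_process K t))" by (subst integral_distr) auto
  also have "\<dots> = (\<integral>\<omega>. g (t powr \<beta> * \<bar>K 1 \<omega>\<bar> powr (- \<beta>)) \<partial>M)" unfolding inverse_law[OF t] by (subst integral_distr) auto
  finally show ?thesis .
qed

lemma l_total:
  assumes t: "t > 0"
  shows "(\<integral>\<^sup>+z. ennreal (indicator {0<..} z * l z t) \<partial>lborel) = 1"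
proof -
  have "AE r in lborel. 0 < l r t \<longrightarrow> 0 < r"
    by (intro has_density_AE_support[OF l t inverse_positive[OF t]]) auto
  then have "AE r in lborel. ennreal (indicator {0<..} r * l r t) = ennreal (l r t)"
    by eventually_elim (use has_densityD(1)[OF l t] in \<open>auto simp: less_le split: split_indicator\<close>)
  then have "(\<integral>\<^sup>+r. ennreal (indicator {0<..} r * l r t) \<partial>lborel) = (\<integral>\<^sup>+r. ennreal (l r t) \<partial>lborel)"
    by (rule nn_integral_cong_AE)
  then show ?thesis using has_density_total[OF l t Y.prob_space_axioms] by simp
qed

lemma kernel_nonneg: "t > 0 \<Longrightarrow> kernel t x p \<ge> 0"
  using has_densityD(1)[OF T] has_densityD(1)[OF h] has_densityD(1)[OF l]
  by (auto simp: kernel_def positive_time_def split: prod.splits)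

lemma kernel_measurable [measurable]:
  assumes t: "t > 0"
  shows "(\<lambda>(x, p). kernel t x p) \<in> borel_measurable (borel \<Otimes>\<^sub>M borel)"
proof -
  have [measurable]: "(\<lambda>r. l r t) \<in> borel_measurable borel" by (rule has_densityD[OF l t])
  have T': "(\<lambda>(x, z). positive_time T x z) \<in> borel_measurable (borel \<Otimes>\<^sub>M borel)"
    and h': "(\<lambda>(x, z). positive_time h x z) \<in> borel_measurable (borel \<Otimes>\<^sub>M borel)"
    using T h by (auto simp: has_density_def intro!: borel_measurable_positive_time)
  have 1: "(\<lambda>q :: (real ^ 'n) \<times> real \<times> real. (fst q - snd (snd q) *\<^sub>R a, fst (snd q))) \<in> borel \<Otimes>\<^sub>M borel \<rightarrow>\<^sub>M borel \<Otimes>\<^sub>M borel"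
    unfolding borel_prod by (intro borel_measurable_continuous_onI continuous_intros)
  have 2: "(\<lambda>q :: (real ^ 'n) \<times> real \<times> real. (snd (snd q), fst (snd q))) \<in> borel \<Otimes>\<^sub>M borel \<rightarrow>\<^sub>M borel \<Otimes>\<^sub>M borel"
    unfolding borel_prod by (intro borel_measurable_continuous_onI continuous_intros)
  have [measurable]: "(\<lambda>q :: (real ^ 'n) \<times> real \<times> real. positive_time T (fst q - snd (snd q) *\<^sub>R a) (fst (snd q))) \<in> borel_measurable (borel \<Otimes>\<^sub>M borel)"
    using measurable_compose[OF 1 T'] by simp
  have [measurable]: "(\<lambda>q :: (real ^ 'n) \<times> real \<times> real. positive_time h (snd (snd q)) (fst (snd q))) \<in> borel_measurable (borel \<Otimes>\<^sub>M borel)"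
    using measurable_compose[OF 2 h'] by simp
  have [measurable]: "(\<lambda>q :: (real ^ 'n) \<times> real \<times> real. fst (snd q)) \<in> borel \<Otimes>\<^sub>M borel \<rightarrow>\<^sub>M borel"
    "(\<lambda>q :: (real ^ 'n) \<times> real \<times> real. snd (snd q)) \<in> borel \<Otimes>\<^sub>M borel \<rightarrow>\<^sub>M borel"
    unfolding borel_prod by (intro borel_measurable_continuous_onI continuous_intros)+
  show ?thesis unfolding kernel_def case_prod_beta by measurable
qed

text \<open>The orthant contains the ray through \<open>a\<close>, so the restriction to it can be dropped on the image of the half-line.\<close>

lemma stable_mixture_eq:
  assumes t: "t > 0"
  shows "stable_mixture a T h l x t = (LBINT z. (LBINT r. kernel t x (z, r)))"
proof -
  have orth: "r *\<^sub>R a \<in> nonneg_orthant" if "r \<ge> 0" for r using a that by (auto simp: nonneg_orthant_def)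
  have inner: "(LINT s:nonneg_orthant|ray_measure a (\<lambda>r. h r z). T (x - s) z) = (LBINT r. positive_time T (x - r *\<^sub>R a) z * (indicator {0..} r * positive_time h r z))"
    if z: "z > 0" for z
  proof -
    have [measurable]: "(\<lambda>r. h r z) \<in> borel_measurable borel" "(\<lambda>x. T x z) \<in> borel_measurable borel"
      by (rule has_densityD[OF h z], rule has_densityD[OF T z])
    have [measurable]: "(nonneg_orthant :: (real ^ 'n) set) \<in> sets borel" by (rule nonneg_orthant_measurable)
    have h0: "0 \<le> indicator {0..} r * h r z" for r using has_densityD(1)[OF h z] by simp
    have d: "indicator {0..} r * ennreal (h r z) = ennreal (indicator {0..} r * h r z)" for r
      by (auto split: split_indicator)
    have "(LINT s:nonneg_orthant|ray_measure a (\<lambda>r. h r z). T (x - s) z)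
      = (\<integral>r. indicator nonneg_orthant (r *\<^sub>R a) *\<^sub>R T (x - r *\<^sub>R a) z \<partial>density lborel (\<lambda>r. indicator {0..} r * ennreal (h r z)))"
      unfolding set_lebesgue_integral_def ray_measure_def by (subst integral_distr) auto
    also have "\<dots> = (LBINT r. (indicator {0..} r * h r z) *\<^sub>R (indicator nonneg_orthant (r *\<^sub>R a) *\<^sub>R T (x - r *\<^sub>R a) z))"
      unfolding d by (subst integral_density) (auto simp: h0)
    also have "\<dots> = (LBINT r. positive_time T (x - r *\<^sub>R a) z * (indicator {0..} r * positive_time h r z))"
      using z orth by (intro Bochner_Integration.integral_cong) (auto simp: positive_time_def split: split_indicator)
    finally show ?thesis .
  qed
  show ?thesis
    unfolding stable_mixture_def set_lebesgue_integral_def[of lborel]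
  proof (intro Bochner_Integration.integral_cong refl)
    fix z :: real
    show "indicator {0<..} z *\<^sub>R ((LINT s:nonneg_orthant|ray_measure a (\<lambda>r. h r z). T (x - s) z) * l z t) = (LBINT r. kernel t x (z, r))"
    proof (cases "z > 0")
      case True
      have "(LBINT r. kernel t x (z, r)) = (LBINT r. positive_time T (x - r *\<^sub>R a) z * (indicator {0..} r * positive_time h r z)) * (indicator {0<..} z * l z t)"
        unfolding kernel_def prod.case by (rule integral_mult_left_zero)
      then show ?thesis using True inner[OF True] by simp
    qed (simp add: kernel_def)
  qed
qed

lemma T_shift_total:
  assumes z: "z > 0"
  shows "(\<integral>\<^sup>+x. ennreal (T (x - v) z) \<partial>lborel) = 1"
proof -
  have [measurable]: "(\<lambda>x. T x z) \<in> borel_measurable borel" by (rule has_densityD[OF T z])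
  have "(\<integral>\<^sup>+x. ennreal (T x z) \<partial>lborel) = (\<integral>\<^sup>+x. ennreal (T x z) \<partial>distr lborel borel (\<lambda>x. x - v))"
  proof -
    have "(\<lambda>x. x - v) = (+) (- v)" by auto
    then show ?thesis by (simp only: lborel_distr_plus)
  qed
  also have "\<dots> = (\<integral>\<^sup>+x. ennreal (T (x - v) z) \<partial>lborel)" by (subst nn_integral_distr) auto
  finally show ?thesis using has_density_total[OF T z Y.prob_space_axioms] by simp
qed

text \<open>All three factors are probability densities in \<open>x\<close>, \<open>r\<close> and \<open>z\<close>, integrated in this order.\<close>

lemma kernel_total:
  assumes t: "t > 0"
  shows "(\<integral>\<^sup>+p. (\<integral>\<^sup>+x. ennreal (kernel t x p) \<partial>lborel) \<partial>lborel) = 1"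
proof -
  have [measurable]: "(\<lambda>r. l r t) \<in> borel_measurable borel" by (rule has_densityD[OF l t])
  have l0: "0 \<le> l z t" for z by (rule has_densityD(1)[OF l t])
  have inner: "(\<integral>\<^sup>+x. ennreal (kernel t x (z, r)) \<partial>lborel) = ennreal (indicator {0<..} z * l z t) * ennreal (indicator {0..} r * positive_time h r z)" for z r
  proof (cases "z > 0")
    case True
    have [measurable]: "(\<lambda>x. T x z) \<in> borel_measurable borel" by (rule has_densityD[OF T True])
    have h0: "0 \<le> h r z" by (rule has_densityD(1)[OF h True])
    have "(\<integral>\<^sup>+x. ennreal (kernel t x (z, r)) \<partial>lborel) = (\<integral>\<^sup>+x. ennreal (l z t * (indicator {0..} r * h r z)) * ennreal (T (x - r *\<^sub>R a) z) \<partial>lborel)"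
      using True l0 h0 has_densityD(1)[OF T True]
      by (intro nn_integral_cong) (simp add: kernel_def positive_time_def mult_ac flip: ennreal_mult)
    also have "\<dots> = ennreal (l z t * (indicator {0..} r * h r z)) * 1"
      by (subst nn_integral_cmult) (auto simp: T_shift_total[OF True])
    finally show ?thesis using True l0 h0 by (simp add: positive_time_def ennreal_mult)
  qed (simp add: kernel_def)
  have "(\<lambda>q. kernel t (snd q) (fst q)) \<in> borel_measurable (borel \<Otimes>\<^sub>M borel)"
    using measurable_compose[OF measurable_pair_swap' kernel_measurable[OF t]] by (simp add: case_prod_unfold)
  then have sw: "(\<lambda>q. ennreal (kernel t (snd q) (fst q))) \<in> borel_measurable (lborel \<Otimes>\<^sub>M lborel)" by simp
  have "(\<lambda>p. \<integral>\<^sup>+x. ennreal (kernel t x p) \<partial>lborel) \<in> borel_measurable lborel"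
    using lborel.borel_measurable_nn_integral_fst[OF sw] by simp
  then have m: "(\<lambda>p. \<integral>\<^sup>+x. ennreal (kernel t x p) \<partial>lborel) \<in> borel_measurable (lborel \<Otimes>\<^sub>M lborel :: (real \<times> real) measure)"
    by (simp only: lborel_prod)
  have "(\<integral>\<^sup>+p. (\<integral>\<^sup>+x. ennreal (kernel t x p) \<partial>lborel) \<partial>lborel) = (\<integral>\<^sup>+z. (\<integral>\<^sup>+r. (\<integral>\<^sup>+x. ennreal (kernel t x (z, r)) \<partial>lborel) \<partial>lborel) \<partial>lborel)"
    using lborel.nn_integral_fst[OF m] by (simp only: lborel_prod)
  also have "\<dots> = (\<integral>\<^sup>+z. ennreal (indicator {0<..} z * l z t) \<partial>lborel)"
  proof (intro nn_integral_cong)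
    fix z :: real
    show "(\<integral>\<^sup>+r. (\<integral>\<^sup>+x. ennreal (kernel t x (z, r)) \<partial>lborel) \<partial>lborel) = ennreal (indicator {0<..} z * l z t)"
    proof (cases "z > 0")
      case True
      have [measurable]: "(\<lambda>r. h r z) \<in> borel_measurable borel" by (rule has_densityD[OF h True])
      have "(\<integral>\<^sup>+r. (\<integral>\<^sup>+x. ennreal (kernel t x (z, r)) \<partial>lborel) \<partial>lborel)
        = (\<integral>\<^sup>+r. ennreal (indicator {0<..} z * l z t) * ennreal (indicator {0..} r * h r z) \<partial>lborel)"
        unfolding inner using True by (simp add: positive_time_def)
      also have "\<dots> = ennreal (indicator {0<..} z * l z t) * (\<integral>\<^sup>+r. ennreal (indicator {0..} r * h r z) \<partial>lborel)"
        by (rule nn_integral_cmult) measurable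
      finally show ?thesis by (simp add: h_total[OF True])
    qed (simp add: inner)
  qed
  also have "\<dots> = 1" by (rule l_total[OF t])
  finally show ?thesis .
qed

lemma integrable_kernel:
  assumes t: "t > 0"
  shows "integrable (lborel \<Otimes>\<^sub>M lborel) (\<lambda>(x, p). kernel t x p)"
proof (rule integrableI_nonneg)
  have m: "(\<lambda>(x, p). kernel t x p) \<in> borel_measurable (lborel \<Otimes>\<^sub>M lborel)" using kernel_measurable[OF t] by simp
  then show "(\<lambda>(x, p). kernel t x p) \<in> borel_measurable (lborel \<Otimes>\<^sub>M lborel)" .
  show "AE q in lborel \<Otimes>\<^sub>M lborel. 0 \<le> (case q of (x, p) \<Rightarrow> kernel t x p)"
    using kernel_nonneg[OF t] by (auto intro!: AE_I2)
  have m': "(\<lambda>q. ennreal (case q of (x, p) \<Rightarrow> kernel t x p)) \<in> borel_measurable (lborel \<Otimes>\<^sub>M lborel)" using m by measurable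
  have "(\<integral>\<^sup>+q. ennreal (case q of (x, p) \<Rightarrow> kernel t x p) \<partial>(lborel \<Otimes>\<^sub>M lborel)) = (\<integral>\<^sup>+p. (\<integral>\<^sup>+x. ennreal (kernel t x p) \<partial>lborel) \<partial>lborel)"
    using lborel_pair.nn_integral_snd[OF m'] by simp
  then show "(\<integral>\<^sup>+q. ennreal (case q of (x, p) \<Rightarrow> kernel t x p) \<partial>(lborel \<Otimes>\<^sub>M lborel)) < \<infinity>"
    using kernel_total[OF t] by simp
qed

text \<open>The iterated integral in the definition equals the double integral wherever the kernel is integrable in
  \<open>(z, r)\<close>, which holds for almost all \<open>x\<close> by Fubini's theorem.\<close>

lemma stable_mixture_AE:
  assumes t: "t > 0"
  shows "AE x in lborel. integrable lborel (kernel t x) \<and> stable_mixture a T h l x t = (LBINT p. kernel t x p)"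
  using lborel_pair.AE_integrable_fst[OF integrable_kernel[OF t]]
proof eventually_elim
  fix x assume i: "integrable lborel (kernel t x)"
  then have "integrable (lborel \<Otimes>\<^sub>M lborel) (kernel t x)" by (simp add: lborel_prod)
  then have "integrable (lborel \<Otimes>\<^sub>M lborel) (\<lambda>(z, r). kernel t x (z, r))" by (simp add: case_prod_beta)
  from lborel_pair.integral_fst[OF this]
  show "integrable lborel (kernel t x) \<and> stable_mixture a T h l x t = (LBINT p. kernel t x p)"
    using i unfolding stable_mixture_eq[OF t] by (simp add: lborel_prod case_prod_beta)
qed

lemma stable_mixture_measurable:
  assumes t: "t > 0"
  shows "(\<lambda>x. stable_mixture a T h l x t) \<in> borel_measurable borel"
proof -
  have 1: "(\<lambda>q :: ((real ^ 'n) \<times> real) \<times> real. (fst (fst q), (snd (fst q), snd q))) \<in> (borel \<Otimes>\<^sub>M borel) \<Otimes>\<^sub>M borel \<rightarrow>\<^sub>M borel \<Otimes>\<^sub>M borel"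
    unfolding borel_prod by (intro borel_measurable_continuous_onI continuous_intros)
  have [measurable]: "(\<lambda>q :: ((real ^ 'n) \<times> real) \<times> real. kernel t (fst (fst q)) (snd (fst q), snd q)) \<in> borel_measurable ((borel \<Otimes>\<^sub>M borel) \<Otimes>\<^sub>M borel)"
    using measurable_compose[OF 1 kernel_measurable[OF t]] by simp
  have "(\<lambda>x. LBINT z. (LBINT r. kernel t x (z, r))) \<in> borel_measurable borel" by measurable
  then show ?thesis unfolding stable_mixture_eq[OF t] .
qed

lemma integrable_stable_mixture:
  assumes t: "t > 0"
  shows "integrable lborel (\<lambda>x. stable_mixture a T h l x t)"
    and "(LBINT x. \<bar>stable_mixture a T h l x t\<bar>) = 1"
proof -
  have [measurable]: "(\<lambda>x. stable_mixture a T h l x t) \<in> borel_measurable borel" by (rule stable_mixture_measurable[OF t])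
  have i: "integrable lborel (\<lambda>x. LBINT p. kernel t x p)"
    using lborel_pair.integrable_fst[OF integrable_kernel[OF t]] .
  have ae: "AE x in lborel. stable_mixture a T h l x t = (LBINT p. kernel t x p)"
    using stable_mixture_AE[OF t] by eventually_elim simp
  show "integrable lborel (\<lambda>x. stable_mixture a T h l x t)"
    using i ae by (subst integrable_cong_AE) auto
  have "(LBINT x. \<bar>stable_mixture a T h l x t\<bar>) = (LBINT x. (LBINT p. kernel t x p))"
  proof (rule integral_cong_AE)
    show "AE x in lborel. \<bar>stable_mixture a T h l x t\<bar> = (LBINT p. kernel t x p)"
      using ae by eventually_elim (simp add: kernel_nonneg[OF t])
  qed (use i in auto)
  also have "\<dots> = (\<integral>q. (case q of (x, p) \<Rightarrow> kernel t x p) \<partial>(lborel \<Otimes>\<^sub>M lborel))"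
    by (rule lborel_pair.integral_fst[OF integrable_kernel[OF t]])
  also have "\<dots> = enn2real (\<integral>\<^sup>+q. ennreal (case q of (x, p) \<Rightarrow> kernel t x p) \<partial>(lborel \<Otimes>\<^sub>M lborel))"
    using integrable_kernel[OF t] kernel_nonneg[OF t] by (intro integral_eq_nn_integral) auto
  also have "(\<integral>\<^sup>+q. ennreal (case q of (x, p) \<Rightarrow> kernel t x p) \<partial>(lborel \<Otimes>\<^sub>M lborel)) = (\<integral>\<^sup>+p. (\<integral>\<^sup>+x. ennreal (kernel t x p) \<partial>lborel) \<partial>lborel)"
  proof -
    have "(\<lambda>q. ennreal (case q of (x, p) \<Rightarrow> kernel t x p)) \<in> borel_measurable (lborel \<Otimes>\<^sub>M lborel)" using integrable_kernel[OF t] by measurable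
    from lborel_pair.nn_integral_snd[OF this] show ?thesis by simp
  qed
  finally show "(LBINT x. \<bar>stable_mixture a T h l x t\<bar>) = 1" by (simp add: kernel_total[OF t])
qed

lemma fourier_T_shift:
  assumes z: "z > 0"
  shows "(LBINT x. iexp (\<xi> \<bullet> x) * cpx (T (x - v) z)) =
    iexp (\<xi> \<bullet> v) * cpx (exp (- z * norm \<xi> powr (2 * \<theta>)))"
proof -
  have [measurable]: "(\<lambda>x. T x z) \<in> borel_measurable borel" by (rule has_densityD[OF T z])
  have "(LBINT x. iexp (\<xi> \<bullet> x) * cpx (T (x - v) z))
     = (LBINT x. iexp (\<xi> \<bullet> (v + x)) * cpx (T x z))"
    by (subst lborel_integral_affine[of 1 _ v]) auto
  also have "\<dots> = (LBINT x. iexp (\<xi> \<bullet> v) * (cpx (T x z) * iexp (\<xi> \<bullet> x)))"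
    by (intro Bochner_Integration.integral_cong) (auto simp: inner_add_right ring_distribs exp_add)
  also have "\<dots> = iexp (\<xi> \<bullet> v) * (LBINT x. cpx (T x z) * iexp (\<xi> \<bullet> x))"
    by (rule integral_mult_right_zero)
  also have "(LBINT x. cpx (T x z) * iexp (\<xi> \<bullet> x)) = (\<integral>\<omega>. iexp (\<xi> \<bullet> S z \<omega>) \<partial>M)"
    by (rule has_density_integral[OF T z]) measurable
  also have "\<dots> = cpx (exp (- z * norm \<xi> powr (2 * \<theta>)))"
    using S z unfolding isotropic_stable_process_def by simp
  finally show ?thesis .
qed

text \<open>Integrating first over \<open>x\<close> gives \<open>exp (- z * norm \<xi> powr (2 * \<theta>))\<close> and a phase, then over \<open>r\<close> the characteristic
  function of \<open>H z\<close> at \<open>\<xi> \<bullet> a\<close>. Together these are \<open>exp (- z * \<Psi>(- \<xi>))\<close>, and the integral over \<open>z\<close> is the definition of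
  \<open>ml\<close>.\<close>

theorem fourier_stable_mixture:
  assumes t: "t > 0"
  shows "fourier (\<lambda>x. cpx (stable_mixture a T h l x t)) \<xi> = Y.ml (symbol \<theta> \<alpha> a (- \<xi>)) t"
proof -
  let ?E = "\<lambda>x. iexp (\<xi> \<bullet> x)"
  have [measurable]: "(\<lambda>x. stable_mixture a T h l x t) \<in> borel_measurable borel" by (rule stable_mixture_measurable[OF t])
  have km [measurable]: "(\<lambda>(x, p). kernel t x p) \<in> borel_measurable (lborel \<Otimes>\<^sub>M lborel)" using kernel_measurable[OF t] by simp
  have [measurable]: "(\<lambda>r. l r t) \<in> borel_measurable borel" by (rule has_densityD[OF l t])
  have int: "integrable (lborel \<Otimes>\<^sub>M lborel) (\<lambda>(x, p). ?E x * cpx (kernel t x p))"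
  proof (rule Bochner_Integration.integrable_bound[OF integrable_kernel[OF t]])
    show "(\<lambda>(x, p). ?E x * cpx (kernel t x p)) \<in> borel_measurable (lborel \<Otimes>\<^sub>M lborel)" by measurable
  qed (auto simp: norm_mult intro!: AE_I2)
  have "fourier (\<lambda>x. cpx (stable_mixture a T h l x t)) \<xi> = (LBINT x. (LBINT p. ?E x * cpx (kernel t x p)))"
    unfolding fourier_def
  proof (rule integral_cong_AE)
    show "AE x in lborel. ?E x * cpx (stable_mixture a T h l x t) = (LBINT p. ?E x * cpx (kernel t x p))"
      using stable_mixture_AE[OF t] by eventually_elim simp
  qed measurable
  also have "\<dots> = (LBINT p. (LBINT x. ?E x * cpx (kernel t x p)))"
    by (rule lborel_pair.Fubini_integral[OF int, symmetric])
  also have "\<dots> = (LBINT z. (LBINT r. (LBINT x. ?E x * cpx (kernel t x (z, r)))))"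
  proof -
    have "integrable lborel (\<lambda>p. LBINT x. ?E x * cpx (kernel t x p))"
      using lborel_pair.integrable_snd[OF int] .
    then show ?thesis by (rule lborel_integral_pair)
  qed
  also have "\<dots> = (LBINT z. cpx (indicator {0<..} z * l z t) * exp (- (symbol \<theta> \<alpha> a (- \<xi>) * cpx z)))"
  proof (intro Bochner_Integration.integral_cong refl)
    fix z :: real
    show "(LBINT r. (LBINT x. ?E x * cpx (kernel t x (z, r)))) = cpx (indicator {0<..} z * l z t) * exp (- (symbol \<theta> \<alpha> a (- \<xi>) * cpx z))"
    proof (cases "z > 0")
      case True
      let ?e = "cpx (exp (- z * norm \<xi> powr (2 * \<theta>)))"
      have 1: "(LBINT x. ?E x * cpx (kernel t x (z, r))) =
          (cpx (l z t) * ?e) * (cpx (indicator {0..} r * h r z) * iexp ((\<xi> \<bullet> a) * r))" for r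
      proof -
        have "(LBINT x. ?E x * cpx (kernel t x (z, r))) =
          (LBINT x. cpx (l z t) * cpx (indicator {0..} r * h r z) * (?E x * cpx (T (x - r *\<^sub>R a) z)))"
          using True by (intro Bochner_Integration.integral_cong) (auto simp: kernel_def positive_time_def)
        also have "\<dots> = cpx (l z t) * cpx (indicator {0..} r * h r z) * (LBINT x. ?E x * cpx (T (x - r *\<^sub>R a) z))"
          by (rule integral_mult_right_zero)
        finally show ?thesis unfolding fourier_T_shift[OF True] by (simp add: mult_ac)
      qed
      have "(LBINT r. (LBINT x. ?E x * cpx (kernel t x (z, r))))
        = (cpx (l z t) * ?e) * (LBINT r. cpx (indicator {0..} r * h r z) * iexp ((\<xi> \<bullet> a) * r))"
        unfolding 1 by (rule integral_mult_right_zero)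
      also have "(LBINT r. cpx (indicator {0..} r * h r z) * iexp ((\<xi> \<bullet> a) * r)) = (\<integral>\<omega>. iexp ((\<xi> \<bullet> a) * H z \<omega>) \<partial>M)"
        by (rule h_integral[OF True]) measurable
      also have "\<dots> = exp (- cpx z * (- \<i> * cpx (\<xi> \<bullet> a)) powr cpx \<alpha>)"
        using True \<alpha> by (intro subordinator_char[OF H]) auto
      also have "(cpx (l z t) * ?e) * \<dots> = cpx (l z t) * exp (- (symbol \<theta> \<alpha> a (- \<xi>) * cpx z))"
        unfolding exp_of_real[symmetric] mult.assoc exp_add[symmetric] symbol_def by (simp add: algebra_simps inner_commute)
      finally show ?thesis using True by simp
    qed (simp add: kernel_def)
  qed
  also have "\<dots> = (\<integral>\<omega>. exp (- (symbol \<theta> \<alpha> a (- \<xi>) * cpx (t powr \<beta> * \<bar>K 1 \<omega>\<bar> powr (- \<beta>)))) \<partial>M)"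
    by (rule l_integral[OF t]) measurable
  finally show ?thesis by (simp only: Y.ml_def)
qed

end

section \<open>Existence and uniqueness\<close>

text \<open>The Caputo derivative sees only positive times, where pairings with the mixture have a formula.\<close>

lemma has_caputo_derivative_cong:
  assumes f: "has_caputo_derivative \<beta> f D t" and eq: "\<And>s. s > 0 \<Longrightarrow> g s = f s"
  shows "has_caputo_derivative \<beta> g D t"
proof -
  have vd: "(g has_vector_derivative vector_derivative f (at s)) (at s)" if "s \<in> {0<..<t}" for s
  proof (rule has_vector_derivative_transform_within_open)
    show "(f has_vector_derivative vector_derivative f (at s)) (at s)"
      using f that by (auto simp: has_caputo_derivative_def vector_derivative_works)
    show "open {0::real<..}" "s \<in> {0<..}" using that by auto
  qed (use eq in simp)
  have e: "indicator {0<..<t} s *\<^sub>R (vector_derivative g (at s) /\<^sub>R ((t - s) powr \<beta>)) =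
      indicator {0<..<t} s *\<^sub>R (vector_derivative f (at s) /\<^sub>R ((t - s) powr \<beta>))" for s
  proof (cases "s \<in> {0<..<t}")
    case True
    then show ?thesis using vector_derivative_at[OF vd[OF True]] by simp
  qed simp
  have "\<forall>s\<in>{0<..<t}. g differentiable (at s)" by (intro ballI differentiableI_vector[OF vd])
  then show ?thesis using f unfolding has_caputo_derivative_def set_integrable_def set_lebesgue_integral_def e by blast
qed

context stable_mixture_setting
begin

lemma pairing_stable_mixture:
  assumes \<phi>: "schwartz \<phi>" and t: "t > 0"
  shows "pairing (\<lambda>x. stable_mixture a T h l x t) \<phi> =
    (LBINT \<xi>. (cpx (1 / (2 * pi) ^ DIM(real ^ 'n)) * fourier \<phi> \<xi>) * Y.ml (symbol \<theta> \<alpha> a \<xi>) t)"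
  unfolding pairing_schwartz[OF integrable_stable_mixture(1)[OF t] \<phi>] fourier_stable_mixture[OF t] minus_minus mult.assoc
  by (rule integral_mult_right_zero[symmetric])

text \<open>By Parseval's formula the pairing with \<open>\<phi>\<close> is a superposition of Mittag-Leffler functions \<open>ml (\<Psi> \<xi>)\<close>, for which
  the equation and the initial value are known; multiplication of the weight by \<open>\<Psi>\<close> is the action of the operators.\<close>

theorem stable_mixture_solves: "solves_frac_problem \<theta> \<alpha> \<beta> a (stable_mixture a T h l)"
  unfolding solves_frac_problem_def
proof (intro conjI allI impI)
  fix t :: real assume "t > 0"
  then show "integrable lborel (\<lambda>x. stable_mixture a T h l x t)" by (rule integrable_stable_mixture)
next
  fix b :: real assume "b > 0"
  show "\<exists>C. \<forall>t\<in>{0<..b}. (LINT x|lborel. \<bar>stable_mixture a T h l x t\<bar>) \<le> C"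
    by (rule exI[of _ 1]) (simp add: integrable_stable_mixture(2))
next
  fix \<phi> :: "real ^ 'n \<Rightarrow> complex" assume \<phi>: "schwartz \<phi>"
  let ?c = "cpx (1 / (2 * pi) ^ DIM(real ^ 'n))"
  let ?q = "\<lambda>\<xi>. ?c * fourier \<phi> \<xi>" and ?\<Lambda> = "symbol \<theta> \<alpha> a"
  have q: "integrable lborel ?q" by (intro integrable_mult_right integrable_fourier_schwartz \<phi>)
  have "integrable lborel (\<lambda>\<xi>. ?\<Lambda> \<xi> * fourier \<phi> \<xi>)"
    by (rule integrable_fourier_schwartz_mult[OF \<phi> borel_measurable_symbol norm_symbol_le[OF norm_a \<theta> \<alpha>]])
  then have "integrable lborel (\<lambda>\<xi>. ?c * (?\<Lambda> \<xi> * fourier \<phi> \<xi>))" by (rule integrable_mult_right)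
  then have q\<Lambda>: "integrable lborel (\<lambda>\<xi>. ?\<Lambda> \<xi> * ?q \<xi>)" by (simp only: mult_ac)
  have Re: "Re (?\<Lambda> \<xi>) \<ge> 0" for \<xi> by (rule Re_symbol_nonneg[OF \<alpha>])
  {
    fix t :: real assume t: "t > 0"
    have "has_caputo_derivative \<beta> (\<lambda>s. LBINT \<xi>. ?q \<xi> * Y.ml (?\<Lambda> \<xi>) s) (- (LBINT \<xi>. ?\<Lambda> \<xi> * ?q \<xi> * Y.ml (?\<Lambda> \<xi>) t)) t"
      by (rule Y.caputo_superposition[OF q borel_measurable_symbol Re q\<Lambda> t])
    moreover have "- (LBINT \<xi>. ?\<Lambda> \<xi> * ?q \<xi> * Y.ml (?\<Lambda> \<xi>) t) =
      - distr_frac_laplacian \<theta> (\<lambda>x. stable_mixture a T h l x t) \<phi> - distr_frac_dir_deriv \<alpha> a (\<lambda>x. stable_mixture a T h l x t) \<phi>"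
    proof -
      have "(LBINT \<xi>. ?\<Lambda> \<xi> * ?q \<xi> * Y.ml (?\<Lambda> \<xi>) t) = (LBINT \<xi>. ?c * (?\<Lambda> \<xi> * fourier \<phi> \<xi> * Y.ml (?\<Lambda> \<xi>) t))"
        by (simp only: mult_ac)
      also have "\<dots> = ?c * (LBINT \<xi>. ?\<Lambda> \<xi> * fourier \<phi> \<xi> * Y.ml (?\<Lambda> \<xi>) t)" by (rule integral_mult_right_zero)
      finally show ?thesis
        unfolding distr_operators_schwartz[OF integrable_stable_mixture(1)[OF t] \<phi> \<theta> \<alpha> norm_a] fourier_stable_mixture[OF t] minus_minus
        by (simp only:)
    qed
    ultimately have "has_caputo_derivative \<beta> (\<lambda>s. LBINT \<xi>. ?q \<xi> * Y.ml (?\<Lambda> \<xi>) s)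
      (- distr_frac_laplacian \<theta> (\<lambda>x. stable_mixture a T h l x t) \<phi> - distr_frac_dir_deriv \<alpha> a (\<lambda>x. stable_mixture a T h l x t) \<phi>) t"
      by (simp only:)
    then show "has_caputo_derivative \<beta> (\<lambda>s. pairing (\<lambda>x. stable_mixture a T h l x s) \<phi>)
      (- distr_frac_laplacian \<theta> (\<lambda>x. stable_mixture a T h l x t) \<phi> - distr_frac_dir_deriv \<alpha> a (\<lambda>x. stable_mixture a T h l x t) \<phi>) t"
      by (rule has_caputo_derivative_cong) (rule pairing_stable_mixture[OF \<phi>])
  }
  have "(LBINT \<xi>. ?q \<xi>) = \<phi> 0"
    unfolding integral_mult_right_zero using fourier_inversion_schwartz[OF \<phi>, of 0] by simp
  then have "((\<lambda>s. LBINT \<xi>. ?q \<xi> * Y.ml (?\<Lambda> \<xi>) s) \<longlongrightarrow> \<phi> 0) (at_right 0)"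
    using Y.superposition_initial[OF q borel_measurable_symbol Re] by simp
  then show "((\<lambda>t. pairing (\<lambda>x. stable_mixture a T h l x t) \<phi>) \<longlongrightarrow> \<phi> 0) (at_right 0)"
    by (rule Lim_transform_within[where d = 1]) (use pairing_stable_mixture[OF \<phi>] in auto)
qed

end

text \<open>At each frequency the difference of the transforms is a bounded solution of the homogeneous Volterra equation.\<close>

theorem solutions_unique:
  fixes w1 w2 :: "'a::euclidean_space \<Rightarrow> real \<Rightarrow> real"
  assumes w1: "solves_frac_problem \<theta> \<alpha> \<beta> a w1" and w2: "solves_frac_problem \<theta> \<alpha> \<beta> a w2"
    and \<theta>: "\<theta> \<in> {0<..<1}" and \<alpha>: "\<alpha> \<in> {0<..<1}" and \<beta>: "\<beta> \<in> {0<..<1}" and a: "norm a = 1" and t: "t > 0"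
  shows "AE x in lborel. w1 x t = w2 x t"
proof -
  note D1 = solves_frac_problemD[OF w1] and D2 = solves_frac_problemD[OF w2]
  obtain C1 where C1: "\<forall>s\<in>{0<..t}. (LINT x|lborel. \<bar>w1 x s\<bar>) \<le> C1" using D1(2)[OF t] by blast
  obtain C2 where C2: "\<forall>s\<in>{0<..t}. (LINT x|lborel. \<bar>w2 x s\<bar>) \<le> C2" using D2(2)[OF t] by blast
  have eq: "fourier (\<lambda>x. cpx (w1 x t)) \<xi> - fourier (\<lambda>x. cpx (w2 x t)) \<xi> = 0" for \<xi>
  proof (rule volterra_unique[where b = t and v = "\<lambda>s. fourier (\<lambda>x. cpx (w1 x s)) \<xi> - fourier (\<lambda>x. cpx (w2 x s)) \<xi>"
        and \<beta> = \<beta> and c = "- symbol \<theta> \<alpha> a (- \<xi>) / cpx (Gamma \<beta>)"])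
    fix s assume s: "s \<in> {0<..t}"
    then have s0: "s > 0" by simp
    show "norm (fourier (\<lambda>x. cpx (w1 x s)) \<xi> - fourier (\<lambda>x. cpx (w2 x s)) \<xi>) \<le> C1 + C2"
      using C1 C2 s by (intro norm_triangle_le_diff add_mono order_trans[OF norm_fourier_solution_le]) auto
    let ?k = "\<lambda>u. cpx (indicator {0<..<s} u * (s - u) powr (\<beta> - 1))"
    note V1 = solution_fourier_volterra[OF w1 \<theta> \<alpha> \<beta> a s0, of \<xi>] and V2 = solution_fourier_volterra[OF w2 \<theta> \<alpha> \<beta> a s0, of \<xi>]
    have "(LBINT u. ?k u * (fourier (\<lambda>x. cpx (w1 x u)) \<xi> - fourier (\<lambda>x. cpx (w2 x u)) \<xi>))
      = (LBINT u. ?k u * fourier (\<lambda>x. cpx (w1 x u)) \<xi>) - (LBINT u. ?k u * fourier (\<lambda>x. cpx (w2 x u)) \<xi>)"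
      unfolding right_diff_distrib by (rule Bochner_Integration.integral_diff[OF V1(1) V2(1)])
    then show "fourier (\<lambda>x. cpx (w1 x s)) \<xi> - fourier (\<lambda>x. cpx (w2 x s)) \<xi> =
       - symbol \<theta> \<alpha> a (- \<xi>) / cpx (Gamma \<beta>) * (LBINT u. ?k u * (fourier (\<lambda>x. cpx (w1 x u)) \<xi> - fourier (\<lambda>x. cpx (w2 x u)) \<xi>))"
      unfolding V1(2) V2(2) by (simp only:) (simp add: right_diff_distrib)
  qed (use \<beta> t in auto)
  have i: "integrable lborel (\<lambda>x. cpx (w1 x t))" "integrable lborel (\<lambda>x. cpx (w2 x t))"
    using D1(1)[OF t] D2(1)[OF t] by (simp_all add: complex_of_real_integrable_eq)
  have "AE x in lborel. w1 x t - w2 x t = 0"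
  proof (rule fourier_unique)
    show "integrable lborel (\<lambda>x. w1 x t - w2 x t)" using D1(1)[OF t] D2(1)[OF t] by simp
    show "fourier (\<lambda>x. cpx (w1 x t - w2 x t)) \<xi> = 0" for \<xi>
      using fourier_lincomb[OF i, of "-1" \<xi>] eq[of \<xi>] by simp
  qed
  then show ?thesis by eventually_elim simp
qed

theorem theorem4:
  fixes \<theta> \<alpha> \<beta> :: real
    and a :: "real ^ 'n"
    and M :: "'w measure"
    and S :: "real \<Rightarrow> 'w \<Rightarrow> real ^ 'n"
    and H K :: "real \<Rightarrow> 'w \<Rightarrow> real"
    and T :: "real ^ 'n \<Rightarrow> real \<Rightarrow> real"
    and h l :: "real \<Rightarrow> real \<Rightarrow> real"
  assumes "\<theta> \<in> {0<..<1}" and "\<alpha> \<in> {0<..<1}" and "\<beta> \<in> {0<..<1}"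
    and "a \<in> nonneg_orthant" and "norm a = 1"
    and "isotropic_stable_process \<theta> M S" and "has_density M S T"
    and "stable_subordinator \<alpha> M H" and "has_density M H h"
    and "stable_subordinator \<beta> M K" and "has_density M (inverse_process K) l"
  shows "solves_frac_problem \<theta> \<alpha> \<beta> a (stable_mixture a T h l) \<and>
    (\<forall>w. solves_frac_problem \<theta> \<alpha> \<beta> a w \<longrightarrow>
       (\<forall>t>0. AE x in lborel. w x t = stable_mixture a T h l x t))"
proof -
  interpret stable_mixture_setting \<theta> \<alpha> \<beta> a M S H K T h l
    using assms by unfold_locales
  show ?thesis
    using stable_mixture_solves solutions_unique[OF _ stable_mixture_solves assms(1-3,5)] by blast
qed
end
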